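(* Let $G$ be a planar graph and let $D$ be a diagram of a spatial embedding of $G$. Let $Y(D;A)$ be the Yamada polynomial of $D$ and $\mathfrak{J}(D;A)$ Jaeger's version of the Yamada polynomial. Then $$Y(D;A^4)=-(A^2+A^{-2})^{|E(G)|-|V(G)|+1}\;\mathfrak{J}(D;A),$$ where $E(G)$ and $V(G)$ are the sets of edges and vertices of $G$.
   Context: Graphs are finite 1-dimensional complexes; loops and multiple edges are allowed, and a closed loop without vertices is regarded as having one vertex and one edge. A spatial graph is a graph embedded (piecewise linearly) in $\mathbb{R}^3$. A diagram is a generic projection to the plane whose multiple points are transversal double points away from the vertices, with over/under information at crossings. Polynomials are elements of $\mathbb{Q}(A)$, and $\varphi=A^2+A^{-2}$. **Smoothings.** At a crossing, the $A$-smoothing is the one joining the two regions swept out when the overstrand is rotated counterclockwise to the understrand; the $B$-smoothing is the other one. **Yamada polynomial.** For an abstract graph $G$ with number of connected components $\mu(G)$ and first Betti number $\beta(G)$, let $$h(G;x,y)=\sum_{F\subset E(G)}(-x)^{-|F|}x^{\mu(G-F)}y^{\beta(G-F)},\qquad h(\emptyset)=1,$$ where $G-F$ is $G$ with the edges in $F$ deleted (all vertices kept). A state of a diagram $D$ is a function $s:\{\text{crossings of }D\}\to\{+,-,0\}$. $D_s$ is the planar graph obtained by replacing each crossing $c$ by its $A$-smoothing if $s(c)=+$, by its $B$-smoothing if $s(c)=-$, and by a vertex of degree 4 if $s(c)=0$. With $p(s)=|s^{-1}(+)|$ and $m(s)=|s^{-1}(-)|$, $$Y(D;A)=\sum_{s}A^{p(s)-m(s)}\,h(D_s;\,x=-1,\;y=-A-2-A^{-1}),\qquad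 Y(\emptyset)=1.$$ **Bracket.** For an unoriented link diagram, $\langle\cdot\rangle$ is the Kauffman bracket, invariant under Reidemeister moves II and III, with $\langle\bigcirc\rangle=1$, $\langle D\sqcup\bigcirc\rangle=(-A^2-A^{-2})\langle D\rangle$, and $\langle\text{crossing}\rangle=A\langle A\text{-smoothing}\rangle+A^{-1}\langle B\text{-smoothing}\rangle$. **Jaeger's version $\mathfrak{J}$.** (This is the specialization $a=-A^3$, $t=A$ of Jaeger's two-variable polynomial.) For a spatial graph diagram $D$, the bar diagram $B_D$ is obtained by replacing each vertex by a disk, each edge strand by a flat (blackboard) strip, and each crossing by one strip crossing over another; on each strand of $D$ between consecutive crossings/vertices the strip carries one bar (a closed curve without crossings and vertices becomes an annulus with one bar). $R$ of a band diagram with bars is determined by the following. (i) $R(\text{strip with a bar})=R(\text{same strip without the bar})+\frac{1}{\varphi}R(\text{strip cut across at the bar})$, where cutting across means that the two parallel boundary arcs of the strip are locally replaced by two caps. (ii) If $B$ has no bar, then $R(B)=\langle L_B\rangle$, where $L_B$ is the link diagram formed by the boundary of $B$. Then $\mathfrak{J}(D;A)=R(B_D)$. *)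

theory Defs
  imports
    "HOL-Library.FuncSet"
    "HOL-Combinatorics.Permutations"
    "HOL-Computational_Algebra.Polynomial"
    "HOL-Computational_Algebra.Fraction_Field"
begin

section \<open>Finite graphs with loops and multiple edges\<close>

text \<open>An edge \<open>e\<close> has the set \<open>ends G e\<close> of end vertices, a singleton when \<open>e\<close> is a loop.\<close>

record ('v, 'e) mgraph =
  gverts :: "'v set"
  gedges :: "'e set"
  ends :: "'e \<Rightarrow> 'v set"

definition finite_graph :: "('v, 'e) mgraph \<Rightarrow> bool" where
  "finite_graph G \<longleftrightarrow> finite (gverts G) \<and> finite (gedges G) \<and>
     (\<forall>e\<in>gedges G. ends G e \<subseteq> gverts G \<and> card (ends G e) \<in> {1, 2})"

definition graph_iso :: "('v, 'e) mgraph \<Rightarrow> ('w, 'f) mgraph \<Rightarrow> bool" where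
  "graph_iso G H \<longleftrightarrow> (\<exists>f g. bij_betw f (gverts G) (gverts H) \<and> bij_betw g (gedges G) (gedges H) \<and>
     (\<forall>e\<in>gedges G. ends H (g e) = f ` ends G e))"

text \<open>The classes of the equivalence relation on \<open>S\<close> generated by \<open>R\<close>.\<close>

definition gen_classes :: "'a set \<Rightarrow> ('a \<times> 'a) set \<Rightarrow> 'a set set" where
  "gen_classes S R = S // ((R \<inter> S \<times> S) \<union> (R \<inter> S \<times> S)\<inverse>)\<^sup>*"

definition num_components :: "('v, 'e) mgraph \<Rightarrow> nat" where
  "num_components G = card (gen_classes (gverts G)
     (\<Union>e\<in>gedges G. ends G e \<times> ends G e))"

text \<open>The first Betti number. For finite graphs the subtraction does not truncate.\<close>

definition betti :: "('v, 'e) mgraph \<Rightarrow> nat" where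
  "betti G = card (gedges G) + num_components G - card (gverts G)"

definition delete_edges :: "('v, 'e) mgraph \<Rightarrow> 'e set \<Rightarrow> ('v, 'e) mgraph" where
  "delete_edges G F = G\<lparr>gedges := gedges G - F\<rparr>"

definition h_poly :: "('v, 'e) mgraph \<Rightarrow> 'k::field \<Rightarrow> 'k \<Rightarrow> 'k" where
  "h_poly G x y = (\<Sum>F\<in>Pow (gedges G). (- x) powi (- int (card F)) *
     x ^ num_components (delete_edges G F) * y ^ betti (delete_edges G F))"


section \<open>Diagrams\<close>

text \<open>
  A diagram is given by its combinatorial map. The darts are the oriented strands: every strand
  between consecutive nodes (vertices or crossings) gives two darts, one leaving from each of its
  ends; \<open>base\<close> is the node at which a dart starts, \<open>opp\<close> reverses a dart, and \<open>rot\<close> takes a dart to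
  the next one counterclockwise around its base. At a crossing, \<open>over\<close> contains the two darts
  that belong to the overstrand. Nodes without darts are isolated vertices, and \<open>circles\<close> labels
  the closed curves that meet neither vertices nor crossings.
\<close>

record ('v, 'd) diagram =
  vertices :: "'v set"
  crossings :: "'v set"
  darts :: "'d set"
  circles :: "'d set"
  base :: "'d \<Rightarrow> 'v"
  rot :: "'d \<Rightarrow> 'd"
  opp :: "'d \<Rightarrow> 'd"
  over :: "'d set"

text \<open>
  Darts lying on the boundary of a common face are those connected by \<open>rot \<circ> opp\<close>.
  The map is drawn in the plane iff it has genus 0, that is, iff every connected component with
  at least one edge satisfies Euler's formula \<open>V - E + F = 2\<close>. As the genus of each component is
  nonnegative, it is enough to require the sum of these equations.
\<close>

definition planar_map :: "('v, 'd) diagram \<Rightarrow> bool" where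
  "planar_map D \<longleftrightarrow>
     (let V = base D ` darts D;
          E = gen_classes (darts D) {(d, opp D d) | d. d \<in> darts D};
          F = gen_classes (darts D) {(d, rot D (opp D d)) | d. d \<in> darts D};
          C = gen_classes (darts D) ({(d, opp D d) | d. d \<in> darts D} \<union>
                {(d, rot D d) | d. d \<in> darts D})
      in int (card V) - int (card E) + int (card F) = 2 * int (card C))"

definition spatial_diagram :: "('v, 'd) diagram \<Rightarrow> bool" where
  "spatial_diagram D \<longleftrightarrow>
     finite (vertices D) \<and> finite (crossings D) \<and> finite (darts D) \<and> finite (circles D) \<and>
     vertices D \<inter> crossings D = {} \<and> darts D \<inter> circles D = {} \<and>
     base D ` darts D \<subseteq> vertices D \<union> crossings D \<and>
     rot D permutes darts D \<and>
     (\<forall>d\<in>darts D. base D (rot D d) = base D d) \<and>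
     (\<forall>d\<in>darts D. \<forall>d'\<in>darts D. base D d = base D d' \<longrightarrow> (\<exists>n. (rot D ^^ n) d = d')) \<and>
     (\<forall>d\<in>darts D. opp D d \<in> darts D \<and> opp D d \<noteq> d \<and> opp D (opp D d) = d) \<and>
     (\<forall>x\<in>crossings D. card {d \<in> darts D. base D d = x} = 4) \<and>
     (\<forall>d\<in>darts D. base D d \<in> crossings D \<longrightarrow> (rot D d \<in> over D \<longleftrightarrow> d \<notin> over D)) \<and>
     planar_map D"

text \<open>
  \<open>resolve D K j\<close> is the abstract graph obtained from \<open>D\<close> when the nodes in \<open>K\<close> are kept as
  vertices and each other node is removed, a dart \<open>d\<close> at such a node being joined with the dart
  \<open>j d\<close>. An edge is the set of all darts that are joined together. Such a set either
  runs between nodes in \<open>K\<close> or is a closed loop without vertices; in the latter case the loop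
  counts as one edge with one vertex, and this vertex is \<open>Inr X\<close> where \<open>X\<close> is the edge.
\<close>

definition resolve ::
  "('v, 'd) diagram \<Rightarrow> 'v set \<Rightarrow> ('d \<Rightarrow> 'd) \<Rightarrow> ('v + 'd set, 'd set) mgraph" where
  "resolve D K j =
     (let E = gen_classes (darts D \<union> circles D)
                ({(d, opp D d) | d. d \<in> darts D} \<union> {(d, j d) | d. d \<in> darts D \<and> base D d \<notin> K});
          T = (\<lambda>X. {d \<in> X \<inter> darts D. base D d \<in> K})
      in \<lparr>gverts = Inl ` K \<union> Inr ` {X \<in> E. T X = {}},
          gedges = E,
          ends = (\<lambda>X. if T X = {} then {Inr X} else (Inl \<circ> base D) ` T X)\<rparr>)"

definition underlying_graph :: "('v, 'd) diagram \<Rightarrow> ('v + 'd set, 'd set) mgraph" where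
  "underlying_graph D = resolve D (vertices D) (\<lambda>d. rot D (rot D d))"

definition diagram_of :: "('v, 'd) diagram \<Rightarrow> ('a, 'b) mgraph \<Rightarrow> bool" where
  "diagram_of D G \<longleftrightarrow> spatial_diagram D \<and> graph_iso (underlying_graph D) G"

text \<open>
  A graph is planar iff it can be drawn without crossings. The two darts of an edge \<open>e\<close> can always
  be labelled by \<open>(e, True)\<close> and \<open>(e, False)\<close>, so fixing the types here is no restriction.
\<close>

definition planar_graph :: "('a, 'b) mgraph \<Rightarrow> bool" where
  "planar_graph G \<longleftrightarrow>
     (\<exists>D :: ('a, 'b \<times> bool) diagram. diagram_of D G \<and> crossings D = {})"


section \<open>States and the Yamada polynomial\<close>

datatype marker = Pos | Neg | Zero

text \<open>
  Rotating the overstrand counterclockwise, an over dart \<open>d\<close> sweeps the region between \<open>d\<close> and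
  \<open>rot d\<close>. The \<open>A\<close>-smoothing merges the two regions of this kind, hence it connects each over dart
  with the under dart preceding it counterclockwise; this under dart is \<open>rot (rot (rot d))\<close> as a
  crossing has valence 4. The value for \<open>Zero\<close> is never used.
\<close>

definition partner :: "('v, 'd) diagram \<Rightarrow> ('v \<Rightarrow> marker) \<Rightarrow> 'd \<Rightarrow> 'd" where
  "partner D s d = (case s (base D d) of
       Pos \<Rightarrow> if d \<in> over D then rot D (rot D (rot D d)) else rot D d
     | Neg \<Rightarrow> if d \<in> over D then rot D d else rot D (rot D (rot D d))
     | Zero \<Rightarrow> d)"

definition state_graph :: "('v, 'd) diagram \<Rightarrow> ('v \<Rightarrow> marker) \<Rightarrow> ('v + 'd set, 'd set) mgraph" where
  "state_graph D s = resolve D (vertices D \<union> {x \<in> crossings D. s x = Zero}) (partner D s)"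

definition state_weight :: "('v, 'd) diagram \<Rightarrow> ('v \<Rightarrow> marker) \<Rightarrow> int" where
  "state_weight D s =
     int (card {x \<in> crossings D. s x = Pos}) - int (card {x \<in> crossings D. s x = Neg})"

text \<open>
  The value at \<open>a\<close> of a Laurent polynomial attached to a diagram; for \<open>a\<close> the variable of
  \<open>\<rat>(A)\<close> this is the polynomial itself, and for \<open>a = A ^ 4\<close> it is the result of substituting.
\<close>

definition yamada :: "('v, 'd) diagram \<Rightarrow> 'k::field \<Rightarrow> 'k" where
  "yamada D a = (\<Sum>s\<in>crossings D \<rightarrow>\<^sub>E {Pos, Neg, Zero}.
     a powi state_weight D s * h_poly (state_graph D s) (- 1) (- a - 2 - inverse a))"


section \<open>The Kauffman bracket\<close>

text \<open>
  A link diagram is a diagram in which every vertex has valence 2; these vertices are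
  marked points on the link and play no role. Expanding all crossings by the skein relation leaves
  closed curves, one for each component of \<open>state_graph D s\<close>, and \<open>n\<close> disjoint closed curves have
  the value \<open>(- a\<^sup>2 - a\<^sup>-\<^sup>2) ^ (n - 1)\<close>. The exponent is an integer: it
  is \<open>- 1\<close> for the empty diagram, as the rule for adding a disjoint circle requires.
\<close>

definition bracket :: "('v, 'd) diagram \<Rightarrow> 'k::field \<Rightarrow> 'k" where
  "bracket D a = (\<Sum>s\<in>crossings D \<rightarrow>\<^sub>E {Pos, Neg}.
     a powi state_weight D s *
     (- (a powi 2) - a powi (- 2)) powi (int (num_components (state_graph D s)) - 1))"


section \<open>Band diagrams and Jaeger's polynomial\<close>

text \<open>
  The band surface of \<open>D\<close> has a disk for each vertex and a flat strip for each strand. Its boundary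
  is a link diagram whose nodes are the corners of \<open>D\<close>: the corner \<open>d\<close> is the sector at the node
  \<open>base D d\<close> between \<open>d\<close> and \<open>rot D d\<close>.

  Looking in the direction of \<open>d\<close>, the strip of \<open>d\<close> starts with a left boundary arc \<open>OutL d\<close>, at
  the corner \<open>d\<close>, and a right boundary arc \<open>OutR d\<close>, at the preceding corner.
  If \<open>base D d\<close> is a vertex, then the corner \<open>d\<close> is a marked point on the boundary of the disk,
  where \<open>OutL d\<close> and \<open>OutR (rot D d)\<close> meet.
  If \<open>base D d\<close> is a crossing, then the corner \<open>d\<close> is the crossing of the left boundary of the strip
  of \<open>d\<close> and the right boundary of the strip of \<open>rot D d\<close>; these two strands continue
  from there into the interior of the band crossing as \<open>In1 d\<close> and \<open>In2 d\<close> respectively, so that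
  \<open>OutL d, OutR (rot D d), In1 d, In2 d\<close> is the counterclockwise order.
  The inner strands join the four corners in a cycle, \<open>In1 d\<close> leading to the corner \<open>rot D d\<close>.

  An isolated vertex \<open>v\<close> has the boundary curve \<open>Disk v\<close>. A closed curve \<open>c\<close> without
  vertices and crossings yields an annulus with boundary curves \<open>Rim1 c\<close> and \<open>Rim2 c\<close>, or,
  if it is cut across, a disk with boundary curve \<open>Rim1 c\<close>.
\<close>

datatype ('v, 'd) bdart = OutL 'd | OutR 'd | In1 'd | In2 'd | Disk 'v | Rim1 'd | Rim2 'd

text \<open>Strands are the sets \<open>{d, opp D d}\<close> and \<open>{c}\<close>.\<close>

definition strands :: "('v, 'd) diagram \<Rightarrow> 'd set set" where
  "strands D = {{d, opp D d} | d. d \<in> darts D} \<union> {{c} | c. c \<in> circles D}"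

definition crossing_darts :: "('v, 'd) diagram \<Rightarrow> 'd set" where
  "crossing_darts D = {d \<in> darts D. base D d \<in> crossings D}"

fun bd_corner :: "('v, 'd) diagram \<Rightarrow> ('v, 'd) bdart \<Rightarrow> 'd" where
  "bd_corner D (OutL d) = d"
| "bd_corner D (OutR d) = inv (rot D) d"
| "bd_corner D (In1 d) = d"
| "bd_corner D (In2 d) = d"
| "bd_corner D _ = undefined"

fun bd_rot :: "('v, 'd) diagram \<Rightarrow> ('v, 'd) bdart \<Rightarrow> ('v, 'd) bdart" where
  "bd_rot D (OutL d) = OutR (rot D d)"
| "bd_rot D (OutR d) = (let d' = inv (rot D) d in if d' \<in> crossing_darts D then In1 d' else OutL d')"
| "bd_rot D (In1 d) = In2 d"
| "bd_rot D (In2 d) = OutL d"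
| "bd_rot D b = b"

text \<open>Cutting a strip across replaces its two parallel boundary arcs by two caps.\<close>

fun bd_opp :: "('v, 'd) diagram \<Rightarrow> 'd set set \<Rightarrow> ('v, 'd) bdart \<Rightarrow> ('v, 'd) bdart" where
  "bd_opp D cuts (OutL d) = (if d \<in> \<Union> cuts then OutR d else OutR (opp D d))"
| "bd_opp D cuts (OutR d) = (if d \<in> \<Union> cuts then OutL d else OutL (opp D d))"
| "bd_opp D cuts (In1 d) = In2 (rot D d)"
| "bd_opp D cuts (In2 d) = In1 (inv (rot D) d)"
| "bd_opp D cuts b = b"

fun bd_over :: "('v, 'd) diagram \<Rightarrow> ('v, 'd) bdart \<Rightarrow> bool" where
  "bd_over D (OutL d) \<longleftrightarrow> d \<in> over D"
| "bd_over D (OutR d) \<longleftrightarrow> d \<in> over D"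
| "bd_over D (In1 d) \<longleftrightarrow> d \<in> over D"
| "bd_over D (In2 d) \<longleftrightarrow> rot D d \<in> over D"
| "bd_over D _ \<longleftrightarrow> False"

text \<open>
  The boundary link of the band surface of \<open>D\<close> in which the strips of the strands in \<open>cuts\<close> have
  been cut across.
\<close>

definition boundary_link ::
  "('v, 'd) diagram \<Rightarrow> 'd set set \<Rightarrow> ('d, ('v, 'd) bdart) diagram" where
  "boundary_link D cuts =
     (let X = crossing_darts D;
          B = OutL ` darts D \<union> OutR ` darts D \<union> In1 ` X \<union> In2 ` X
      in \<lparr>vertices = darts D - X,
          crossings = X,
          darts = B,
          circles = Disk ` (vertices D - base D ` darts D) \<union> Rim1 ` circles D \<union>
            Rim2 ` (circles D - \<Union> cuts),
          base = bd_corner D,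
          rot = (\<lambda>b. if b \<in> B then bd_rot D b else b),
          opp = bd_opp D cuts,
          over = {b \<in> B. bd_over D b}\<rparr>)"

definition phi :: "'k::field \<Rightarrow> 'k" where
  "phi a = a powi 2 + a powi (- 2)"

text \<open>
  The function \<open>R\<close> on the band surface of \<open>D\<close> with the strands in \<open>cuts\<close> cut across and with a
  bar on each of the strands in \<open>bars\<close>. The two lemmas are its defining rules.
\<close>

definition R_poly :: "('v, 'd) diagram \<Rightarrow> 'd set set \<Rightarrow> 'd set set \<Rightarrow> 'k::field \<Rightarrow> 'k" where
  "R_poly D bars cuts a =
     (\<Sum>F\<in>Pow bars. (1 / phi a) ^ card F * bracket (boundary_link D (cuts \<union> F)) a)"

lemma R_poly_bar:
  assumes "finite bars" and "b \<in> bars"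
  shows "R_poly D bars cuts a =
    R_poly D (bars - {b}) cuts a + 1 / phi a * R_poly D (bars - {b}) (insert b cuts) a"
proof -
  define B where "B = bars - {b}"
  have B: "bars = insert b B" "b \<notin> B" "finite B"
    using assms by (auto simp: B_def)
  define f where "f F = (1 / phi a) ^ card F * bracket (boundary_link D (cuts \<union> F)) a" for F
  have "sum f (Pow bars) = sum f (Pow B) + sum f (insert b ` Pow B)"
    unfolding B(1) Pow_insert by (rule sum.union_disjoint) (use B in auto)
  also have "sum f (insert b ` Pow B) = (\<Sum>F\<in>Pow B. f (insert b F))"
    by (subst sum.reindex) (use B in \<open>auto intro!: inj_onI\<close>)
  also have "\<dots> = (\<Sum>F\<in>Pow B. 1 / phi a *
      ((1 / phi a) ^ card F * bracket (boundary_link D (insert b cuts \<union> F)) a))"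
  proof (rule sum.cong [OF refl])
    fix F assume "F \<in> Pow B"
    then have "card (insert b F) = Suc (card F)"
      using B by (metis PowD card_insert_disjoint finite_subset subsetD)
    then show "f (insert b F) = 1 / phi a *
        ((1 / phi a) ^ card F * bracket (boundary_link D (insert b cuts \<union> F)) a)"
      by (simp add: f_def)
  qed
  finally show ?thesis
    unfolding R_poly_def B_def [symmetric] by (simp add: f_def sum_distrib_left)
qed

lemma R_poly_no_bar: "R_poly D {} cuts a = bracket (boundary_link D cuts) a"
  by (simp add: R_poly_def)

definition jaeger :: "('v, 'd) diagram \<Rightarrow> 'k::field \<Rightarrow> 'k" where
  "jaeger D a = R_poly D (strands D) {} a"


section \<open>The variable of \<open>\<rat>(A)\<close>\<close>

definition var_A :: "rat poly fract" where
  "var_A = Fract [:0, 1:] 1"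

end

theory Submission
  imports Defs
begin

text \<open>
  Cutting a strip at a bar with weight \<open>1 / phi\<close> projects the two parallel boundary arcs onto the
  part killed by turnbacks, since a closed curve has the value \<open>- phi\<close>. Hence in the expansion of
  the four crossings at which two bands cross, every smoothing in which some strip end turns back
  cancels. Of the remaining seven smoothings one gives the \<open>A\<close>-smoothing of the bands with weight
  \<open>a ^ 4\<close>, one the \<open>B\<close>-smoothing with weight \<open>a ^ - 4\<close>, and five give a disk at which the four
  strips meet, with total weight \<open>phi\<close>. So both sides are sums over the states of \<open>D\<close>, and it remains
  to compare the values of each state, which is a planar graph: a planar surface with \<open>\<mu>\<close>
  components and first Betti number \<open>\<beta>\<close> has \<open>\<mu> + \<beta>\<close> boundary curves. Planarity of
  states and of cut surfaces holds because genus 0 is preserved when a cycle of one of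
  the two permutations of a combinatorial map is split. Finally, an edge of a state consists of several
  strands; cutting it once more only separates a further disk and changes the sign, so that the sum over
  cut strands reduces to the sum over cut edges.
\<close>


section \<open>Classes of generated equivalence relations\<close>

text \<open>The exponent, the sign and the substitution come from one Euler count. Let c be the
  number of boundary curves of a state surface with mu components after cutting the strips in F, let
  Z be the number of crossings kept as vertices, and beta = c - mu. Genus 0 gives c + |F| = |E(G)| -
  |V(G)| + Z + 2 mu. Hence, apart from the small circles inside band crossings,
  -phi^(|E(G)|-|V(G)|+1) phi^(-|F|) (-phi)^(c-1) equals (-1)^c phi^(2 beta - Z). The factor phi^(-Z)
  is absorbed by the weight phi of each kept crossing, and (-1)^c phi^(2 beta) = (-1)^mu
  (-phi^2)^beta is a term of h at x = -1. Since phi^2 = a^4 + 2 + a^-4, its y is the one of the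
  Yamada polynomial at a^4. The obstacle is that planarity is given only as an equation between
  numbers of classes, with no curves in a plane to look at. Therefore surfaces are encoded by
  permutations of a fixed set of darts: a smoothing or a cut is a composition with a transposition,
  and boundary curves are cycles of a product.\<close>

definition conn :: "'a set \<Rightarrow> ('a \<times> 'a) set \<Rightarrow> ('a \<times> 'a) set" where
  "conn S R = ((R \<inter> S \<times> S) \<union> (R \<inter> S \<times> S)\<inverse>)\<^sup>*"

definition cls :: "'a set \<Rightarrow> ('a \<times> 'a) set \<Rightarrow> 'a \<Rightarrow> 'a set" where
  "cls S R x = conn S R `` {x}"

definition nc :: "'a set \<Rightarrow> ('a \<times> 'a) set \<Rightarrow> nat" where
  "nc S R = card (gen_classes S R)"

text \<open>Reflexivity holds outside \<open>S\<close> too, because \<open>conn\<close> is a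
  reflexive transitive closure on the whole type; \<open>nc\<close> counts only the classes of
  elements of \<open>S\<close>.\<close>

lemma conn_refl [simp]: "(x, x) \<in> conn S R"
  by (simp add: conn_def)

lemma conn_sym: "(x, y) \<in> conn S R \<Longrightarrow> (y, x) \<in> conn S R"
proof -
  have "sym (conn S R)"
    unfolding conn_def by (rule sym_rtrancl) (auto simp: sym_def)
  then show "(x, y) \<in> conn S R \<Longrightarrow> (y, x) \<in> conn S R"
    by (auto dest: symD)
qed

lemma conn_trans: "(x, y) \<in> conn S R \<Longrightarrow> (y, z) \<in> conn S R \<Longrightarrow> (x, z) \<in> conn S R"
  unfolding conn_def by (rule rtrancl_trans)

lemma conn_link: "(x, y) \<in> R \<Longrightarrow> x \<in> S \<Longrightarrow> y \<in> S \<Longrightarrow> (x, y) \<in> conn S R"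
  unfolding conn_def by auto

text \<open>Induction along a chain of links, done once. Later arguments only name a quantity that
  does not change along a single link; with a membership test as \<open>f\<close> it shows that a
  set is a union of classes.\<close>

lemma conn_invariant:
  assumes "(x, y) \<in> conn S R"
    and "\<And>u v. (u, v) \<in> R \<Longrightarrow> u \<in> S \<Longrightarrow> v \<in> S \<Longrightarrow> f u = f v"
  shows "f x = f y"
  using assms(1) unfolding conn_def
  by (induction rule: rtrancl_induct) (auto dest: assms(2))

lemma cls_eq_iff: "cls S R x = cls S R y \<longleftrightarrow> (x, y) \<in> conn S R"
  unfolding cls_def by (auto intro: conn_sym conn_trans dest: equalityD1)

lemma cls_link: "(x, y) \<in> R \<Longrightarrow> x \<in> S \<Longrightarrow> y \<in> S \<Longrightarrow> cls S R x = cls S R y"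
  by (simp add: cls_eq_iff conn_link)

lemma mem_cls_iff: "y \<in> cls S R x \<longleftrightarrow> (x, y) \<in> conn S R"
  by (simp add: cls_def)

lemma self_mem_cls [simp]: "x \<in> cls S R x"
  by (simp add: cls_def)

lemma cls_eqI: "y \<in> cls S R x \<Longrightarrow> cls S R y = cls S R x"
  by (metis cls_eq_iff mem_cls_iff)

lemma cls_subset:
  assumes "x \<in> A" and "\<And>u v. (u, v) \<in> R \<Longrightarrow> u \<in> S \<Longrightarrow> v \<in> S \<Longrightarrow> u \<in> A \<longleftrightarrow> v \<in> A"
  shows "cls S R x \<subseteq> A"
proof
  fix y assume "y \<in> cls S R x"
  then have "(x \<in> A) = (y \<in> A)"
    using conn_invariant [of x y S R "\<lambda>z. z \<in> A"] assms(2) by (simp add: mem_cls_iff)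
  with assms(1) show "y \<in> A" by simp
qed

lemma cls_subset_carrier: "x \<in> S \<Longrightarrow> cls S R x \<subseteq> S"
  by (rule cls_subset) auto

lemma gen_classes_eq: "gen_classes S R = cls S R ` S"
  by (auto simp: gen_classes_def quotient_def cls_def conn_def)

text \<open>\<open>f\<close> only has to be a complete invariant of the classes on \<open>S\<close>.
  Nodes, strands, graph components and boundary curves are counted by naming such an
  \<open>f\<close> and computing its image.\<close>

lemma nc_eq_card_image:
  assumes "\<And>x y. x \<in> S \<Longrightarrow> y \<in> S \<Longrightarrow> f x = f y \<longleftrightarrow> (x, y) \<in> conn S R"
  shows "nc S R = card (f ` S)"
proof -
  have "bij_betw (\<lambda>X. f (SOME x. x \<in> X \<inter> S)) (cls S R ` S) (f ` S)"
  proof -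
    have *: "f (SOME y. y \<in> cls S R x \<inter> S) = f x" if "x \<in> S" for x
    proof -
      have "(SOME y. y \<in> cls S R x \<inter> S) \<in> cls S R x \<inter> S"
        by (rule someI [of _ x]) (use that in simp)
      then show ?thesis
        using assms [of "SOME y. y \<in> cls S R x \<inter> S" x] that
        by (auto simp: mem_cls_iff intro: conn_sym)
    qed
    let ?h = "\<lambda>X. f (SOME x. x \<in> X \<inter> S)"
    have "inj_on ?h (cls S R ` S)"
    proof (rule inj_onI)
      fix X Y assume "X \<in> cls S R ` S" "Y \<in> cls S R ` S" and eq: "?h X = ?h Y"
      then obtain x y where xy: "x \<in> S" "y \<in> S" "X = cls S R x" "Y = cls S R y" by blast
      have "f x = f y"
        using eq unfolding xy(3,4) * [OF xy(1)] * [OF xy(2)] .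
      then show "X = Y" using assms xy by (simp add: cls_eq_iff)
    qed
    moreover have "?h ` cls S R ` S = f ` S"
      unfolding image_image by (rule image_cong [OF refl]) (rule *)
    ultimately show ?thesis by (simp add: bij_betw_def)
  qed
  then show ?thesis
    by (simp add: nc_def gen_classes_eq bij_betw_same_card)
qed

lemma nc_eq: "nc S R = card (cls S R ` S)"
  by (simp add: nc_def gen_classes_eq)

lemma nc_transfer:
  assumes "\<And>x. x \<in> S \<Longrightarrow> g x \<in> S'"
    and "\<And>x y. x \<in> S \<Longrightarrow> y \<in> S \<Longrightarrow> (g x, g y) \<in> conn S' R' \<longleftrightarrow> (x, y) \<in> conn S R"
    and "\<And>y. y \<in> S' \<Longrightarrow> \<exists>x\<in>S. (g x, y) \<in> conn S' R'"
  shows "nc S R = nc S' R'"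
proof -
  have "nc S R = card ((\<lambda>x. cls S' R' (g x)) ` S)"
    by (rule nc_eq_card_image) (use assms(2) in \<open>auto simp: cls_eq_iff\<close>)
  also have "(\<lambda>x. cls S' R' (g x)) ` S = cls S' R' ` S'"
  proof
    show "(\<lambda>x. cls S' R' (g x)) ` S \<subseteq> cls S' R' ` S'"
      using assms(1) by auto
    show "cls S' R' ` S' \<subseteq> (\<lambda>x. cls S' R' (g x)) ` S"
      using assms(3) cls_eq_iff by fastforce
  qed
  finally show ?thesis by (simp add: nc_eq)
qed

lemma conn_mono:
  assumes "\<And>u v. (u, v) \<in> R \<Longrightarrow> u \<in> S \<Longrightarrow> v \<in> S \<Longrightarrow> (u, v) \<in> conn S R'"
  shows "conn S R \<subseteq> conn S R'"
proof
  fix p assume "p \<in> conn S R"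
  then obtain x y where p: "p = (x, y)" "(x, y) \<in> conn S R" by (cases p) auto
  have "cls S R' x = cls S R' y"
    by (rule conn_invariant [OF p(2)]) (use assms in \<open>auto simp: cls_eq_iff\<close>)
  with p show "p \<in> conn S R'" by (simp add: cls_eq_iff)
qed

lemma conn_subset: "R \<subseteq> R' \<Longrightarrow> conn S R \<subseteq> conn S R'"
  by (rule conn_mono) (auto intro: conn_link)

lemma conn_eqI:
  assumes "\<And>u v. (u, v) \<in> R \<Longrightarrow> u \<in> S \<Longrightarrow> v \<in> S \<Longrightarrow> (u, v) \<in> conn S R'"
    and "\<And>u v. (u, v) \<in> R' \<Longrightarrow> u \<in> S \<Longrightarrow> v \<in> S \<Longrightarrow> (u, v) \<in> conn S R"
  shows "conn S R = conn S R'"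
  using conn_mono [of R S R'] conn_mono [of R' S R] assms by blast

lemma nc_cong_conn: "conn S R = conn S R' \<Longrightarrow> nc S R = nc S R'"
  by (simp add: nc_eq cls_def)

text \<open>Every coarse class is a union of fine ones, so sending a fine class to the coarse class
  around it is onto.\<close>

lemma nc_antimono:
  assumes "finite S" and "conn S R \<subseteq> conn S R'"
  shows "nc S R' \<le> nc S R"
proof -
  have "cls S R' ` S = (\<lambda>X. \<Union> (cls S R' ` X)) ` (cls S R ` S)"
  proof -
    have "\<Union> (cls S R' ` cls S R x) = cls S R' x" for x
    proof -
      have "cls S R' y = cls S R' x" if "y \<in> cls S R x" for y
        using that assms(2) by (auto simp: mem_cls_iff cls_eq_iff intro: conn_sym)
      then show ?thesis using self_mem_cls [of x S R] by blast
    qed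
    then show ?thesis by (simp add: image_image)
  qed
  then show ?thesis
    by (simp add: nc_eq card_image_le assms(1))
qed

lemma conn_insert_mono: "conn S R \<subseteq> conn S (insert p R)"
  by (rule conn_mono) (auto intro: conn_link)

lemma nc_insert_connected:
  assumes "(a, b) \<in> conn S R"
  shows "nc S (insert (a, b) R) = nc S R"
  by (rule nc_cong_conn, rule conn_eqI) (use assms in \<open>auto intro: conn_link\<close>)

lemma nc_insert_disconnected:
  assumes "finite S" "a \<in> S" "b \<in> S" "(a, b) \<notin> conn S R"
  shows "nc S R = Suc (nc S (insert (a, b) R))"
proof -
  let ?R = "insert (a, b) R"
  \<comment> \<open>Relabelling the class of \<open>b\<close> by that of \<open>a\<close> is what
    the new link does; the label that disappears is the class of \<open>b\<close>, hence the
    \<open>Suc\<close>.\<close>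
  define f where "f x = (if cls S R x = cls S R b then cls S R a else cls S R x)" for x
  have ab: "(a, b) \<in> conn S ?R" by (rule conn_link) (use assms in auto)
  have sub: "(x, y) \<in> conn S ?R" if "(x, y) \<in> conn S R" for x y
    using that conn_insert_mono by blast
  have "nc S ?R = card (f ` S)"
  proof (rule nc_eq_card_image)
    fix x y assume "x \<in> S" "y \<in> S"
    show "f x = f y \<longleftrightarrow> (x, y) \<in> conn S ?R"
    proof
      assume "(x, y) \<in> conn S ?R"
      then show "f x = f y"
        by (rule conn_invariant) (auto simp: f_def dest: cls_link)
    next
      have c: "(z, if cls S R z = cls S R b then a else z) \<in> conn S ?R" for z
        using ab by (auto simp: cls_eq_iff intro: sub conn_sym conn_trans)
      assume "f x = f y"
      then have "(if cls S R x = cls S R b then a else x, if cls S R y = cls S R b then a else y) \<in> conn S R"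
        unfolding f_def by (auto simp: cls_eq_iff split: if_splits)
      with c show "(x, y) \<in> conn S ?R"
        by (meson conn_sym conn_trans sub)
    qed
  qed
  also have "f ` S = cls S R ` S - {cls S R b}"
  proof -
    have "cls S R a \<noteq> cls S R b" using assms(4) by (simp add: cls_eq_iff)
    then show ?thesis using assms(2) by (auto simp: f_def)
  qed
  also have "Suc (card \<dots>) = card (cls S R ` S)"
    by (rule card_Suc_Diff1) (use assms in auto)
  finally show ?thesis by (simp add: nc_eq)
qed

text \<open>Without links every element is a class of its own, and each link merges at most two
  classes. For a connected set this bounds the number of links from below, and so the number of path
  ends from above.\<close>

lemma card_le_nc_plus_card:
  assumes "finite S" "finite R"
  shows "card S \<le> nc S R + card R"
  using assms(2)
proof (induction R)
  case empty
  have "nc S {} = card (id ` S)"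
  proof (rule nc_eq_card_image)
    fix x y
    show "id x = id y \<longleftrightarrow> (x, y) \<in> conn S {}"
      using conn_invariant [of x y S "{}" id] by auto
  qed
  then show ?case by simp
next
  case (insert p R)
  obtain a b where p: "p = (a, b)" by (cases p)
  show ?case
  proof (cases "a \<in> S \<and> b \<in> S \<and> (a, b) \<notin> conn S R")
    case True
    then show ?thesis using nc_insert_disconnected [of S a b R] insert assms p by simp
  next
    case False
    have "conn S (insert p R) = conn S R"
      by (rule conn_eqI) (use False p in \<open>auto intro: conn_link\<close>)
    then have "nc S (insert p R) = nc S R" by (rule nc_cong_conn)
    then show ?thesis using insert by simp
  qed
qed

lemma nc_add_isolated:
  assumes "finite S" "finite Q" "S \<inter> Q = {}" and "\<And>u v. (u, v) \<in> R \<Longrightarrow> u \<in> S \<and> v \<in> S"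
  shows "nc (S \<union> Q) R = nc S R + card Q"
proof -
  define f where "f x = (if x \<in> S then Inl (cls S R x) else Inr x)" for x
  have "nc (S \<union> Q) R = card (f ` (S \<union> Q))"
  proof (rule nc_eq_card_image)
    fix x y assume xy: "x \<in> S \<union> Q" "y \<in> S \<union> Q"
    have "R \<inter> (S \<union> Q) \<times> (S \<union> Q) = R \<inter> S \<times> S" using assms(4) by auto
    then have c: "conn (S \<union> Q) R = conn S R" by (simp add: conn_def)
    show "f x = f y \<longleftrightarrow> (x, y) \<in> conn (S \<union> Q) R"
    proof
      assume "f x = f y"
      then show "(x, y) \<in> conn (S \<union> Q) R"
        unfolding c by (auto simp: f_def cls_eq_iff split: if_splits)
    next
      assume "(x, y) \<in> conn (S \<union> Q) R"
      then show "f x = f y"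
        by (rule conn_invariant) (use assms(4) in \<open>auto simp: f_def dest: cls_link\<close>)
    qed
  qed
  also have "f ` (S \<union> Q) = Inl ` (cls S R ` S) \<union> Inr ` Q"
    using assms(3) by (auto simp: f_def image_iff)
  also have "card \<dots> = card (cls S R ` S) + card Q"
    by (subst card_Un_disjoint) (use assms in \<open>auto simp: card_image\<close>)
  finally show ?thesis by (simp add: nc_eq)
qed


section \<open>Cycles of permutations and genus\<close>

definition gr :: "'a set \<Rightarrow> ('a \<Rightarrow> 'a) \<Rightarrow> ('a \<times> 'a) set" where
  "gr S f = {(x, f x) | x. x \<in> S}"

lemma gr_iff [simp]: "(x, y) \<in> gr S f \<longleftrightarrow> x \<in> S \<and> y = f x"
  by (auto simp: gr_def)

lemma funpow_in_permutes: "p permutes S \<Longrightarrow> x \<in> S \<Longrightarrow> (p ^^ n) x \<in> S"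
  by (induction n) (auto simp: permutes_in_image)

lemma funpow_return_permutes:
  assumes "p permutes S" "finite S" "x \<in> S"
  obtains n where "0 < n" "(p ^^ n) x = x"
proof -
  have "finite {y. \<exists>n. y = (p ^^ n) x}"
    by (rule finite_subset [OF _ assms(2)]) (auto intro: funpow_in_permutes assms)
  then show ?thesis
    using funpow_inj_finite [of p x] permutes_inj [OF assms(1)] that by blast
qed

lemma conn_funpow:
  assumes "\<And>x. x \<in> S \<Longrightarrow> f x \<in> S" "gr S f \<subseteq> R" "x \<in> S"
  shows "(x, (f ^^ n) x) \<in> conn S R"
proof -
  have "(f ^^ n) x \<in> S \<and> (x, (f ^^ n) x) \<in> conn S R"
  proof (induction n)
    case (Suc n)
    then have "((f ^^ n) x, f ((f ^^ n) x)) \<in> conn S R"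
      using assms by (intro conn_link) auto
    with Suc show ?case using assms(1) conn_trans by fastforce
  qed (use assms in auto)
  then show ?thesis ..
qed

text \<open>Links may be traversed backwards, yet forward iterates suffice: on a finite set a cycle
  returns to its start, so the predecessor of a point is also one of its later iterates.\<close>

lemma conn_permutes_iff:
  assumes p: "p permutes S" "finite S" "x \<in> S"
  shows "(x, y) \<in> conn S (gr S p) \<longleftrightarrow> (\<exists>n. (p ^^ n) x = y)"
proof
  assume "\<exists>n. (p ^^ n) x = y"
  then show "(x, y) \<in> conn S (gr S p)"
    using conn_funpow [of S p "gr S p" x] permutes_in_image [OF p(1)] p(3) by auto
next
  let ?P = "{z. \<exists>n. (p ^^ n) x = z}"
  assume "(x, y) \<in> conn S (gr S p)"
  then have "(x \<in> ?P) = (y \<in> ?P)"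
  proof (rule conn_invariant [where f = "\<lambda>z. z \<in> ?P"])
    fix u v assume "(u, v) \<in> gr S p"
    then have v: "v = p u" by simp
    show "(u \<in> ?P) = (v \<in> ?P)"
    proof
      assume "u \<in> ?P"
      then obtain n where "(p ^^ n) x = u" by blast
      then have "(p ^^ Suc n) x = v" using v by simp
      then show "v \<in> ?P" by blast
    next
      assume "v \<in> ?P"
      then obtain n where n: "(p ^^ n) x = p u" using v by blast
      obtain k where k: "0 < k" "(p ^^ k) x = x" using funpow_return_permutes [OF p] .
      \<comment> \<open>For \<open>n = 0\<close> the point before \<open>x\<close> is reached only
        at the end of a full turn, as iterate \<open>k - 1\<close>.\<close>
      obtain m where "p ((p ^^ m) x) = p u"
      proof (cases n)
        case 0
        with n k that [of "k - 1"] show ?thesis by (cases k) auto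
      next
        case (Suc m)
        with n that [of m] show ?thesis by simp
      qed
      then have "(p ^^ m) x = u" using permutes_inj [OF p(1)] by (simp add: inj_eq)
      then show "u \<in> ?P" by blast
    qed
  qed
  moreover have "x \<in> ?P" by (auto intro: exI [of _ 0])
  ultimately show "\<exists>n. (p ^^ n) x = y" by blast
qed

definition cyc :: "'a set \<Rightarrow> ('a \<Rightarrow> 'a) \<Rightarrow> nat" where
  "cyc S f = nc S (gr S f)"

lemma permutes_comp_transpose:
  "p permutes S \<Longrightarrow> a \<in> S \<Longrightarrow> b \<in> S \<Longrightarrow> p \<circ> transpose a b permutes S"
  by (rule permutes_compose [OF permutes_swap_id])

lemma comp_transpose_twice [simp]: "p \<circ> transpose a b \<circ> transpose a b = p"
  by (simp add: comp_assoc)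

lemma conn_comp_transpose:
  assumes p: "p permutes S" "a \<in> S" "b \<in> S" and R: "gr S p \<subseteq> R" "(a, b) \<in> conn S R"
  shows "gr S (p \<circ> transpose a b) \<subseteq> conn S R"
proof -
  have *: "(x, p x) \<in> conn S R" if "x \<in> S" for x
    using R that permutes_in_image [OF p(1)] by (intro conn_link) auto
  have "(a, p b) \<in> conn S R" "(b, p a) \<in> conn S R"
    using * p R(2) by (blast intro: conn_trans conn_sym)+
  then show ?thesis using * p by (auto simp: gr_def transpose_def)
qed

text \<open>The transposition only exchanges the images of \<open>a\<close> and \<open>b\<close>, so
  both permutations generate the same classes once \<open>a\<close> and \<open>b\<close> are linked.
  Counts before and after a transposition are compared through this common relation.\<close>

lemma conn_insert_transpose:
  assumes p: "p permutes S" "a \<in> S" "b \<in> S"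
  shows "conn S (insert (a, b) (gr S (p \<circ> transpose a b) \<union> R)) = conn S (insert (a, b) (gr S p \<union> R))"
proof -
  have *: "conn S (insert (a, b) (gr S (q \<circ> transpose a b) \<union> R)) \<subseteq> conn S (insert (a, b) (gr S q \<union> R))"
    if q: "q permutes S" for q
  proof (rule conn_mono)
    fix u v assume uv: "(u, v) \<in> insert (a, b) (gr S (q \<circ> transpose a b) \<union> R)" "u \<in> S" "v \<in> S"
    have "(a, b) \<in> conn S (insert (a, b) (gr S q \<union> R))"
      by (rule conn_link) (use p in auto)
    moreover from this have "gr S (q \<circ> transpose a b) \<subseteq> conn S (insert (a, b) (gr S q \<union> R))"
      by (intro conn_comp_transpose) (use q p in auto)
    ultimately show "(u, v) \<in> conn S (insert (a, b) (gr S q \<union> R))"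
      using uv conn_link [of u v "insert (a, b) (gr S q \<union> R)" S] by blast
  qed
  show ?thesis
    using * [OF p(1)] * [OF permutes_comp_transpose [OF p]] by simp
qed

text \<open>A transposition across two cycles joins them: from \<open>a\<close> the new permutation
  goes to \<open>p b\<close> and then follows the old cycle of \<open>b\<close>, which avoids
  \<open>a\<close>, until it reaches \<open>b\<close>.\<close>

lemma conn_transpose_if_disconnected:
  assumes p: "p permutes S" "finite S" "a \<in> S" "b \<in> S"
    and ab: "(a, b) \<notin> conn S (gr S p)"
  shows "(a, b) \<in> conn S (gr S (p \<circ> transpose a b))"
proof (rule ccontr)
  let ?q = "p \<circ> transpose a b"
  define P where "P = cls S (gr S ?q) a"
  assume "(a, b) \<notin> conn S (gr S ?q)"
  then have bP: "b \<notin> P" by (simp add: P_def mem_cls_iff)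
  have aP: "a \<in> P" by (simp add: P_def)
  have q: "?q permutes S" using p by (simp add: permutes_comp_transpose)
  have closed: "?q x \<in> P" if "x \<in> P" for x
  proof -
    have "x \<in> S" using that cls_subset_carrier [of a S] p(3) unfolding P_def by blast
    then have "(x, ?q x) \<in> conn S (gr S ?q)"
      using permutes_in_image [OF q] by (intro conn_link) auto
    with that show ?thesis unfolding P_def by (auto simp: mem_cls_iff intro: conn_trans)
  qed
  have "(p ^^ Suc n) b \<in> P" for n
  proof (induction n)
    case 0
    show ?case using closed [OF aP] by simp
  next
    case (Suc n)
    have "(p ^^ Suc n) b \<noteq> a"
      using ab conn_permutes_iff [OF p(1,2,4)] conn_sym by metis
    moreover have "(p ^^ Suc n) b \<noteq> b" using Suc bP by auto
    ultimately show ?case using closed [OF Suc] by (simp add: transpose_def)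
  qed
  moreover obtain k where "0 < k" "(p ^^ k) b = b"
    using funpow_return_permutes [OF p(1,2,4)] .
  ultimately show False using bP by (metis gr0_implies_Suc)
qed

text \<open>A transposition within one cycle breaks it. The old arc from \<open>p a\<close> to
  \<open>b\<close> is closed under the new permutation, because the new image of \<open>b\<close> is
  \<open>p a\<close>, and it does not contain \<open>a\<close>.\<close>

lemma disconn_transpose_if_connected:
  assumes p: "p permutes S" "finite S" "a \<in> S" "b \<in> S" "a \<noteq> b"
    and ab: "(a, b) \<in> conn S (gr S p)"
  shows "(a, b) \<notin> conn S (gr S (p \<circ> transpose a b))"
proof
  let ?q = "p \<circ> transpose a b"
  \<comment> \<open>Minimality keeps \<open>a\<close> out of the arc \<open>P\<close>: a return to
    \<open>a\<close> on the way would leave a shorter way to \<open>b\<close>.\<close>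
  define m where "m = (LEAST n. (p ^^ n) a = b)"
  have ex: "\<exists>n. (p ^^ n) a = b" using ab conn_permutes_iff [OF p(1-3)] by blast
  then have m: "(p ^^ m) a = b" unfolding m_def by (rule LeastI_ex)
  have least: "(p ^^ n) a \<noteq> b" if "n < m" for n
    using that not_less_Least unfolding m_def by blast
  define P where "P = (\<lambda>i. (p ^^ i) a) ` {1..m}"
  have "m \<noteq> 0" using m p(5) by (intro notI) auto
  have bP: "b \<in> P" unfolding P_def using m \<open>m \<noteq> 0\<close> by force
  have aP: "a \<notin> P"
  proof
    assume "a \<in> P"
    then obtain i where i: "1 \<le> i" "i \<le> m" "(p ^^ i) a = a" unfolding P_def by force
    have "(p ^^ (m - i)) ((p ^^ i) a) = b"
      using m i(2) by (metis funpow_add comp_apply le_add_diff_inverse2)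
    then show False using least [of "m - i"] i \<open>m \<noteq> 0\<close> by auto
  qed
  have "?q x \<in> P" if x: "x \<in> P" for x
  proof (cases "x = b")
    case True
    then show ?thesis using \<open>m \<noteq> 0\<close> unfolding P_def by (force simp: transpose_def image_iff intro: bexI [of _ 1])
  next
    case False
    obtain i where i: "1 \<le> i" "i \<le> m" "x = (p ^^ i) a" using x unfolding P_def by force
    have "i \<noteq> m" using False i m by auto
    then have "p x \<in> P" unfolding P_def using i by (force simp: image_iff intro: bexI [of _ "Suc i"])
    then show ?thesis using False aP x by (auto simp: transpose_def)
  qed
  then have *: "(?q ^^ n) b \<in> P" for n by (induction n) (use bP in auto)
  assume "(a, b) \<in> conn S (gr S ?q)"
  then have "(b, a) \<in> conn S (gr S ?q)" by (rule conn_sym)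
  then show False
    using * aP conn_permutes_iff [OF permutes_comp_transpose [OF p(1,3,4)] p(2,4)] by metis
qed

lemma cyc_merge:
  assumes p: "p permutes S" "finite S" "a \<in> S" "b \<in> S"
    and ab: "(a, b) \<notin> conn S (gr S p)"
  shows "cyc S p = Suc (cyc S (p \<circ> transpose a b))"
proof -
  have "nc S (insert (a, b) (gr S (p \<circ> transpose a b))) = nc S (insert (a, b) (gr S p))"
    using conn_insert_transpose [OF p(1,3,4), of "{}"] by (intro nc_cong_conn) simp
  moreover have "nc S (insert (a, b) (gr S (p \<circ> transpose a b))) = nc S (gr S (p \<circ> transpose a b))"
    by (rule nc_insert_connected [OF conn_transpose_if_disconnected [OF assms]])
  ultimately show ?thesis
    using nc_insert_disconnected [OF p(2-4) ab] by (simp add: cyc_def)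
qed

lemma cyc_split:
  assumes p: "p permutes S" "finite S" "a \<in> S" "b \<in> S" "a \<noteq> b"
    and ab: "(a, b) \<in> conn S (gr S p)"
  shows "cyc S (p \<circ> transpose a b) = Suc (cyc S p)"
  using cyc_merge [OF permutes_comp_transpose [OF p(1,3,4)] p(2-4) disconn_transpose_if_connected [OF assms]]
  by simp

text \<open>Applying \<open>q\<close> conjugates one product into the other, so the cycles
  correspond.\<close>

lemma cyc_comp_commute:
  assumes "p permutes S" "q permutes S"
  shows "cyc S (p \<circ> q) = cyc S (q \<circ> p)"
  unfolding cyc_def
proof (rule nc_transfer [where g = q])
  have *: "(f x, f y) \<in> conn S (gr S (f \<circ> g))"
    if "(x, y) \<in> conn S (gr S (g \<circ> f))" "f permutes S" "g permutes S" for f g x y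
  proof -
    have "cls S (gr S (f \<circ> g)) (f x) = cls S (gr S (f \<circ> g)) (f y)"
      using that(1)
    proof (rule conn_invariant [where f = "\<lambda>x. cls S (gr S (f \<circ> g)) (f x)"])
      fix u v assume "(u, v) \<in> gr S (g \<circ> f)" "u \<in> S"
      then show "cls S (gr S (f \<circ> g)) (f u) = cls S (gr S (f \<circ> g)) (f v)"
        using that by (intro cls_link) (auto simp: permutes_in_image)
    qed
    then show ?thesis by (simp add: cls_eq_iff)
  qed
  fix x y assume xy: "x \<in> S" "y \<in> S"
  show "(q x, q y) \<in> conn S (gr S (q \<circ> p)) \<longleftrightarrow> (x, y) \<in> conn S (gr S (p \<circ> q))"
  proof
    assume "(q x, q y) \<in> conn S (gr S (q \<circ> p))"
    then have "(p (q x), p (q y)) \<in> conn S (gr S (p \<circ> q))" using * assms by blast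
    moreover have "(z, p (q z)) \<in> conn S (gr S (p \<circ> q))" if "z \<in> S" for z
      using that assms by (intro conn_link) (auto simp: permutes_in_image)
    ultimately show "(x, y) \<in> conn S (gr S (p \<circ> q))"
      using xy conn_sym conn_trans by metis
  qed (use * assms in blast)
next
  fix y assume "y \<in> S"
  then obtain x where "x \<in> S" "q x = y" using assms(2) by (metis permutes_image imageE)
  then show "\<exists>x\<in>S. (q x, y) \<in> conn S (gr S (q \<circ> p))" by (auto intro!: bexI [of _ x])
qed (use assms in \<open>auto simp: permutes_in_image\<close>)

text \<open>This is nonnegativity of the genus of a hypermap with nodes \<open>p\<close>, edges
  \<open>q\<close> and the product as faces. Removing a transposition from \<open>q\<close> raises
  its cycle number by one. If the transposition joins points that are connected without it, the
  components stay and the faces change by at most one; otherwise it merges two components and with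
  them two faces.\<close>

lemma genus_nonneg:
  assumes "p permutes S" "q permutes S" "finite S"
  shows "cyc S p + cyc S q + cyc S (p \<circ> q) \<le> card S + 2 * nc S (gr S p \<union> gr S q)"
  using assms(2)
proof (induction "card {x. q x \<noteq> x}" arbitrary: q rule: less_induct)
  case less
  show ?case
  proof (cases "\<exists>a. q a \<noteq> a")
    case False
    then have q: "q = id" by auto
    have "cyc S id = card S"
      unfolding cyc_def
    proof (subst nc_eq_card_image [where f = id])
      fix x y
      show "id x = id y \<longleftrightarrow> (x, y) \<in> conn S (gr S id)"
        using conn_invariant [of x y S "gr S id" id] by auto
    qed simp
    moreover have "conn S (gr S p \<union> gr S id) = conn S (gr S p)"
      by (rule conn_eqI) (auto intro: conn_link)
    ultimately show ?thesis using q by (simp add: cyc_def nc_eq cls_def)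
  next
    case True
    then obtain a where a: "q a \<noteq> a" by blast
    \<comment> \<open>With this choice \<open>r\<close> fixes \<open>b\<close> and moves nothing
      that \<open>q\<close> fixes, so the induction measure drops.\<close>
    define b where "b = q a"
    define r where "r = q \<circ> transpose a b"
    have ab: "a \<in> S" "b \<in> S" "a \<noteq> b"
      using a less.prems by (auto simp: b_def permutes_in_image dest: permutes_not_in)
    have r: "r permutes S" "q = r \<circ> transpose a b"
      using less.prems ab by (auto simp: r_def permutes_comp_transpose)
    have qab: "(a, b) \<in> conn S (gr S q)" using ab by (intro conn_link) (auto simp: b_def)
    have cr: "cyc S r = Suc (cyc S q)"
      unfolding r_def by (rule cyc_split) (use less.prems assms ab qab in auto)
    have fin: "finite {x. q x \<noteq> x}"
      by (rule finite_subset [OF _ assms(3)]) (use less.prems permutes_not_in in fastforce)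
    have "{x. r x \<noteq> x} \<subset> {x. q x \<noteq> x}"
    proof -
      have "r b = b" by (simp add: r_def b_def)
      moreover have "q b \<noteq> b"
        using a permutes_inj [OF less.prems] by (auto simp: b_def inj_eq)
      moreover have "q x \<noteq> x" if "r x \<noteq> x" for x
      proof (cases "x = a \<or> x = b")
        case False
        then show ?thesis using that by (simp add: r_def transpose_def)
      qed (use a that \<open>r b = b\<close> in auto)
      ultimately show ?thesis by blast
    qed
    then have IH: "cyc S p + cyc S r + cyc S (p \<circ> r) \<le> card S + 2 * nc S (gr S p \<union> gr S r)"
      using r(1) by (intro less.hyps) (auto intro: psubset_card_mono fin)
    let ?Rr = "gr S p \<union> gr S r" and ?Rq = "gr S p \<union> gr S q"
    have eq: "conn S (insert (a, b) ?Rq) = conn S (insert (a, b) ?Rr)"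
      using conn_insert_transpose [OF r(1) ab(1,2), of "gr S p"] r(2) by (simp add: Un_commute)
    have "(a, b) \<in> conn S ?Rq" using ab by (intro conn_link) (auto simp: b_def)
    from nc_insert_connected [OF this] have nq: "nc S ?Rq = nc S (insert (a, b) ?Rr)"
      using nc_cong_conn [OF eq] by simp
    have pr: "p \<circ> r permutes S" "p \<circ> q = (p \<circ> r) \<circ> transpose a b"
      using permutes_compose [OF r(1) assms(1)] r(2) by (auto simp: comp_assoc)
    show ?thesis
    proof (cases "(a, b) \<in> conn S ?Rr")
      case True
      then have "nc S ?Rq = nc S ?Rr" using nq nc_insert_connected by metis
      moreover have "cyc S (p \<circ> q) \<le> Suc (cyc S (p \<circ> r))"
        unfolding pr(2) using cyc_split [OF pr(1) assms(3) ab] cyc_merge [OF pr(1) assms(3) ab(1,2)]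
        by (cases "(a, b) \<in> conn S (gr S (p \<circ> r))") auto
      ultimately show ?thesis using IH cr by simp
    next
      case False
      then have n: "nc S ?Rr = Suc (nc S ?Rq)" using nq nc_insert_disconnected [OF assms(3) ab(1,2)] by simp
      have "conn S (gr S (p \<circ> r)) \<subseteq> conn S ?Rr"
      proof (rule conn_mono)
        fix u v assume uv: "(u, v) \<in> gr S (p \<circ> r)" "u \<in> S" "v \<in> S"
        have "r u \<in> S" using uv r(1) by (simp add: permutes_in_image)
        then have "(u, r u) \<in> conn S ?Rr" "(r u, p (r u)) \<in> conn S ?Rr"
          using uv by (auto intro!: conn_link)
        then show "(u, v) \<in> conn S ?Rr" using uv by (auto intro: conn_trans)
      qed
      then have "(a, b) \<notin> conn S (gr S (p \<circ> r))" using False by blast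
      then have "cyc S (p \<circ> r) = Suc (cyc S (p \<circ> q))"
        unfolding pr(2) using cyc_merge [OF pr(1) assms(3) ab(1,2)] by simp
      then show ?thesis using IH cr n by simp
    qed
  qed
qed

text \<open>For an involution \<open>q\<close> without fixed points,
  \<open>card S = 2 * cyc S q\<close>, and the equation becomes Euler's formula V - E + F = 2C. The
  general form admits fixed points of \<open>q\<close>, which are the loose ends of cut strands, and
  it treats both permutations alike.\<close>

definition genus0 :: "'a set \<Rightarrow> ('a \<Rightarrow> 'a) \<Rightarrow> ('a \<Rightarrow> 'a) \<Rightarrow> bool" where
  "genus0 S p q \<longleftrightarrow>
     cyc S p + cyc S q + cyc S (p \<circ> q) = card S + 2 * nc S (gr S p \<union> gr S q)"

lemma genus0_commute:
  assumes "p permutes S" "q permutes S"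
  shows "genus0 S p q \<longleftrightarrow> genus0 S q p"
  using cyc_comp_commute [OF assms] by (simp add: genus0_def Un_commute add.commute)

lemma conn_comp_subset:
  assumes "p permutes S" "q permutes S"
  shows "conn S (gr S (p \<circ> q)) \<subseteq> conn S (gr S p \<union> gr S q)"
proof (rule conn_mono)
  fix u v assume uv: "(u, v) \<in> gr S (p \<circ> q)" "u \<in> S" "v \<in> S"
  have "q u \<in> S" using uv assms by (simp add: permutes_in_image)
  then have "(u, q u) \<in> conn S (gr S p \<union> gr S q)" "(q u, p (q u)) \<in> conn S (gr S p \<union> gr S q)"
    using uv by (auto intro!: conn_link)
  then show "(u, v) \<in> conn S (gr S p \<union> gr S q)" using uv by (auto intro: conn_trans)
qed

text \<open>Splitting a cycle of \<open>q\<close> adds 1 on the left. If a face splits as well, the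
  left side gains 2, while the component count rises by at most 1. If two faces merge, the left side
  stays, and \<open>a\<close> and \<open>b\<close> remain connected. So the genus cannot grow, and
  \<open>genus_nonneg\<close> gives the other inequality.\<close>

lemma genus0_split_right:
  assumes g: "genus0 S p q" and p: "p permutes S" and q: "q permutes S" and fin: "finite S"
    and ab: "a \<in> S" "b \<in> S" "a \<noteq> b" "(a, b) \<in> conn S (gr S q)"
  shows "genus0 S p (q \<circ> transpose a b)"
proof -
  define r where "r = q \<circ> transpose a b"
  have r: "r permutes S" unfolding r_def using q ab by (simp add: permutes_comp_transpose)
  have cr: "cyc S r = Suc (cyc S q)"
    unfolding r_def by (rule cyc_split) (use q fin ab in auto)
  let ?Rr = "gr S p \<union> gr S r" and ?Rq = "gr S p \<union> gr S q"
  have eq: "conn S (insert (a, b) ?Rr) = conn S (insert (a, b) ?Rq)"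
    using conn_insert_transpose [OF q ab(1,2), of "gr S p"] by (simp add: Un_commute r_def)
  have "(a, b) \<in> conn S ?Rq"
    using ab(4) conn_subset [of "gr S q" ?Rq S] by blast
  then have nq: "nc S ?Rq = nc S (insert (a, b) ?Rr)"
    using nc_cong_conn [OF eq] nc_insert_connected by metis
  have pq: "p \<circ> q permutes S" "p \<circ> r = (p \<circ> q) \<circ> transpose a b"
    using permutes_compose [OF q p] by (auto simp: comp_assoc r_def)
  have "cyc S p + cyc S r + cyc S (p \<circ> r) \<ge> card S + 2 * nc S ?Rr"
  proof (cases "(a, b) \<in> conn S (gr S (p \<circ> q))")
    case True
    then have "cyc S (p \<circ> r) = Suc (cyc S (p \<circ> q))"
      unfolding pq(2) by (rule cyc_split [OF pq(1) fin ab(1-3)])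
    moreover have "nc S ?Rr \<le> Suc (nc S (insert (a, b) ?Rr))"
      using nc_insert_connected [of a b S ?Rr] nc_insert_disconnected [of S a b ?Rr] fin ab
      by (cases "(a, b) \<in> conn S ?Rr") auto
    ultimately show ?thesis using g cr nq by (simp add: genus0_def)
  next
    case False
    then have "cyc S (p \<circ> q) = Suc (cyc S (p \<circ> r))"
      unfolding pq(2) by (rule cyc_merge [OF pq(1) fin ab(1,2)])
    moreover have "(a, b) \<in> conn S (gr S (p \<circ> r))"
      unfolding pq(2) by (rule conn_transpose_if_disconnected [OF pq(1) fin ab(1,2) False])
    then have "(a, b) \<in> conn S ?Rr" using conn_comp_subset [OF p r] by blast
    then have "nc S ?Rr = nc S ?Rq" using nq nc_insert_connected by metis
    ultimately show ?thesis using g cr by (simp add: genus0_def)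
  qed
  with genus_nonneg [OF p r fin] show ?thesis by (simp add: genus0_def r_def)
qed

lemma genus0_split_left:
  assumes "genus0 S p q" "p permutes S" "q permutes S" "finite S"
    and "a \<in> S" "b \<in> S" "a \<noteq> b" "(a, b) \<in> conn S (gr S p)"
  shows "genus0 S (p \<circ> transpose a b) q"
  using genus0_split_right [of S q p a b] assms
  by (simp add: genus0_commute permutes_comp_transpose)


section \<open>Resolutions of diagrams\<close>

text \<open>\<open>L\<close> takes one pair from every two-element orbit, so connecting along
  \<open>L\<close> costs only half as many links as there are moved points. Parity is recorded
  separately because an upper bound would leave a single path end possible.\<close>

lemma involution_links:
  assumes "finite P" and "\<And>x. x \<in> P \<Longrightarrow> f x \<in> P" and "\<And>x. x \<in> P \<Longrightarrow> f (f x) = x"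
  shows "\<exists>L. finite L \<and> 2 * card L + card {x \<in> P. f x = x} \<le> card P \<and>
           even (card P + card {x \<in> P. f x = x}) \<and>
           (\<forall>x\<in>P. f x = x \<or> (x, f x) \<in> L \<or> (f x, x) \<in> L)"
  using assms
proof (induction "card P" arbitrary: P rule: less_induct)
  case less
  show ?case
  proof (cases "\<exists>x\<in>P. f x \<noteq> x")
    case False
    then have "{x \<in> P. f x = x} = P" by auto
    then show ?thesis using False by (intro exI [of _ "{}"]) auto
  next
    case True
    then obtain x where x: "x \<in> P" "f x \<noteq> x" by blast
    let ?P = "P - {x, f x}"
    have fx: "f x \<in> P" "f (f x) = x" using less.prems x by auto
    have cardP: "card P = card ?P + 2"
      using card_Diff_subset [of "{x, f x}" P] card_mono [of P "{x, f x}"] less.prems(1) x fx by auto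
    have "f y \<in> ?P" if "y \<in> ?P" for y
      using that less.prems(2,3) [of y] fx x by auto
    moreover have "f (f y) = y" if "y \<in> ?P" for y using that less.prems(3) by blast
    ultimately obtain L where L: "finite L" "2 * card L + card {y \<in> ?P. f y = y} \<le> card ?P"
      "even (card ?P + card {y \<in> ?P. f y = y})"
      "\<forall>y\<in>?P. f y = y \<or> (y, f y) \<in> L \<or> (f y, y) \<in> L"
      using less.hyps [of ?P] cardP less.prems(1) by auto
    have "{y \<in> P. f y = y} = {y \<in> ?P. f y = y}" using x fx by auto
    moreover have "card (insert (x, f x) L) \<le> Suc (card L)" by (simp add: card_insert_if L(1))
    moreover have "\<forall>y\<in>P. f y = y \<or> (y, f y) \<in> insert (x, f x) L \<or> (f y, y) \<in> insert (x, f x) L"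
      using L(4) fx by auto
    ultimately show ?thesis
      using L cardP by (intro exI [of _ "insert (x, f x) L"]) auto
  qed
qed

text \<open>The links of two involutions form paths and cycles, and only the ends of a path are fixed points.\<close>

lemma fixed_points_two_involutions:
  assumes P: "finite P" "x \<in> P" and cl: "P \<subseteq> cls S R x"
    and f: "\<And>x. x \<in> P \<Longrightarrow> f x \<in> P" "\<And>x. x \<in> P \<Longrightarrow> f (f x) = x"
    and g: "\<And>x. x \<in> P \<Longrightarrow> g x \<in> P" "\<And>x. x \<in> P \<Longrightarrow> g (g x) = x"
    and R: "\<And>u v. (u, v) \<in> R \<Longrightarrow> u \<in> P \<or> v \<in> P \<Longrightarrow> u \<in> P \<and> v \<in> P \<and> (v = f u \<or> v = g u)"
  shows "card {x \<in> P. f x = x} + card {x \<in> P. g x = x} \<in> {0, 2}"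
proof -
  obtain L where L: "finite L" "2 * card L + card {x \<in> P. f x = x} \<le> card P"
    "even (card P + card {x \<in> P. f x = x})" "\<forall>x\<in>P. f x = x \<or> (x, f x) \<in> L \<or> (f x, x) \<in> L"
    using involution_links [of P f] P(1) f by blast
  obtain M where M: "finite M" "2 * card M + card {x \<in> P. g x = x} \<le> card P"
    "even (card P + card {x \<in> P. g x = x})" "\<forall>x\<in>P. g x = x \<or> (x, g x) \<in> M \<or> (g x, x) \<in> M"
    using involution_links [of P g] P(1) g by blast
  have single: "cls P (L \<union> M) y = cls P (L \<union> M) x" if "y \<in> P" for y
  proof -
    let ?h = "\<lambda>z. if z \<in> P then cls P (L \<union> M) z else {}"
    have *: "cls P (L \<union> M) u = cls P (L \<union> M) v" if "u \<in> P" "v \<in> P" "v = f u \<or> v = g u" for u v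
    proof -
      have "u = v \<or> (u, v) \<in> L \<union> M \<or> (v, u) \<in> L \<union> M" using bspec [OF L(4) that(1)] bspec [OF M(4) that(1)] that(3) by auto
      then show ?thesis using that cls_link [of u v "L \<union> M" P] cls_link [of v u "L \<union> M" P] by auto
    qed
    have "(x, y) \<in> conn S R" using cl that by (auto simp: mem_cls_iff)
    then have "?h x = ?h y"
    proof (rule conn_invariant)
      fix u v assume uv: "(u, v) \<in> R"
      show "?h u = ?h v"
      proof (cases "u \<in> P \<or> v \<in> P")
        case True
        from R [OF uv this] have "u \<in> P" "v \<in> P" "v = f u \<or> v = g u" by auto
        then show ?thesis using * [of u v] by simp
      qed simp
    qed
    then show ?thesis using that P by auto
  qed
  have "cls P (L \<union> M) ` P = (\<lambda>_. cls P (L \<union> M) x) ` P"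
    by (rule image_cong [OF refl single])
  also have "\<dots> = {cls P (L \<union> M) x}" using P(2) by blast
  finally have "nc P (L \<union> M) = 1" by (simp add: nc_eq)
  \<comment> \<open>\<open>P\<close> is one class under the links of \<open>L\<close> and
    \<open>M\<close>. Doubling this inequality and inserting the bounds for
    \<open>2 * card L\<close> and \<open>2 * card M\<close> leaves at most two fixed points.\<close>
  then have "card P \<le> 1 + card (L \<union> M)"
    using card_le_nc_plus_card [of P "L \<union> M"] P(1) L(1) M(1) by simp
  also have "card (L \<union> M) \<le> card L + card M" by (rule card_Un_le)
  finally have "card {x \<in> P. f x = x} + card {x \<in> P. g x = x} \<le> 2" using L(2) M(2) by linarith
  moreover have "even (card {x \<in> P. f x = x} + card {x \<in> P. g x = x})" using L(3) M(3) by presburger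
  moreover have "n \<in> {0, 2}" if "n \<le> 2" "even n" for n :: nat
    using that by (cases "n = 1") auto
  ultimately show ?thesis by blast
qed

text \<open>The same setting serves the states of \<open>D\<close>, the graph underlying
  \<open>D\<close>, and the states of the boundary link. At removed nodes \<open>j\<close> pairs the
  darts off; at kept nodes the rotation has to be transitive.\<close>

locale resolution =
  fixes D :: "('v, 'd) diagram" and K :: "'v set" and j :: "'d \<Rightarrow> 'd"
  assumes fin: "finite (darts D)" "finite (circles D)" "finite K"
    and disj: "darts D \<inter> circles D = {}"
    and opp: "\<And>d. d \<in> darts D \<Longrightarrow> opp D d \<in> darts D"
      "\<And>d. d \<in> darts D \<Longrightarrow> opp D d \<noteq> d" "\<And>d. d \<in> darts D \<Longrightarrow> opp D (opp D d) = d"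
    and j: "\<And>d. d \<in> darts D \<Longrightarrow> base D d \<notin> K \<Longrightarrow> j d \<in> darts D"
      "\<And>d. d \<in> darts D \<Longrightarrow> base D d \<notin> K \<Longrightarrow> base D (j d) = base D d"
      "\<And>d. d \<in> darts D \<Longrightarrow> base D d \<notin> K \<Longrightarrow> j (j d) = d"
      "\<And>d. d \<in> darts D \<Longrightarrow> base D d \<notin> K \<Longrightarrow> j d \<noteq> d"
    and rot: "\<And>d. d \<in> darts D \<Longrightarrow> rot D d \<in> darts D"
      "\<And>d. d \<in> darts D \<Longrightarrow> base D (rot D d) = base D d"
      "\<And>d d'. d \<in> darts D \<Longrightarrow> d' \<in> darts D \<Longrightarrow> base D d = base D d' \<Longrightarrow> base D d \<in> K \<Longrightarrow>
         \<exists>n. (rot D ^^ n) d = d'"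
begin

definition arcs :: "'d set" where
  "arcs = darts D \<union> circles D"

text \<open>\<open>edge_links F\<close> joins darts within the edges of the resolution when the strands in \<open>F\<close> are
  cut; \<open>links F\<close> joins moreover the edges meeting at a node of \<open>K\<close>.\<close>

definition edge_links :: "'d set set \<Rightarrow> ('d \<times> 'd) set" where
  "edge_links F = {(d, opp D d) | d. d \<in> darts D \<and> d \<notin> \<Union>F} \<union>
     {(d, j d) | d. d \<in> darts D \<and> base D d \<notin> K}"

definition turn :: "'d \<Rightarrow> 'd" where
  "turn d = (if base D d \<in> K then rot D d else j d)"

definition links :: "'d set set \<Rightarrow> ('d \<times> 'd) set" where
  "links F = {(d, opp D d) | d. d \<in> darts D \<and> d \<notin> \<Union>F} \<union> {(d, turn d) | d. d \<in> darts D}"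

abbreviation "piece F \<equiv> cls arcs (edge_links F)"
abbreviation "edge_of \<equiv> piece {}"

definition tips :: "'d set \<Rightarrow> 'd set" where
  "tips X = {d \<in> X \<inter> darts D. base D d \<in> K}"

lemma finite_arcs: "finite arcs"
  by (simp add: arcs_def fin)

lemma turn_in: "d \<in> darts D \<Longrightarrow> turn d \<in> darts D"
  by (simp add: turn_def j rot)

lemma edges_eq: "gedges (resolve D K j) = edge_of ` arcs"
  by (simp add: resolve_def Let_def gen_classes_eq arcs_def edge_links_def)

lemma verts_eq: "gverts (resolve D K j) = Inl ` K \<union> Inr ` {X \<in> edge_of ` arcs. tips X = {}}"
  by (simp add: resolve_def Let_def gen_classes_eq arcs_def edge_links_def tips_def)

lemma ends_eq: "ends (resolve D K j) X = (if tips X = {} then {Inr X} else (Inl \<circ> base D) ` tips X)"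
  by (auto simp: resolve_def Let_def gen_classes_eq arcs_def edge_links_def tips_def)

lemma strand_closed:
  assumes "F \<subseteq> strands D" "d \<in> darts D"
  shows "opp D d \<in> \<Union>F \<longleftrightarrow> d \<in> \<Union>F"
proof -
  have "opp D d' \<in> \<Union>F" if d': "d' \<in> \<Union>F" "d' \<in> darts D" for d'
  proof -
    obtain X where X: "X \<in> F" "d' \<in> X" using d'(1) by blast
    then consider e where "X = {e, opp D e}" "e \<in> darts D" | c where "X = {c}" "c \<in> circles D"
      using assms(1) by (auto simp: strands_def)
    then have "opp D d' \<in> X"
      using X(2) d'(2) disj opp(3) by cases auto
    with X(1) show ?thesis by blast
  qed
  then show ?thesis using assms(2) opp by metis
qed

text \<open>Both darts of a cut strand become fixed points. Loose ends at cuts and ends at kept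
  nodes are then the fixed points of two involutions, the second being \<open>j\<close> extended by
  the identity.\<close>

definition opp_cut :: "'d set set \<Rightarrow> 'd \<Rightarrow> 'd" where
  "opp_cut F d = (if d \<in> \<Union>F then d else opp D d)"

lemma piece_darts: "x \<in> darts D \<Longrightarrow> piece F x \<subseteq> darts D"
  by (rule cls_subset) (auto simp: edge_links_def opp j)

lemma piece_circle:
  assumes "x \<in> circles D"
  shows "piece F x = {x}"
proof -
  have "piece F x \<subseteq> {x}"
    by (rule cls_subset) (use assms disj opp(1) j(1) in \<open>auto simp: edge_links_def\<close>)
  then show ?thesis using self_mem_cls [of x] by blast
qed

lemma piece_opp:
  "y \<in> piece F x \<Longrightarrow> y \<in> darts D \<Longrightarrow> y \<notin> \<Union>F \<Longrightarrow> opp D y \<in> piece F x"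
  using cls_link [of y "opp D y" "edge_links F" arcs] cls_eqI [of y arcs _ x] opp
    self_mem_cls [of "opp D y"]
  by (auto simp: arcs_def edge_links_def)

lemma piece_j:
  "y \<in> piece F x \<Longrightarrow> y \<in> darts D \<Longrightarrow> base D y \<notin> K \<Longrightarrow> j y \<in> piece F x"
  using cls_link [of y "j y" "edge_links F" arcs] cls_eqI [of y arcs _ x] j
    self_mem_cls [of "j y"]
  by (auto simp: arcs_def edge_links_def)

lemma piece_subset_edge: "piece F x \<subseteq> edge_of x"
  unfolding cls_def using conn_subset [of "edge_links F" "edge_links {}" arcs]
  by (auto simp: edge_links_def)

text \<open>A piece is always closed under \<open>j\<close>; closure under \<open>opp D\<close>,
  even across cuts, leaves no link leading out of it.\<close>

lemma piece_closed_eq_edge: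
  assumes "x \<in> darts D" and "\<And>y. y \<in> piece F x \<Longrightarrow> opp D y \<in> piece F x"
  shows "piece F x = edge_of x"
proof
  have "u \<in> piece F x \<longleftrightarrow> v \<in> piece F x" if uv: "(u, v) \<in> edge_links {}" for u v
  proof -
    consider "u \<in> darts D" "v = opp D u" | "u \<in> darts D" "v = j u" "base D u \<notin> K"
      using uv by (auto simp: edge_links_def)
    then show ?thesis
    proof cases
      case 1
      then show ?thesis using assms(2) [of u] assms(2) [of v] opp by auto
    next
      case 2
      then show ?thesis using piece_j [of u F x] piece_j [of v F x] j by auto
    qed
  qed
  then show "edge_of x \<subseteq> piece F x" by (intro cls_subset) auto
qed (rule piece_subset_edge)

text \<open>A piece is a path or a cycle, and its ends are the darts at kept nodes and the darts at
  cuts. The later case distinctions on pieces rest on counting these ends, of which there are none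
  or two.\<close>

lemma piece_fixed_points:
  assumes F: "F \<subseteq> strands D" and x: "x \<in> darts D"
  shows "card (tips (piece F x)) + card (piece F x \<inter> \<Union>F) \<in> {0, 2}"
proof -
  let ?P = "piece F x"
  let ?g = "\<lambda>d. if base D d \<in> K then d else j d"
  have sub: "?P \<subseteq> darts D" by (rule piece_darts [OF x])
  have "card {y \<in> ?P. opp_cut F y = y} + card {y \<in> ?P. ?g y = y} \<in> {0, 2}"
  proof (rule fixed_points_two_involutions [where S = arcs and R = "edge_links F" and x = x])
    show "finite ?P" by (rule finite_subset [OF sub fin(1)])
    show "x \<in> ?P" by simp
    show "?P \<subseteq> cls arcs (edge_links F) x" by simp
  next
    fix y assume y: "y \<in> ?P"
    then have "y \<in> darts D" using sub by blast
    with y show "opp_cut F y \<in> ?P" "opp_cut F (opp_cut F y) = y" "?g y \<in> ?P" "?g (?g y) = y"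
      using piece_opp piece_j strand_closed [OF F] by (auto simp: opp_cut_def opp j)
  next
    fix u v assume uv: "(u, v) \<in> edge_links F" "u \<in> ?P \<or> v \<in> ?P"
    have "u \<in> arcs" "v \<in> arcs" using uv(1) by (auto simp: edge_links_def arcs_def opp j)
    then have "cls arcs (edge_links F) u = cls arcs (edge_links F) v" by (rule cls_link [OF uv(1)])
    then have "u \<in> ?P" "v \<in> ?P" using uv(2) by (metis cls_eqI self_mem_cls)+
    moreover have "v = opp_cut F u \<or> v = ?g u"
      using uv(1) by (auto simp: edge_links_def opp_cut_def)
    ultimately show "u \<in> ?P \<and> v \<in> ?P \<and> (v = opp_cut F u \<or> v = ?g u)" by blast
  qed
  moreover have "{y \<in> ?P. opp_cut F y = y} = ?P \<inter> \<Union>F"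
    using sub opp(2) by (auto simp: opp_cut_def)
  moreover have "{y \<in> ?P. ?g y = y} = tips ?P"
    using sub j(4) by (auto simp: tips_def)
  ultimately show ?thesis by (simp add: add.commute)
qed

lemma tips_edge:
  assumes "X \<in> edge_of ` arcs"
  shows "card (tips X) \<in> {0, 2}"
proof -
  obtain x where x: "x \<in> arcs" "X = edge_of x" using assms by blast
  show ?thesis
  proof (cases "x \<in> darts D")
    case True
    then show ?thesis using piece_fixed_points [of "{}" x] x by simp
  next
    case False
    then have "X = {x}" "x \<notin> darts D" using x piece_circle by (auto simp: arcs_def)
    then show ?thesis by (auto simp: tips_def)
  qed
qed

lemma edge_eqI: "y \<in> X \<Longrightarrow> X \<in> edge_of ` arcs \<Longrightarrow> X = edge_of y"
  using cls_eqI by fastforce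

lemma finite_tips: "finite (tips X)"
  by (rule finite_subset [OF _ fin(1)]) (auto simp: tips_def)

lemma card_verts_eq:
  "card (gverts (resolve D K j)) = card K + card {X \<in> edge_of ` arcs. tips X = {}}"
  unfolding verts_eq
  by (subst card_Un_disjoint) (auto simp: fin finite_arcs card_image)

text \<open>An edge with ends has exactly two tips, so the darts at kept nodes count such edges
  twice. A closed loop contributes one edge and one vertex and drops out. In particular the value
  does not depend on \<open>j\<close>.\<close>

lemma resolve_euler:
  "2 * (int (card (gedges (resolve D K j))) - int (card (gverts (resolve D K j)))) =
     int (card {d \<in> darts D. base D d \<in> K}) - 2 * int (card K)"
proof -
  let ?E = "edge_of ` arcs"
  let ?Eloop = "{X \<in> ?E. tips X = {}}" and ?Epath = "{X \<in> ?E. tips X \<noteq> {}}"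
  have finE: "finite ?E" by (simp add: finite_arcs)
  have "{d \<in> darts D. base D d \<in> K} = \<Union> (tips ` ?Epath)"
  proof
    show "{d \<in> darts D. base D d \<in> K} \<subseteq> \<Union> (tips ` ?Epath)"
    proof
      fix d assume d: "d \<in> {d \<in> darts D. base D d \<in> K}"
      then have "d \<in> tips (edge_of d)" by (simp add: tips_def)
      moreover have "edge_of d \<in> ?E" using d by (intro imageI) (simp add: arcs_def)
      ultimately show "d \<in> \<Union> (tips ` ?Epath)" by blast
    qed
  qed (auto simp: tips_def)
  moreover have "card (\<Union> (tips ` ?Epath)) = (\<Sum>X\<in>?Epath. card (tips X))"
  proof (rule card_UN_disjoint)
    show "\<forall>X\<in>?Epath. \<forall>Y\<in>?Epath. X \<noteq> Y \<longrightarrow> tips X \<inter> tips Y = {}"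
    proof (intro ballI impI)
      fix X Y assume XY: "X \<in> ?Epath" "Y \<in> ?Epath" "X \<noteq> Y"
      have "X = Y" if "d \<in> X" "d \<in> Y" for d
        using edge_eqI [OF that(1)] edge_eqI [OF that(2)] XY by simp
      then show "tips X \<inter> tips Y = {}" using XY(3) by (auto simp: tips_def)
    qed
  qed (use finE finite_tips in auto)
  moreover have "(\<Sum>X\<in>?Epath. card (tips X)) = (\<Sum>X\<in>?Epath. 2)"
  proof (rule sum.cong [OF refl])
    fix X assume "X \<in> ?Epath"
    then show "card (tips X) = 2" using tips_edge [of X] finite_tips by auto
  qed
  ultimately have "card {d \<in> darts D. base D d \<in> K} = 2 * card ?Epath" by simp
  moreover have "card ?E = card ?Eloop + card ?Epath"
    using finE by (subst card_Un_disjoint [symmetric]) (auto intro: arg_cong [where f = card])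
  ultimately show ?thesis by (simp add: edges_eq card_verts_eq)
qed

lemma conn_rot:
  assumes "d \<in> darts D" "d' \<in> darts D" "base D d = base D d'" "base D d \<in> K"
  shows "(d, d') \<in> conn arcs (links F)"
proof -
  obtain n where n: "(rot D ^^ n) d = d'" using rot(3) [OF assms] by blast
  have "(rot D ^^ n) d \<in> darts D \<and> base D ((rot D ^^ n) d) = base D d \<and>
    (d, (rot D ^^ n) d) \<in> conn arcs (links F)" for n
  proof (induction n)
    case (Suc n)
    let ?e = "(rot D ^^ n) d"
    have e: "?e \<in> darts D" "base D ?e \<in> K" using Suc assms by auto
    then have "(?e, rot D ?e) \<in> conn arcs (links F)"
      by (intro conn_link) (auto simp: links_def arcs_def turn_def rot)
    then show ?case using Suc e rot by (auto intro: conn_trans)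
  qed (use assms in auto)
  then show ?thesis using n by blast
qed


section \<open>Cutting an edge that is already cut\<close>

lemma strand_card:
  assumes "e \<in> strands D" "e \<subseteq> X" "d \<in> e" "d \<in> darts D"
  shows "e = {d, opp D d}"
  using assms disj by (auto simp: strands_def opp)

text \<open>Without tips the piece meets no kept node, so the rotation links that
  \<open>links\<close> adds to \<open>edge_links\<close> never apply to it.\<close>

lemma piece_tipless_closed:
  assumes x: "x \<in> arcs" and no: "tips (piece F x) = {}"
  shows "piece F x = cls arcs (links F) x"
proof
  show "cls arcs (links F) x \<subseteq> piece F x"
  proof (rule cls_subset)
    fix u v assume uv: "(u, v) \<in> links F" "u \<in> arcs" "v \<in> arcs"
    have "(u, v) \<in> edge_links F \<or> u \<in> darts D \<and> v = rot D u \<and> base D u \<in> K"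
      using uv(1) by (auto simp: links_def edge_links_def turn_def split: if_splits)
    then show "u \<in> piece F x \<longleftrightarrow> v \<in> piece F x"
    proof
      assume "(u, v) \<in> edge_links F"
      then show ?thesis using cls_link uv by (metis cls_eqI self_mem_cls)
    next
      assume "u \<in> darts D \<and> v = rot D u \<and> base D u \<in> K"
      then show ?thesis using no rot(1) [of u] rot(2) [of u] by (auto simp: tips_def)
    qed
  qed simp
  have "conn arcs (edge_links F) \<subseteq> conn arcs (links F)"
    by (rule conn_subset) (auto simp: links_def edge_links_def turn_def)
  then show "piece F x \<subseteq> cls arcs (links F) x" by (auto simp: cls_def)
qed

text \<open>Between two cuts of one edge lies a segment without tips, and it becomes a component of
  its own. It may adjoin \<open>e\<close> on the side of \<open>d\<close> or on that of
  \<open>opp D d\<close>, so both pieces have to be examined.\<close>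

lemma cut_again:
  assumes F: "F \<subseteq> strands D" and e: "e \<in> strands D" "e \<notin> F" "e \<subseteq> X"
    and e': "e' \<in> F" "e' \<subseteq> X" and X: "X \<in> edge_of ` arcs"
  shows "nc arcs (links (insert e F)) = Suc (nc arcs (links F))"
proof -
  let ?F = "insert e F"
  obtain d where d: "d \<in> darts D" "e = {d, opp D d}"
  \<comment> \<open>A circle is an edge consisting of a single strand, so it has no room for a
    second cut.\<close>
  proof (cases "\<exists>c\<in>circles D. e = {c}")
    case True
    then obtain c where c: "c \<in> circles D" "e = {c}" by blast
    then have "X = {c}" using edge_eqI [of c X] X e(3) piece_circle by simp
    moreover have "e' \<noteq> {}" using e'(1) F by (auto simp: strands_def)
    ultimately have "e' = e" using e'(2) c by auto
    then show ?thesis using e(2) e'(1) by simp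
  next
    case False
    then show ?thesis using e(1) that by (auto simp: strands_def)
  qed
  have od: "opp D d \<in> darts D" "opp D d \<noteq> d" "opp D (opp D d) = d" using d opp by auto
  have F': "?F \<subseteq> strands D" using F e by simp
  obtain z where z: "z \<in> e'" using e'(1) F by (auto simp: strands_def)
  have Xd: "edge_of d = X" "edge_of (opp D d) = X"
    using edge_eqI [of d X] edge_eqI [of "opp D d" X] X e(3) d by auto
  have zX: "z \<in> X" using z e' by auto
  have zd: "z \<noteq> d" "z \<noteq> opp D d"
  proof -
    have "y \<notin> e'" if "y = d \<or> y = opp D d" for y
    proof
      assume "y \<in> e'"
      moreover have "y \<in> darts D" using that d od by auto
      ultimately have "e' = {y, opp D y}" using strand_card [of e' X y] e' F by auto
      then have "e' = e" using that d(2) od by auto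
      then show False using e(2) e'(1) by simp
    qed
    then show "z \<noteq> d" "z \<noteq> opp D d" using z by auto
  qed
  let ?Pd = "piece ?F d" and ?Po = "piece ?F (opp D d)"
  have zP: "z \<in> ?Pd \<inter> \<Union>?F" if "?Pd = X" using that zX z e'(1) by auto
  have dcut: "y \<in> \<Union>?F" if "y = d \<or> y = opp D d" for y using that d(2) by auto
  have fp: "card (tips (piece ?F y)) + card (piece ?F y \<inter> \<Union>?F) \<le> 2" if "y \<in> darts D" for y
    using piece_fixed_points [OF F' that] by auto
  have fin_cut: "finite (piece ?F y \<inter> \<Union>?F)" if "y \<in> darts D" for y
    by (rule finite_subset [OF _ fin(1)]) (use piece_darts [OF that] in auto)
  \<comment> \<open>A piece whose two loose ends are the two sides of \<open>e\<close> would be the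
    whole edge, and would contain the cut dart \<open>z\<close> as a third loose end.\<close>
  have notboth: "opp D d \<notin> ?Pd"
  proof
    assume o: "opp D d \<in> ?Pd"
    then have "{d, opp D d} \<subseteq> ?Pd \<inter> \<Union>?F" using dcut by auto
    moreover have "card (?Pd \<inter> \<Union>?F) \<le> card {d, opp D d}" using fp [OF d(1)] od(2) by simp
    ultimately have cut: "?Pd \<inter> \<Union>?F = {d, opp D d}"
      using card_seteq [OF fin_cut [OF d(1)]] by metis
    have "?Pd = edge_of d"
    proof (rule piece_closed_eq_edge [OF d(1)])
      fix y assume y: "y \<in> ?Pd"
      then have "y \<in> darts D" using piece_darts [OF d(1)] by blast
      show "opp D y \<in> ?Pd"
      proof (cases "y \<in> \<Union>?F")
        case True
        then have "y \<in> {d, opp D d}" using y cut by blast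
        then have "opp D y \<in> {d, opp D d}" using od(3) by auto
        then show ?thesis using o by auto
      next
        case False
        then show ?thesis using y piece_opp \<open>y \<in> darts D\<close> by blast
      qed
    qed
    then have "z \<in> ?Pd \<inter> \<Union>?F" using zP Xd by simp
    then show False using cut zd by auto
  qed
  \<comment> \<open>If both sides of \<open>e\<close> led to a kept node, each piece would have its
    only loose end at \<open>e\<close>, and together they would fill the edge, leaving no place for
    the cut at \<open>e'\<close>.\<close>
  have "tips ?Pd = {} \<or> tips ?Po = {}"
  proof (rule ccontr)
    assume "\<not> ?thesis"
    then have t: "card (tips ?Pd) \<ge> 1" "card (tips ?Po) \<ge> 1"
      using finite_tips by (simp_all add: Suc_le_eq card_gt_0_iff)
    have only: "piece ?F y \<inter> \<Union>?F = {y}" if "y = d \<or> y = opp D d" for y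
    proof -
      have y: "y \<in> darts D" using that d od by auto
      have "{y} \<subseteq> piece ?F y \<inter> \<Union>?F" using dcut that by auto
      moreover have "card (piece ?F y \<inter> \<Union>?F) \<le> card {y}" using fp [OF y] t that by auto
      ultimately show ?thesis using card_seteq [OF fin_cut [OF y]] by metis
    qed
    let ?U = "?Pd \<union> ?Po"
    have "edge_of d \<subseteq> ?U"
    proof (rule cls_subset)
      fix u v assume uv: "(u, v) \<in> edge_links {}" "u \<in> arcs" "v \<in> arcs"
      show "u \<in> ?U \<longleftrightarrow> v \<in> ?U"
      proof (cases "(u, v) \<in> edge_links ?F")
        case True
        then have eq: "piece ?F u = piece ?F v" using cls_link uv by metis
        have "u \<in> piece ?F y \<longleftrightarrow> v \<in> piece ?F y" for y
          using eq by (metis cls_eqI self_mem_cls)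
        then show ?thesis by blast
      next
        case False
        then have c: "u \<in> darts D" "v = opp D u" "u \<in> \<Union>?F" using uv(1) by (auto simp: edge_links_def)
        then have vc: "v \<in> \<Union>?F" using strand_closed [OF F'] by simp
        have iff: "y \<in> ?U \<longleftrightarrow> y = d \<or> y = opp D d" if "y \<in> \<Union>?F" for y
          using only [of d] only [of "opp D d"] that by auto
        have "v = d \<longleftrightarrow> u = opp D d" "v = opp D d \<longleftrightarrow> u = d"
          using c(2) od(3) opp(3) [OF c(1)] by metis+
        then show ?thesis unfolding iff [OF c(3)] iff [OF vc] by blast
      qed
    qed simp
    then have "z \<in> ?U" using zX Xd by blast
    then have "z \<in> ?U \<inter> \<Union>?F" using z e'(1) by auto
    then show False using only [of d] only [of "opp D d"] zd by auto
  qed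
  then have disc: "(d, opp D d) \<notin> conn arcs (links ?F)"
  proof
    assume "tips ?Pd = {}"
    then have "?Pd = cls arcs (links ?F) d" using piece_tipless_closed d by (simp add: arcs_def)
    then show ?thesis using notboth by (simp add: mem_cls_iff)
  next
    assume "tips ?Po = {}"
    then have "?Po = cls arcs (links ?F) (opp D d)" using piece_tipless_closed od by (simp add: arcs_def)
    moreover have "d \<notin> ?Po" using notboth by (metis cls_eqI self_mem_cls)
    ultimately show ?thesis using mem_cls_iff conn_sym by metis
  qed
  have "d \<notin> \<Union>F"
  proof
    assume "d \<in> \<Union>F"
    then obtain f where f: "f \<in> F" "d \<in> f" by blast
    then have "f = e" using strand_card [of f UNIV d] F d by auto
    then show False using f e by simp
  qed
  then have odF: "d \<notin> \<Union>F" "opp D d \<notin> \<Union>F" using strand_closed [OF F d(1)] by auto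
  have "conn arcs (links F) = conn arcs (insert (d, opp D d) (links ?F))"
  proof (rule conn_eqI)
    fix u v assume uv: "(u, v) \<in> links F" "u \<in> arcs" "v \<in> arcs"
    let ?R = "insert (d, opp D d) (links ?F)"
    have "(u, v) \<in> ?R \<or> (v, u) \<in> ?R" using uv(1) d od by (auto simp: links_def)
    then show "(u, v) \<in> conn arcs ?R" using uv by (auto intro: conn_link conn_sym)
  next
    fix u v assume uv: "(u, v) \<in> insert (d, opp D d) (links ?F)" "u \<in> arcs" "v \<in> arcs"
    then have "(u, v) \<in> links F" using d odF by (auto simp: links_def)
    then show "(u, v) \<in> conn arcs (links F)" using uv by (intro conn_link)
  qed
  then have "nc arcs (links F) = nc arcs (insert (d, opp D d) (links ?F))" by (rule nc_cong_conn)
  then show ?thesis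
    using nc_insert_disconnected [OF finite_arcs _ _ disc] d od by (simp add: arcs_def)
qed


section \<open>Deleting edges by cutting one strand in each\<close>

context
  fixes C :: "'d set set" and r :: "'d set \<Rightarrow> 'd set" and F :: "'d set set"
  assumes C: "C \<subseteq> edge_of ` arcs" and r: "\<And>X. X \<in> C \<Longrightarrow> r X \<in> strands D" "\<And>X. X \<in> C \<Longrightarrow> r X \<subseteq> X"
    and F_eq: "F = r ` C"
begin

lemma cut_strands: "F \<subseteq> strands D"
  using r F_eq by auto

lemma cut_in_edge:
  assumes "d \<in> \<Union>F" "d \<in> X" "X \<in> edge_of ` arcs"
  shows "X \<in> C" "d \<in> r X"
proof -
  obtain Y where Y: "Y \<in> C" "d \<in> r Y" using assms(1) F_eq by blast
  then have "Y = X" using edge_eqI [of d Y] edge_eqI [of d X] assms r(2) C by blast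
  with Y show "X \<in> C" "d \<in> r X" by auto
qed

text \<open>With one cut per edge there is no segment between different cuts. A piece without tips
  that meets a cut comes from a closed edge cut once: its loose ends are the two sides of that
  cut.\<close>

lemma piece_no_tips:
  assumes s: "s \<in> arcs" and no: "tips (piece F s) = {}"
  shows "piece F s = edge_of s"
proof (cases "s \<in> darts D")
  case False
  then show ?thesis using piece_circle s by (simp add: arcs_def)
next
  case True
  show ?thesis
  proof (rule piece_closed_eq_edge [OF True])
    fix y assume y: "y \<in> piece F s"
    then have yd: "y \<in> darts D" using piece_darts [OF True] by blast
    show "opp D y \<in> piece F s"
    proof (cases "y \<in> \<Union>F")
      case False
      then show ?thesis using piece_opp [OF y yd] by simp
    next
      case cut: True
      have fin_cut: "finite (piece F s \<inter> \<Union>F)"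
        by (rule finite_subset [OF _ fin(1)]) (use piece_darts [OF True] in auto)
      have "card (piece F s \<inter> \<Union>F) \<noteq> 0" using fin_cut y cut by auto
      then have two: "card (piece F s \<inter> \<Union>F) = 2"
        using piece_fixed_points [OF cut_strands True] no by simp
      let ?X = "edge_of s"
      have X: "?X \<in> edge_of ` arcs" using s by simp
      have yX: "y \<in> ?X" using y piece_subset_edge by blast
      have rX: "r ?X = {y, opp D y}"
        using strand_card [of "r ?X" ?X y] cut_in_edge [OF cut yX X] r yd by blast
      have "piece F s \<inter> \<Union>F \<subseteq> r ?X"
        using cut_in_edge(2) [OF _ _ X] piece_subset_edge by blast
      then have "piece F s \<inter> \<Union>F \<subseteq> {y, opp D y}" using rX by simp
      moreover have "card {y, opp D y} = 2" using opp(2) [OF yd] by auto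
      ultimately have "piece F s \<inter> \<Union>F = {y, opp D y}"
        using two card_subset_eq by (metis finite.emptyI finite.insertI)
      then show ?thesis by blast
    qed
  qed
qed

lemma piece_uncut:
  assumes X: "X \<in> edge_of ` arcs" "X \<notin> C" and t: "t \<in> X" "t \<in> darts D"
  shows "piece F t = X"
proof -
  have Xt: "X = edge_of t" using edge_eqI t X by blast
  have "piece F t = edge_of t"
  proof (rule piece_closed_eq_edge [OF t(2)])
    fix y assume y: "y \<in> piece F t"
    then have "y \<in> X" "y \<in> darts D"
      using piece_subset_edge Xt piece_darts [OF t(2)] by blast+
    moreover from this have "y \<notin> \<Union>F" using cut_in_edge(1) X by blast
    ultimately show "opp D y \<in> piece F t" using piece_opp [OF y] by blast
  qed
  then show ?thesis using Xt by simp
qed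

lemma conn_piece_links: "y \<in> piece F x \<Longrightarrow> (x, y) \<in> conn arcs (links F)"
proof -
  assume "y \<in> piece F x"
  moreover have "conn arcs (edge_links F) \<subseteq> conn arcs (links F)"
    by (rule conn_subset) (auto simp: links_def edge_links_def turn_def)
  ultimately show ?thesis by (auto simp: mem_cls_iff)
qed

text \<open>The two halves of a cut edge stay attached to their end vertices, so cutting separates
  exactly what deletion separates. A closed edge cut once remains one component, as its deletion
  leaves its one vertex. Nodes without darts are invisible to \<open>links\<close> and are added
  separately.\<close>

lemma components_delete_edges:
  "num_components (delete_edges (resolve D K j) C) = nc arcs (links F) + card (K - base D ` darts D)"
proof -
  let ?V = "gverts (resolve D K j)"
  define RG where "RG = (\<Union>X\<in>edge_of ` arcs - C. ends (resolve D K j) X \<times> ends (resolve D K j) X)"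
  have nG: "num_components (delete_edges (resolve D K j) C) = nc ?V RG"
    by (simp add: num_components_def delete_edges_def nc_def RG_def edges_eq)
  let ?I = "K - base D ` darts D"
  \<comment> \<open>Components of a graph are classes of vertices, those of \<open>links\<close> are
    classes of darts. \<open>touch\<close> relates a vertex to the pieces that end there, and a
    closed edge to its artificial vertex; the two counts are compared along this relation.\<close>
  define touch where "touch u s \<longleftrightarrow> (\<exists>t\<in>tips (piece F s). u = Inl (base D t)) \<or>
    tips (edge_of s) = {} \<and> u = Inr (edge_of s)" for u :: "'v + 'd set" and s
  have touch_ex: "\<exists>u. touch u s" if "s \<in> arcs" for s
    using piece_no_tips [OF that] unfolding touch_def by (cases "tips (piece F s) = {}") auto
  have touchV: "u \<in> ?V" if "touch u s" "s \<in> arcs" for u s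
    using that unfolding touch_def verts_eq by (auto simp: tips_def)
  have touch_uniq: "cls ?V RG u = cls ?V RG w" if t: "touch u s" "touch w s" and s: "s \<in> arcs" for u w s
  proof (cases "tips (edge_of s) = {}")
    case True
    have "tips (piece F s) \<subseteq> tips (edge_of s)" using piece_subset_edge by (auto simp: tips_def)
    then have "u = w" using True t unfolding touch_def by auto
    then show ?thesis by simp
  next
    case False
    then obtain t t' where tt: "t \<in> tips (piece F s)" "u = Inl (base D t)"
      "t' \<in> tips (piece F s)" "w = Inl (base D t')"
      using t unfolding touch_def by auto
    have sd: "s \<in> darts D"
    proof (rule ccontr)
      assume "s \<notin> darts D"
      then have "edge_of s = {s}" using piece_circle s by (simp add: arcs_def)
      then show False using False \<open>s \<notin> darts D\<close> by (auto simp: tips_def)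
    qed
    show ?thesis
    proof (cases "t = t'")
      case True
      then show ?thesis using tt by simp
    next
      case ne: False
      \<comment> \<open>Two different tips use up both ends of the piece. So it contains no cut, is
        a whole edge outside \<open>C\<close>, and joins \<open>u\<close> to \<open>w\<close> in
        \<open>RG\<close>.\<close>
      have "card {t, t'} \<le> card (tips (piece F s))"
        using tt finite_tips by (intro card_mono) auto
      then have "card (piece F s \<inter> \<Union>F) = 0"
        using ne piece_fixed_points [OF cut_strands sd] by auto
      moreover have "finite (piece F s \<inter> \<Union>F)"
        by (rule finite_subset [OF _ fin(1)]) (use piece_darts [OF sd] in auto)
      ultimately have nocut: "piece F s \<inter> \<Union>F = {}" by simp
      have "piece F s = edge_of s"
      proof (rule piece_closed_eq_edge [OF sd])
        fix y assume y: "y \<in> piece F s"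
        then show "opp D y \<in> piece F s"
          using piece_opp [OF y] nocut piece_darts [OF sd] by blast
      qed
      moreover have "edge_of s \<notin> C"
      proof
        assume X: "edge_of s \<in> C"
        obtain y where "y \<in> r (edge_of s)" using r(1) [OF X] by (auto simp: strands_def)
        then have "y \<in> piece F s \<inter> \<Union>F" using r(2) [OF X] X F_eq \<open>piece F s = edge_of s\<close> by blast
        then show False using nocut by blast
      qed
      ultimately have "(u, w) \<in> RG"
        using tt False s unfolding RG_def ends_eq by (intro UN_I [of "edge_of s"]) auto
      then show ?thesis using cls_link touchV t s by metis
    qed
  qed
  \<comment> \<open>\<open>vt\<close> chooses a vertex for a dart and, below, \<open>pt\<close> a
    dart for a vertex. They are inverse to each other only up to connection, which is all that a
    count of classes needs.\<close>
  define vt where "vt s = (SOME u. touch u s)" for s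
  have vt: "touch (vt s) s" if "s \<in> arcs" for s
    unfolding vt_def by (rule someI_ex) (rule touch_ex [OF that])
  have vt_inv: "cls ?V RG (vt a) = cls ?V RG (vt b)" if ab: "(a, b) \<in> conn arcs (links F)" for a b
    using ab
  proof (rule conn_invariant [where f = "\<lambda>s. cls ?V RG (vt s)"])
    fix a b assume ab: "(a, b) \<in> links F" "a \<in> arcs" "b \<in> arcs"
    have "(a, b) \<in> edge_links F \<or> a \<in> darts D \<and> b = rot D a \<and> base D a \<in> K"
      using ab(1) by (auto simp: links_def edge_links_def turn_def split: if_splits)
    then show "cls ?V RG (vt a) = cls ?V RG (vt b)"
    proof
      assume e: "(a, b) \<in> edge_links F"
      then have "piece F a = piece F b" using cls_link ab by metis
      moreover have "edge_of a = edge_of b"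
        using \<open>piece F a = piece F b\<close> piece_subset_edge by (metis cls_eqI self_mem_cls subsetD)
      ultimately have "touch u a = touch u b" for u unfolding touch_def by simp
      then show ?thesis unfolding vt_def by simp
    next
      assume k: "a \<in> darts D \<and> b = rot D a \<and> base D a \<in> K"
      have "a \<in> tips (piece F a)" "b \<in> tips (piece F b)" using k rot by (auto simp: tips_def)
      then have "touch (Inl (base D a)) a" "touch (Inl (base D a)) b"
        using k rot(2) unfolding touch_def by metis+
      then show ?thesis using touch_uniq vt ab by metis
    qed
  qed
  define pt where "pt u = (case u of Inl v \<Rightarrow> (SOME d. d \<in> darts D \<and> base D d = v)
    | Inr X \<Rightarrow> (SOME x. x \<in> arcs \<and> X = edge_of x))" for u :: "'v + 'd set"
  have pt_Inl: "pt (Inl v) \<in> darts D" "base D (pt (Inl v)) = v" if "v \<in> base D ` darts D" for v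
  proof -
    have "\<exists>d. d \<in> darts D \<and> base D d = v" using that by auto
    from someI_ex [OF this] show "pt (Inl v) \<in> darts D" "base D (pt (Inl v)) = v"
      by (auto simp: pt_def)
  qed
  have pt_Inr: "pt (Inr X) \<in> arcs" "edge_of (pt (Inr X)) = X" if "X \<in> edge_of ` arcs" for X
  proof -
    have "\<exists>x. x \<in> arcs \<and> X = edge_of x" using that by auto
    from someI_ex [OF this] show "pt (Inr X) \<in> arcs" "edge_of (pt (Inr X)) = X"
      by (auto simp: pt_def)
  qed
  have pt: "pt u \<in> arcs" "touch u (pt u)" if u: "u \<in> ?V" "u \<notin> Inl ` ?I" for u
  proof -
    have "pt u \<in> arcs \<and> touch u (pt u)"
    proof (cases u)
      case (Inl v)
      then have v: "v \<in> K" "v \<in> base D ` darts D" using u by (auto simp: verts_eq)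
      from pt_Inl [OF v(2)] v(1) have "pt u \<in> tips (piece F (pt u))" "Inl (base D (pt u)) = u"
        using Inl by (auto simp: tips_def)
      then have "touch u (pt u)" unfolding touch_def by metis
      moreover have "pt u \<in> arcs" using pt_Inl(1) [OF v(2)] Inl by (simp add: arcs_def)
      ultimately show ?thesis by simp
    next
      case (Inr X)
      then have "X \<in> edge_of ` arcs" "tips X = {}" using u by (auto simp: verts_eq)
      then show ?thesis using pt_Inr [of X] Inr unfolding touch_def by simp
    qed
    then show "pt u \<in> arcs" "touch u (pt u)" by auto
  qed
  let ?cl = "cls arcs (links F)"
  have pt_conn: "?cl (pt u) = ?cl s" if u: "touch u s" and s: "s \<in> arcs" for u s
  proof (cases "tips (edge_of s) = {}")
    case True
    have sub: "tips (piece F s) \<subseteq> tips (edge_of s)" using piece_subset_edge by (auto simp: tips_def)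
    then have p: "piece F s = edge_of s" using piece_no_tips s True by auto
    have ue: "u = Inr (edge_of s)" using u True sub unfolding touch_def by auto
    have "edge_of (pt u) = edge_of s" using pt_Inr [of "edge_of s"] ue s by simp
    then have "pt u \<in> piece F s" using p by (metis self_mem_cls)
    then show ?thesis using conn_piece_links conn_sym by (metis cls_eq_iff)
  next
    case False
    then obtain t where t: "t \<in> tips (piece F s)" "u = Inl (base D t)" using u unfolding touch_def by auto
    then have td: "t \<in> darts D" "base D t \<in> K" "t \<in> piece F s" by (auto simp: tips_def)
    then have "(t, pt u) \<in> conn arcs (links F)"
      using pt_Inl [of "base D t"] t(2) by (intro conn_rot) auto
    moreover have "(s, t) \<in> conn arcs (links F)" using conn_piece_links td(3) .
    ultimately show ?thesis by (metis cls_eq_iff)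
  qed
  define f where "f u = (if u \<in> Inl ` ?I then Inr u else Inl (?cl (pt u)))" for u
  have "nc ?V RG = card (f ` ?V)"
  proof (rule nc_eq_card_image)
    fix u w assume uw: "u \<in> ?V" "w \<in> ?V"
    show "f u = f w \<longleftrightarrow> (u, w) \<in> conn ?V RG"
    proof
      assume eq: "f u = f w"
      show "(u, w) \<in> conn ?V RG"
      proof (cases "u \<in> Inl ` ?I \<or> w \<in> Inl ` ?I")
        case True
        then have "u = w" using eq unfolding f_def by (auto split: if_splits)
        then show ?thesis by simp
      next
        case False
        then have n: "u \<notin> Inl ` ?I" "w \<notin> Inl ` ?I" by auto
        then have "?cl (pt u) = ?cl (pt w)" using eq unfolding f_def by simp
        then have "cls ?V RG (vt (pt u)) = cls ?V RG (vt (pt w))" by (intro vt_inv) (simp add: cls_eq_iff)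
        moreover have "cls ?V RG u = cls ?V RG (vt (pt u))"
          using touch_uniq pt [OF uw(1) n(1)] vt by blast
        moreover have "cls ?V RG w = cls ?V RG (vt (pt w))"
          using touch_uniq pt [OF uw(2) n(2)] vt by blast
        ultimately show ?thesis by (metis cls_eq_iff)
      qed
    next
      assume "(u, w) \<in> conn ?V RG"
      then show "f u = f w"
      proof (rule conn_invariant)
        fix u w assume uw: "(u, w) \<in> RG" "u \<in> ?V" "w \<in> ?V"
        obtain X where X: "X \<in> edge_of ` arcs" "X \<notin> C"
          "u \<in> ends (resolve D K j) X" "w \<in> ends (resolve D K j) X"
          using uw(1) unfolding RG_def by blast
        show "f u = f w"
        proof (cases "tips X = {}")
          case True
          then show ?thesis using X by (simp add: ends_eq)
        next
          case False
          then obtain t t' where t: "t \<in> tips X" "u = Inl (base D t)" "t' \<in> tips X" "w = Inl (base D t')"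
            using X(3,4) by (auto simp: ends_eq)
          then have td: "t \<in> darts D" "t' \<in> darts D" "t \<in> X" "t' \<in> X" by (auto simp: tips_def)
          have pX: "piece F t = X" "piece F t' = X" using piece_uncut X td by auto
          have "touch u t" "touch w t" using t pX unfolding touch_def by auto
          then have "?cl (pt u) = ?cl t" "?cl (pt w) = ?cl t" using pt_conn td by (auto simp: arcs_def)
          moreover have "u \<notin> Inl ` ?I" "w \<notin> Inl ` ?I" using t td by auto
          ultimately show ?thesis unfolding f_def by simp
        qed
      qed
    qed
  qed
  also have "f ` ?V = Inl ` (?cl ` arcs) \<union> Inr ` Inl ` ?I"
  proof
    show "f ` ?V \<subseteq> Inl ` (?cl ` arcs) \<union> Inr ` Inl ` ?I"
    proof
      fix z assume "z \<in> f ` ?V"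
      then obtain u where u: "u \<in> ?V" "z = f u" by blast
      show "z \<in> Inl ` (?cl ` arcs) \<union> Inr ` Inl ` ?I"
        using pt(1) [OF u(1)] u(2) by (cases "u \<in> Inl ` ?I") (simp_all add: f_def)
    qed
    show "Inl ` (?cl ` arcs) \<union> Inr ` Inl ` ?I \<subseteq> f ` ?V"
    proof
      fix z :: "'d set + 'v + 'd set" assume "z \<in> Inl ` (?cl ` arcs) \<union> Inr ` Inl ` ?I"
      then consider s where "s \<in> arcs" "z = Inl (?cl s)" | v where "v \<in> ?I" "z = Inr (Inl v)" by auto
      then show "z \<in> f ` ?V"
      proof cases
        case 1
        have "vt s \<in> ?V" using touchV vt 1 by blast
        moreover have "vt s \<notin> Inl ` ?I" using vt [OF 1(1)] by (auto simp: touch_def tips_def)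
        then have "f (vt s) = z" using pt_conn [OF vt [OF 1(1)] 1(1)] 1(2) by (simp add: f_def)
        ultimately show ?thesis by blast
      next
        case 2
        then have "f (Inl v) = z" "Inl v \<in> ?V" by (auto simp: f_def verts_eq)
        then show ?thesis by blast
      qed
    qed
  qed
  also have "card \<dots> = card (?cl ` arcs) + card ?I"
    by (subst card_Un_disjoint) (auto simp: card_image finite_arcs fin inj_on_def)
  finally show ?thesis by (simp add: nG nc_eq)
qed

end

lemma components_resolve:
  "num_components (resolve D K j) = nc arcs (links {}) + card (K - base D ` darts D)"
  using components_delete_edges [of "{}" id "{}"] by (simp add: delete_edges_def)

end


section \<open>Planarity of states\<close>

text \<open>Any spatial diagram is meant, not only a diagram of a link.\<close>

locale link_diagram =
  fixes D :: "('v, 'd) diagram"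
  assumes spatial: "spatial_diagram D"
begin

abbreviation "M \<equiv> darts D"
abbreviation "\<rho> \<equiv> rot D"
abbreviation "X \<equiv> crossing_darts D"

lemma finites [simp]: "finite (vertices D)" "finite (crossings D)" "finite M" "finite (circles D)"
  using spatial by (auto simp: spatial_diagram_def)

lemma disjoints: "vertices D \<inter> crossings D = {}" "M \<inter> circles D = {}"
  using spatial by (auto simp: spatial_diagram_def)

lemma base_in: "d \<in> M \<Longrightarrow> base D d \<in> vertices D \<union> crossings D"
  using spatial by (auto simp: spatial_diagram_def)

lemma rot_permutes: "\<rho> permutes M"
  using spatial by (auto simp: spatial_diagram_def)

lemma rot_in [simp]: "\<rho> d \<in> M \<longleftrightarrow> d \<in> M"
  by (rule permutes_in_image [OF rot_permutes])

lemma rot_eq_iff [simp]: "\<rho> d = \<rho> d' \<longleftrightarrow> d = d'"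
  by (simp add: inj_eq permutes_inj [OF rot_permutes])

lemma base_rot [simp]: "d \<in> M \<Longrightarrow> base D (\<rho> d) = base D d"
  using spatial by (auto simp: spatial_diagram_def)

lemma rot_trans: "d \<in> M \<Longrightarrow> d' \<in> M \<Longrightarrow> base D d = base D d' \<Longrightarrow> \<exists>n. (\<rho> ^^ n) d = d'"
  using spatial by (auto simp: spatial_diagram_def)

lemma opp_facts [simp]:
  "d \<in> M \<Longrightarrow> opp D d \<in> M" "d \<in> M \<Longrightarrow> opp D d \<noteq> d" "d \<in> M \<Longrightarrow> opp D (opp D d) = d"
  using spatial by (auto simp: spatial_diagram_def)

lemma valence: "x \<in> crossings D \<Longrightarrow> card {d \<in> M. base D d = x} = 4"
  using spatial by (auto simp: spatial_diagram_def)

lemma X_iff: "d \<in> X \<longleftrightarrow> d \<in> M \<and> base D d \<in> crossings D"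
  by (simp add: crossing_darts_def)

lemma rot_X [simp]: "\<rho> d \<in> X \<longleftrightarrow> d \<in> X"
  by (auto simp: X_iff)

lemma over_rot [simp]: "d \<in> X \<Longrightarrow> \<rho> d \<in> over D \<longleftrightarrow> d \<notin> over D"
  using spatial by (auto simp: spatial_diagram_def X_iff)

lemma base_funpow: "d \<in> M \<Longrightarrow> base D ((\<rho> ^^ n) d) = base D d"
  by (induction n) (auto simp: funpow_in_permutes [OF rot_permutes])

text \<open>By pigeonhole some power of the rotation between the first and the fourth fixes
  \<open>d\<close>; by transitivity the orbit contains all four darts, so no power below the fourth
  does.\<close>

lemma rot_four:
  assumes d: "d \<in> X"
  shows "\<rho> (\<rho> (\<rho> (\<rho> d))) = d" and "{d' \<in> M. base D d' = base D d} = {d, \<rho> d, \<rho> (\<rho> d), \<rho> (\<rho> (\<rho> d))}"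
    and "distinct [d, \<rho> d, \<rho> (\<rho> d), \<rho> (\<rho> (\<rho> d))]"
proof -
  let ?B = "{d' \<in> M. base D d' = base D d}"
  have dM: "d \<in> M" and c4: "card ?B = 4" using d valence by (auto simp: X_iff)
  have B: "?B = {(\<rho> ^^ n) d | n. True}"
    using rot_trans [OF dM] base_funpow [OF dM] funpow_in_permutes [OF rot_permutes dM]
    by fastforce
  obtain p where p: "0 < p" "p \<le> 4" "(\<rho> ^^ p) d = d"
  proof -
    have "\<not> inj_on (\<lambda>n. (\<rho> ^^ n) d) {0..4}"
    proof
      assume "inj_on (\<lambda>n. (\<rho> ^^ n) d) {0..4}"
      then have "card ((\<lambda>n. (\<rho> ^^ n) d) ` {0..4}) = 5" by (simp add: card_image)
      moreover have "card ((\<lambda>n. (\<rho> ^^ n) d) ` {0..4}) \<le> card ?B"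
      proof (rule card_mono)
        show "finite ?B" by simp
        show "(\<lambda>n. (\<rho> ^^ n) d) ` {0..4} \<subseteq> ?B" unfolding B by auto
      qed
      ultimately show False using c4 by simp
    qed
    then obtain i k where ik: "i < k" "k \<le> 4" "(\<rho> ^^ i) d = (\<rho> ^^ k) d"
      unfolding inj_on_def by (metis atLeastAtMost_iff nat_neq_iff)
    have "(\<rho> ^^ i) ((\<rho> ^^ (k - i)) d) = (\<rho> ^^ i) d"
      using ik by (metis comp_apply funpow_add le_add_diff_inverse less_imp_le)
    moreover have "inj (\<rho> ^^ i)" using permutes_inj [OF rot_permutes] by (rule inj_fn)
    ultimately have "(\<rho> ^^ (k - i)) d = d" by (simp add: inj_eq)
    then show ?thesis using that [of "k - i"] ik by auto
  qed
  have mod: "(\<rho> ^^ n) d = (\<rho> ^^ (n mod p)) d" for n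
    using p(3) by (simp add: funpow_mod_eq)
  have sub: "?B \<subseteq> (\<lambda>n. (\<rho> ^^ n) d) ` {0..<p}"
  proof
    fix y assume "y \<in> ?B"
    then obtain n where "y = (\<rho> ^^ n) d" using B by blast
    then show "y \<in> (\<lambda>n. (\<rho> ^^ n) d) ` {0..<p}" using mod [of n] p(1) by auto
  qed
  then have "4 \<le> card ((\<lambda>n. (\<rho> ^^ n) d) ` {0..<p})" using c4 card_mono [OF _ sub] by simp
  also have "\<dots> \<le> p" using card_image_le [of "{0..<p}" "\<lambda>n. (\<rho> ^^ n) d"] by simp
  finally have p4: "p = 4" using p(2) by simp
  then show "\<rho> (\<rho> (\<rho> (\<rho> d))) = d" using p(3) by (simp add: numeral_eq_Suc)
  have "{0..<4} = {0, 1, 2, 3::nat}" by auto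
  then have sub4: "?B \<subseteq> {d, \<rho> d, \<rho> (\<rho> d), \<rho> (\<rho> (\<rho> d))}"
    using sub p4 by (simp add: numeral_eq_Suc)
  then show eq: "?B = {d, \<rho> d, \<rho> (\<rho> d), \<rho> (\<rho> (\<rho> d))}" using dM by auto
  have "card (set [d, \<rho> d, \<rho> (\<rho> d), \<rho> (\<rho> (\<rho> d))]) = 4" using c4 eq by simp
  then show "distinct [d, \<rho> d, \<rho> (\<rho> d), \<rho> (\<rho> (\<rho> d))]" by (intro card_distinct) simp
qed

lemma partner_eq:
  assumes "s (base D d) \<noteq> Zero"
  shows "partner D s d = (if (d \<in> over D) = (s (base D d) = Pos) then \<rho> (\<rho> (\<rho> d)) else \<rho> d)"
  using assms by (cases "s (base D d)") (auto simp: partner_def)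

lemma partner_facts:
  assumes "d \<in> X" "s (base D d) \<noteq> Zero"
  shows "partner D s d \<in> X" "base D (partner D s d) = base D d"
    "partner D s (partner D s d) = d" "partner D s d \<noteq> d"
  using assms rot_four [OF assms(1)] by (auto simp: partner_eq X_iff)

lemma resolution_state:
  assumes "\<And>x. x \<in> crossings D \<Longrightarrow> x \<notin> K \<Longrightarrow> s x \<noteq> Zero" "vertices D \<subseteq> K" "finite K"
  shows "resolution D K (partner D s)"
proof
  fix d assume d: "d \<in> M" "base D d \<notin> K"
  then have "d \<in> X" "s (base D d) \<noteq> Zero" using base_in [of d] assms by (auto simp: X_iff)
  from partner_facts [of d s, OF this] show "partner D s d \<in> M" "base D (partner D s d) = base D d"
    "partner D s (partner D s d) = d" "partner D s d \<noteq> d" by (auto simp: X_iff)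
qed (use disjoints rot_trans assms in auto)

lemma resolution_underlying: "resolution D (vertices D) (\<lambda>d. \<rho> (\<rho> d))"
proof
  fix d assume d: "d \<in> M" "base D d \<notin> vertices D"
  then have "d \<in> X" using base_in [of d] by (auto simp: X_iff)
  from rot_four [OF this] show "\<rho> (\<rho> (\<rho> (\<rho> d))) = d" "\<rho> (\<rho> d) \<noteq> d" by auto
qed (use disjoints rot_trans in auto)

text \<open>A cut turns the two-cycle of a strand into two fixed points. The identity outside the
  darts makes this a permutation in the sense of \<open>permutes\<close>.\<close>

definition opp_on :: "'d set set \<Rightarrow> 'd \<Rightarrow> 'd" where
  "opp_on F d = (if d \<in> M \<and> d \<notin> \<Union>F then opp D d else d)"

text \<open>Read as a rotation, a smoothing replaces the four-cycle of a crossing by two two-cycles,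
  so the crossing becomes two nodes of valence 2. A smoothed diagram is thus again a map on the same
  darts.\<close>

definition smooth_at :: "'v set \<Rightarrow> ('v \<Rightarrow> marker) \<Rightarrow> 'd \<Rightarrow> 'd" where
  "smooth_at Z s d = (if d \<in> M \<and> base D d \<in> Z then partner D s d else \<rho> d)"

definition dart_strands :: "'d set set" where
  "dart_strands = (\<lambda>d. {d, opp D d}) ` M"

lemma strands_eq: "strands D = dart_strands \<union> (\<lambda>c. {c}) ` circles D"
  by (auto simp: strands_def dart_strands_def)

lemma dart_strand_mem: "e \<in> dart_strands \<Longrightarrow> d \<in> e \<Longrightarrow> e = {d, opp D d}"
  by (auto simp: dart_strands_def)

lemma card_darts: "card M = 2 * card dart_strands"
proof -
  have "2 * card dart_strands = card (\<Union>dart_strands)"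
  proof (rule card_partition)
    show "finite (\<Union> dart_strands)" by (auto simp: dart_strands_def)
    fix c c' assume "c \<in> dart_strands" "c' \<in> dart_strands" "c \<noteq> c'"
    moreover have "c = c'" if "x \<in> c" "x \<in> c'" for x
      using that dart_strand_mem [of c x] dart_strand_mem [of c' x] calculation by simp
    ultimately show "c \<inter> c' = {}" by blast
  next
    fix c assume "c \<in> dart_strands"
    then obtain d where d: "d \<in> M" "c = {d, opp D d}" by (auto simp: dart_strands_def)
    have "opp D d \<noteq> d" using d by simp
    then show "card c = 2" using d(2) by simp
  qed (simp add: dart_strands_def)
  also have "\<Union>dart_strands = M" by (auto simp: dart_strands_def)
  finally show ?thesis by simp
qed

lemma strand_unique: "e \<in> strands D \<Longrightarrow> d \<in> e \<Longrightarrow> d \<in> M \<Longrightarrow> e = {d, opp D d}"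
  using disjoints by (auto simp: strands_eq dart_strands_def)

lemma strand_mem: "F \<subseteq> strands D \<Longrightarrow> d \<in> M \<Longrightarrow> d \<in> \<Union>F \<longleftrightarrow> {d, opp D d} \<in> F"
  using strand_unique by blast

lemma strand_mem_opp: "F \<subseteq> strands D \<Longrightarrow> d \<in> M \<Longrightarrow> opp D d \<in> \<Union>F \<longleftrightarrow> d \<in> \<Union>F"
  using strand_mem [of F d] strand_mem [of F "opp D d"] by (simp add: insert_commute)

lemma opp_on_involution:
  "F \<subseteq> strands D \<Longrightarrow> d \<in> M \<Longrightarrow> opp_on F (opp_on F d) = d"
  using strand_mem_opp [of F d] by (auto simp: opp_on_def)

lemma opp_on_permutes:
  assumes "F \<subseteq> strands D"
  shows "opp_on F permutes M"
proof (rule bij_imp_permutes)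
  show "bij_betw (opp_on F) M M"
    by (rule bij_betw_byWitness [where f' = "opp_on F"])
      (use opp_on_involution [OF assms] in \<open>auto simp: opp_on_def\<close>)
qed (auto simp: opp_on_def)

lemma cyc_rot: "cyc M \<rho> = card (base D ` M)"
  unfolding cyc_def
proof (rule nc_eq_card_image)
  fix d d' assume d: "d \<in> M" "d' \<in> M"
  show "base D d = base D d' \<longleftrightarrow> (d, d') \<in> conn M (gr M \<rho>)"
    using conn_permutes_iff [OF rot_permutes] d rot_trans base_funpow by auto
qed

lemma cyc_opp: "cyc M (opp_on {}) = card dart_strands"
  unfolding cyc_def dart_strands_def
proof (rule nc_eq_card_image)
  fix d d' assume d: "d \<in> M" "d' \<in> M"
  show "{d, opp D d} = {d', opp D d'} \<longleftrightarrow> (d, d') \<in> conn M (gr M (opp_on {}))"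
  proof
    assume "{d, opp D d} = {d', opp D d'}"
    then have "d' = d \<or> d' = opp D d" by (metis doubleton_eq_iff)
    then show "(d, d') \<in> conn M (gr M (opp_on {}))"
    proof
      assume "d' = opp D d"
      then show ?thesis using d by (intro conn_link) (auto simp: opp_on_def)
    qed simp
  next
    assume "(d, d') \<in> conn M (gr M (opp_on {}))"
    then show "{d, opp D d} = {d', opp D d'}"
      by (rule conn_invariant) (auto simp: opp_on_def)
  qed
qed

text \<open>Adding 2E, the number of darts, to the equation V - E + F = 2C of
  \<open>planar_map\<close> gives the form of \<open>genus0\<close>.\<close>

lemma genus0_diagram: "genus0 M \<rho> (opp_on {})"
proof -
  have E: "{(d, opp D d) | d. d \<in> M} = gr M (opp_on {})"
    by (auto simp: gr_def opp_on_def)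
  have F: "{(d, \<rho> (opp D d)) | d. d \<in> M} = gr M (\<rho> \<circ> opp_on {})"
    by (auto simp: gr_def opp_on_def)
  have V: "{(d, \<rho> d) | d. d \<in> M} = gr M \<rho>" by (simp add: gr_def)
  have "planar_map D" using spatial by (simp add: spatial_diagram_def)
  then have "int (cyc M \<rho>) - int (cyc M (opp_on {})) + int (cyc M (\<rho> \<circ> opp_on {})) =
      2 * int (nc M (gr M (opp_on {}) \<union> gr M \<rho>))"
    unfolding planar_map_def Let_def E F V cyc_rot by (simp add: cyc_def nc_def)
  then show ?thesis
    using cyc_opp card_darts by (simp add: genus0_def Un_commute)
qed

text \<open>The transposition exchanges the images of two opposite darts: \<open>a\<close> now goes
  to \<open>\<rho> (\<rho> (\<rho> a))\<close> and \<open>\<rho> (\<rho> a)\<close> to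
  \<open>\<rho> a\<close>. These are the partners exactly when \<open>a\<close> is joined with the
  dart preceding it counterclockwise, which is the meaning of the condition on
  \<open>over D\<close>.\<close>

lemma smooth_at_insert:
  assumes a: "a \<in> X" "(a \<in> over D) = (s (base D a) = Pos)" "s (base D a) \<noteq> Zero" "base D a \<notin> Z"
  shows "smooth_at (insert (base D a) Z) s = smooth_at Z s \<circ> transpose a (\<rho> (\<rho> a))"
proof
  fix d
  let ?b = "\<rho> (\<rho> a)"
  have aM: "a \<in> M" using a by (simp add: X_iff)
  have four: "\<rho> (\<rho> (\<rho> (\<rho> a))) = a" and all: "d \<in> M \<Longrightarrow> base D d = base D a \<Longrightarrow>
      d \<in> {a, \<rho> a, ?b, \<rho> ?b}" and dist: "distinct [a, \<rho> a, ?b, \<rho> ?b]"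
    using rot_four [OF a(1)] by auto
  show "smooth_at (insert (base D a) Z) s d = (smooth_at Z s \<circ> transpose a ?b) d"
  proof (cases "d \<in> M \<and> base D d = base D a")
    case True
    then have "d \<in> {a, \<rho> a, ?b, \<rho> ?b}" using all by blast
    then show ?thesis
      using dist four a aM by (auto simp: smooth_at_def partner_eq transpose_def)
  next
    case False
    then have "d \<noteq> a" "d \<noteq> ?b" using aM by auto
    then show ?thesis using False by (auto simp: smooth_at_def)
  qed
qed

lemma genus0_smooth:
  assumes "finite Z" "Z \<subseteq> crossings D" "\<And>x. x \<in> Z \<Longrightarrow> s x \<noteq> Zero"
  shows "smooth_at Z s permutes M \<and> genus0 M (smooth_at Z s) (opp_on {}) \<and>
    cyc M (smooth_at Z s) = card (base D ` M) + card Z"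
  using assms
proof (induction Z rule: finite_induct)
  case empty
  have "smooth_at {} s = \<rho>" by (auto simp: smooth_at_def)
  then show ?case using rot_permutes genus0_diagram cyc_rot by simp
next
  case (insert x Z)
  then have IH: "smooth_at Z s permutes M" "genus0 M (smooth_at Z s) (opp_on {})"
    "cyc M (smooth_at Z s) = card (base D ` M) + card Z" by auto
  have "card {d \<in> M. base D d = x} = 4" using valence insert by auto
  then obtain d where d: "d \<in> M" "base D d = x"
    by (metis (mono_tags, lifting) card.empty empty_Collect_eq zero_neq_numeral)
  \<comment> \<open>Over and under darts alternate, so \<open>d\<close> or its successor is of the
    kind that \<open>smooth_at_insert\<close> requires.\<close>
  define a where "a = (if (d \<in> over D) = (s x = Pos) then d else \<rho> d)"
  have dX: "d \<in> X" using d insert by (simp add: X_iff)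
  have a: "a \<in> X" "(a \<in> over D) = (s (base D a) = Pos)" "base D a = x"
    using dX d over_rot [OF dX] by (auto simp: a_def)
  let ?b = "\<rho> (\<rho> a)"
  have eq: "smooth_at (insert x Z) s = smooth_at Z s \<circ> transpose a ?b"
    using smooth_at_insert [of a s Z] a insert by auto
  have aM: "a \<in> M" "?b \<in> M" "a \<noteq> ?b" using a rot_four(3) [OF a(1)] by (auto simp: X_iff)
  have "(smooth_at Z s ^^ 2) a = ?b"
    using insert.hyps a aM by (simp add: numeral_2_eq_2 smooth_at_def)
  then have c: "(a, ?b) \<in> conn M (gr M (smooth_at Z s))"
    using conn_permutes_iff [OF IH(1)] aM by auto
  show ?case
    unfolding eq
  proof (intro conjI)
    show "smooth_at Z s \<circ> transpose a ?b permutes M"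
      by (rule permutes_comp_transpose [OF IH(1) aM(1,2)])
    show "genus0 M (smooth_at Z s \<circ> transpose a ?b) (opp_on {})"
      by (rule genus0_split_left [OF IH(2,1) _ _ aM c]) (simp_all add: opp_on_permutes)
    have "cyc M (smooth_at Z s \<circ> transpose a ?b) = Suc (cyc M (smooth_at Z s))"
      by (rule cyc_split [OF IH(1) _ aM c]) simp
    then show "cyc M (smooth_at Z s \<circ> transpose a ?b) = card (base D ` M) + card (insert x Z)"
      using IH(3) insert.hyps by simp
  qed
qed

lemma genus0_cut:
  assumes p: "p permutes M" "genus0 M p (opp_on {})" and F: "finite F" "F \<subseteq> strands D"
  shows "genus0 M p (opp_on F) \<and> cyc M (opp_on F) = card dart_strands + card (F \<inter> dart_strands)"
  using F
proof (induction F rule: finite_induct)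
  case empty
  then show ?case using p cyc_opp by simp
next
  case (insert e F)
  then have IH: "genus0 M p (opp_on F)" "cyc M (opp_on F) = card dart_strands + card (F \<inter> dart_strands)"
    and F: "F \<subseteq> strands D" by auto
  show ?case
  proof (cases "e \<in> dart_strands")
    \<comment> \<open>The strand of a circle contains no dart, so cutting it does not change the
      map.\<close>
    case False
    then have "e \<inter> M = {}" using insert.prems strand_unique by (auto simp: dart_strands_def)
    then have "opp_on (insert e F) = opp_on F" by (auto simp: opp_on_def fun_eq_iff)
    then show ?thesis using False IH by simp
  next
    case True
    then obtain d where d: "d \<in> M" "e = {d, opp D d}" by (auto simp: dart_strands_def)
    have od: "opp D d \<in> M" "d \<noteq> opp D d" using opp_facts(1) [OF d(1)] opp_facts(2) [OF d(1)] by metis+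
    have nF: "d \<notin> \<Union>F" "opp D d \<notin> \<Union>F"
      using strand_mem [OF F d(1)] strand_mem_opp [OF F d(1)] d insert.hyps by auto
    have eq: "opp_on (insert e F) = opp_on F \<circ> transpose d (opp D d)"
    proof
      fix x
      show "opp_on (insert e F) x = (opp_on F \<circ> transpose d (opp D d)) x"
      proof (cases "x = d \<or> x = opp D d")
        case True
        have "opp_on (insert e F) x = x" using True d(2) by (auto simp: opp_on_def)
        moreover have "opp_on F (opp D d) = d" "opp_on F d = opp D d"
          using d(1) od(1) nF by (simp_all add: opp_on_def)
        ultimately show ?thesis using True by auto
      next
        case False
        then show ?thesis using d(2) by (simp add: opp_on_def transpose_def)
      qed
    qed
    have c: "(d, opp D d) \<in> conn M (gr M (opp_on F))"
      using d od nF by (intro conn_link) (auto simp: opp_on_def)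
    have "card (insert e F \<inter> dart_strands) = Suc (card (F \<inter> dart_strands))"
      using True insert.hyps by simp
    show ?thesis
      unfolding eq
    proof (intro conjI)
      show "genus0 M p (opp_on F \<circ> transpose d (opp D d))"
        by (rule genus0_split_right [OF IH(1) p(1) opp_on_permutes [OF F] _ d(1) od c]) simp
      have "cyc M (opp_on F \<circ> transpose d (opp D d)) = Suc (cyc M (opp_on F))"
        by (rule cyc_split [OF opp_on_permutes [OF F] _ d(1) od c]) simp
      then show "cyc M (opp_on F \<circ> transpose d (opp D d)) = card dart_strands + card (insert e F \<inter> dart_strands)"
        using IH(2) \<open>card (insert e F \<inter> dart_strands) = _\<close> by simp
    qed
  qed
qed

end


section \<open>State sums over cut strands\<close>

lemma sum_Pow_insert:
  assumes "finite A" "b \<notin> A"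
  shows "(\<Sum>F\<in>Pow (insert b A). w F) = (\<Sum>F\<in>Pow A. w F) + (\<Sum>F\<in>Pow A. w (insert b F))"
proof -
  have "(\<Sum>F\<in>Pow (insert b A). w F) = sum w (Pow A) + sum w (insert b ` Pow A)"
    unfolding Pow_insert by (rule sum.union_disjoint) (use assms in auto)
  also have "sum w (insert b ` Pow A) = (\<Sum>F\<in>Pow A. w (insert b F))"
    by (subst sum.reindex) (use assms in \<open>auto intro!: inj_onI\<close>)
  finally show ?thesis .
qed

lemma sum_Pow_cancel:
  fixes w :: "'a set \<Rightarrow> 'k::comm_monoid_add"
  assumes "finite A" "r \<in> A" and "\<And>F. F \<subseteq> A - {r} \<Longrightarrow> w F + w (insert r F) = 0"
  shows "(\<Sum>F\<in>Pow A. w F) = 0"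
proof -
  have A: "A = insert r (A - {r})" using assms(2) by blast
  have "(\<Sum>F\<in>Pow A. w F) = (\<Sum>F\<in>Pow (A - {r}). w F + w (insert r F))"
    by (subst A, subst sum_Pow_insert) (use assms(1) in \<open>auto simp: sum.distrib\<close>)
  also have "\<dots> = 0" using assms(3) by (intro sum.neutral) auto
  finally show ?thesis .
qed

text \<open>A set that contains an element \<open>b\<close> of \<open>B\<close> cancels against the
  set in which the associated \<open>r\<close> is toggled. Treating the elements of \<open>B\<close>
  one by one leaves the subsets of \<open>Q\<close>.\<close>

lemma sum_Pow_representatives:
  fixes w :: "'a set \<Rightarrow> 'k::comm_monoid_add"
  assumes "finite B" "finite Q" "Q \<inter> B = {}"
    and "\<And>b. b \<in> B \<Longrightarrow> \<exists>r\<in>Q. \<forall>F. F \<subseteq> (Q \<union> B) - {b, r} \<longrightarrow>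
      w (insert b F) + w (insert r (insert b F)) = 0"
  shows "(\<Sum>F\<in>Pow (Q \<union> B). w F) = (\<Sum>F\<in>Pow Q. w F)"
  using assms(1,3,4)
proof (induction B rule: finite_induct)
  case (insert b B)
  obtain r where r: "r \<in> Q" "\<And>F. F \<subseteq> (Q \<union> insert b B) - {b, r} \<Longrightarrow>
      w (insert b F) + w (insert r (insert b F)) = 0"
    using insert.prems(2) [of b] by auto
  have bQ: "b \<notin> Q \<union> B" using insert by auto
  have "(\<Sum>F\<in>Pow (Q \<union> insert b B). w F) =
      (\<Sum>F\<in>Pow (Q \<union> B). w F) + (\<Sum>F\<in>Pow (Q \<union> B). w (insert b F))"
    using sum_Pow_insert [of "Q \<union> B" b w] insert.hyps assms(2) bQ by simp
  also have "(\<Sum>F\<in>Pow (Q \<union> B). w (insert b F)) = 0"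
  proof (rule sum_Pow_cancel [where r = r])
    fix F assume F: "F \<subseteq> Q \<union> B - {r}"
    have "w (insert b F) + w (insert r (insert b F)) = 0" by (rule r(2)) (use F bQ in auto)
    then show "w (insert b F) + w (insert b (insert r F)) = 0" by (simp add: insert_commute)
  qed (use insert.hyps assms(2) r in auto)
  also have "(\<Sum>F\<in>Pow (Q \<union> B). w F) = (\<Sum>F\<in>Pow Q. w F)"
  proof (rule insert.IH)
    fix b' assume b': "b' \<in> B"
    then obtain r' where "r' \<in> Q" "\<forall>F. F \<subseteq> (Q \<union> insert b B) - {b', r'} \<longrightarrow>
      w (insert b' F) + w (insert r' (insert b' F)) = 0"
      using insert.prems(2) [of b'] by auto
    then show "\<exists>r\<in>Q. \<forall>F. F \<subseteq> (Q \<union> B) - {b', r} \<longrightarrow> w (insert b' F) + w (insert r (insert b' F)) = 0"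
      by (intro bexI [of _ r']) auto
  qed (use insert in auto)
  finally show ?case by simp
qed simp

section \<open>Components and boundary curves of the surface of a state\<close>

context link_diagram
begin

definition state_nodes :: "('v \<Rightarrow> marker) \<Rightarrow> 'v set" where
  "state_nodes s = vertices D \<union> {x \<in> crossings D. s x = Zero}"

definition smoothed :: "('v \<Rightarrow> marker) \<Rightarrow> 'v set" where
  "smoothed s = {x \<in> crossings D. s x \<noteq> Zero}"

abbreviation "isolated \<equiv> vertices D - base D ` M"

lemma resolution_nodes: "resolution D (state_nodes s) (partner D s)"
  by (rule resolution_state) (auto simp: state_nodes_def)

text \<open>The last summand counts the disks of isolated vertices, which carry no darts and so form
  no class of \<open>links\<close>.\<close>

definition comps :: "('v \<Rightarrow> marker) \<Rightarrow> 'd set set \<Rightarrow> nat" where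
  "comps s F = nc (resolution.arcs D) (resolution.links D (state_nodes s) (partner D s) F) + card isolated"

abbreviation faces :: "('v \<Rightarrow> marker) \<Rightarrow> 'd set set \<Rightarrow> nat" where
  "faces s F \<equiv> cyc M (smooth_at (smoothed s) s \<circ> opp_on F)"

text \<open>The number of boundary curves of the surface of the state \<open>s\<close> when the strips in \<open>F\<close> are cut.\<close>

definition curves :: "('v \<Rightarrow> marker) \<Rightarrow> 'd set set \<Rightarrow> nat" where
  "curves s F = faces s F + card isolated + card (circles D) + card (circles D - \<Union>F)"

lemma finite_strands: "finite (strands D)"
  by (simp add: strands_eq dart_strands_def)

lemma circle_strand: "e \<in> strands D \<Longrightarrow> c \<in> e \<Longrightarrow> c \<in> circles D \<Longrightarrow> e = {c}"
  using disjoints(2) by (auto simp: strands_def dest: opp_facts(1))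

lemma crossing_bases: "crossings D \<subseteq> base D ` M"
proof
  fix x assume "x \<in> crossings D"
  then have "card {d \<in> M. base D d = x} = 4" by (rule valence)
  then have "{d \<in> M. base D d = x} \<noteq> {}" by (intro notI) simp
  then show "x \<in> base D ` M" by blast
qed

lemma card_bases: "card (base D ` M) + card isolated = card (vertices D) + card (crossings D)"
proof -
  have "card (base D ` M \<union> isolated) = card (base D ` M) + card isolated"
    by (rule card_Un_disjoint) auto
  moreover have "base D ` M \<union> isolated = vertices D \<union> crossings D"
    using base_in crossing_bases by auto
  moreover have "card (vertices D \<union> crossings D) = card (vertices D) + card (crossings D)"
    by (rule card_Un_disjoint) (use disjoints in auto)
  ultimately show ?thesis by simp
qed

lemma card_smoothed: "card (smoothed s) + card {x \<in> crossings D. s x = Zero} = card (crossings D)"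
  unfolding smoothed_def
  by (subst card_Un_disjoint [symmetric]) (auto intro: arg_cong [where f = card])

text \<open>The passage from resolutions to permutations, where genus 0 is available: on darts
  \<open>turn\<close> is \<open>smooth_at\<close>, and a fixed point of \<open>opp_on F\<close> only
  gives a trivial link.\<close>

lemma comps_eq:
  assumes F: "F \<subseteq> strands D"
  shows "comps s F = nc M (gr M (smooth_at (smoothed s) s) \<union> gr M (opp_on F)) +
    card (circles D) + card isolated"
proof -
  interpret r: resolution D "state_nodes s" "partner D s" by (rule resolution_nodes)
  have turn: "r.turn d = smooth_at (smoothed s) s d" if "d \<in> M" for d
  proof -
    have "base D d \<in> state_nodes s \<longleftrightarrow> base D d \<notin> smoothed s"
      using base_in [OF that] disjoints by (auto simp: state_nodes_def smoothed_def)
    then show ?thesis using that by (simp add: r.turn_def smooth_at_def)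
  qed
  have sub: "u \<in> M \<and> v \<in> M" if "(u, v) \<in> r.links F" for u v
    using that by (auto simp: r.links_def r.turn_in)
  have "nc r.arcs (r.links F) = nc M (r.links F) + card (circles D)"
    unfolding r.arcs_def by (rule nc_add_isolated) (use disjoints sub in auto)
  moreover have c: "conn M (r.links F) = conn M (gr M (smooth_at (smoothed s) s) \<union> gr M (opp_on F))"
  proof (rule conn_eqI)
    fix u v assume uv: "(u, v) \<in> r.links F" "u \<in> M" "v \<in> M"
    then show "(u, v) \<in> conn M (gr M (smooth_at (smoothed s) s) \<union> gr M (opp_on F))"
      by (intro conn_link) (auto simp: r.links_def turn opp_on_def)
  next
    fix u v assume uv: "(u, v) \<in> gr M (smooth_at (smoothed s) s) \<union> gr M (opp_on F)" "u \<in> M" "v \<in> M"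
    then have "u = v \<or> (u, v) \<in> r.links F"
      using turn by (auto simp: r.links_def opp_on_def split: if_splits)
    then show "(u, v) \<in> conn M (r.links F)" using uv by (auto intro: conn_link)
  qed
  ultimately show ?thesis unfolding comps_def using nc_cong_conn [OF c] by linarith
qed

lemma smooth_facts:
  "smooth_at (smoothed s) s permutes M"
  "genus0 M (smooth_at (smoothed s) s) (opp_on {})"
  "cyc M (smooth_at (smoothed s) s) = card (base D ` M) + card (smoothed s)"
proof -
  have "finite (smoothed s)" "smoothed s \<subseteq> crossings D" "\<And>x. x \<in> smoothed s \<Longrightarrow> s x \<noteq> Zero"
    by (auto simp: smoothed_def)
  note * = genus0_smooth [OF this]
  show "smooth_at (smoothed s) s permutes M" by (rule conjunct1 [OF *])
  show "genus0 M (smooth_at (smoothed s) s) (opp_on {})" by (rule conjunct1 [OF conjunct2 [OF *]])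
  show "cyc M (smooth_at (smoothed s) s) = card (base D ` M) + card (smoothed s)"
    by (rule conjunct2 [OF conjunct2 [OF *]])
qed

text \<open>This is genus 0 of the cut state, with all cycle numbers expressed through
  \<open>D\<close>; disks of isolated vertices and annuli obey the same formula. Consequently a
  further cut raises the number of curves by 1 if it separates a component and lowers it by 1
  otherwise.\<close>

lemma curves_euler:
  assumes F: "F \<subseteq> strands D"
  shows "int (curves s F) + int (card F) = int (card dart_strands) - int (card (vertices D))
    - 2 * int (card (crossings D)) + int (card {x \<in> crossings D. s x = Zero}) + 2 * int (comps s F)"
proof -
  have finF: "finite F" using F finite_strands finite_subset by blast
  have g: "genus0 M (smooth_at (smoothed s) s) (opp_on F)"
    "cyc M (opp_on F) = card dart_strands + card (F \<inter> dart_strands)"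
    using genus0_cut [OF smooth_facts(1,2) finF F] by auto
  let ?c = "\<lambda>c. {c}"
  have Fsplit: "F = (F \<inter> dart_strands) \<union> ?c ` (circles D \<inter> \<Union>F)"
  proof -
    have "c \<in> circles D \<Longrightarrow> c \<in> f \<Longrightarrow> f \<in> F \<Longrightarrow> {c} \<in> F" for c f
      using circle_strand F by blast
    then show ?thesis using F unfolding strands_eq by blast
  qed
  have "(F \<inter> dart_strands) \<inter> ?c ` (circles D \<inter> \<Union>F) = {}"
    using disjoints by (auto simp: dart_strands_def)
  then have "card ((F \<inter> dart_strands) \<union> ?c ` (circles D \<inter> \<Union>F)) =
      card (F \<inter> dart_strands) + card (?c ` (circles D \<inter> \<Union>F))"
    using finF by (intro card_Un_disjoint) auto
  moreover have "card (?c ` (circles D \<inter> \<Union>F)) = card (circles D \<inter> \<Union>F)"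
    by (simp add: card_image)
  ultimately have cF: "card F = card (F \<inter> dart_strands) + card (circles D \<inter> \<Union>F)"
    using Fsplit by argo
  have "card (circles D - \<Union>F) + card (circles D \<inter> \<Union>F) = card (circles D)"
    by (subst card_Un_disjoint [symmetric]) (auto intro: arg_cong [where f = card])
  then show ?thesis
    using g cF card_darts card_bases card_smoothed [of s] comps_eq [OF F, of s] smooth_facts(3) [of s]
    unfolding genus0_def curves_def by linarith
qed

text \<open>Faces refine components, so every component has a boundary curve. This makes the natural
  number \<open>curves s F - comps s F\<close>, the Betti number, an exact difference.\<close>

lemma comps_le_curves:
  assumes "F \<subseteq> strands D"
  shows "comps s F \<le> curves s F"
proof -
  have "nc M (gr M (smooth_at (smoothed s) s) \<union> gr M (opp_on F)) \<le> faces s F"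
    unfolding cyc_def
    by (rule nc_antimono [OF _ conn_comp_subset [OF smooth_facts(1) opp_on_permutes [OF assms]]]) simp
  then show ?thesis by (simp add: comps_eq [OF assms] curves_def)
qed

text \<open>With mu = \<open>comps s F\<close> and beta = \<open>curves s F - comps s F\<close> this
  is (-1)^mu (-p^2)^beta, a term of \<open>h_poly\<close> at x = -1 and y = -p^2, where the factor
  (-x)^(-|F|) is 1. Unlike that term it is defined for every set of strands, also for several
  strands of one edge.\<close>

definition weight :: "('v \<Rightarrow> marker) \<Rightarrow> 'k::field \<Rightarrow> 'd set set \<Rightarrow> 'k" where
  "weight s p F = (- 1) ^ curves s F * p ^ (2 * (curves s F - comps s F))"

lemma card_darts_nodes:
  "card {d \<in> M. base D d \<in> state_nodes s} + 4 * card (smoothed s) = card M"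
proof -
  have "{d \<in> M. base D d \<in> smoothed s} = (\<Union>x\<in>smoothed s. {d \<in> M. base D d = x})" by auto
  also have "card \<dots> = (\<Sum>x\<in>smoothed s. card {d \<in> M. base D d = x})"
    by (rule card_UN_disjoint) (auto simp: smoothed_def)
  also have "\<dots> = 4 * card (smoothed s)" by (simp add: smoothed_def valence)
  finally have "card {d \<in> M. base D d \<in> smoothed s} = 4 * card (smoothed s)" .
  moreover have "card ({d \<in> M. base D d \<in> state_nodes s} \<union> {d \<in> M. base D d \<in> smoothed s}) =
      card {d \<in> M. base D d \<in> state_nodes s} + card {d \<in> M. base D d \<in> smoothed s}"
    by (rule card_Un_disjoint) (use disjoints in \<open>auto simp: state_nodes_def smoothed_def\<close>)
  moreover have "{d \<in> M. base D d \<in> state_nodes s} \<union> {d \<in> M. base D d \<in> smoothed s} = M"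
    using base_in by (auto simp: state_nodes_def smoothed_def)
  ultimately show ?thesis by simp
qed

lemma card_state_nodes:
  "card (state_nodes s) = card (vertices D) + card {x \<in> crossings D. s x = Zero}"
  unfolding state_nodes_def by (rule card_Un_disjoint) (use disjoints in auto)

text \<open>The right side is the constant of \<open>curves_euler\<close>; this is what identifies
  \<open>curves - comps\<close> with a Betti number.\<close>

lemma state_graph_euler:
  "int (card (gedges (state_graph D s))) - int (card (gverts (state_graph D s))) =
    int (card dart_strands) - int (card (vertices D)) - 2 * int (card (crossings D))
    + int (card {x \<in> crossings D. s x = Zero})"
proof -
  have sg: "state_graph D s = resolve D (state_nodes s) (partner D s)"
    by (simp add: state_graph_def state_nodes_def)
  have "2 * (int (card (gedges (state_graph D s))) - int (card (gverts (state_graph D s)))) =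
      int (card {d \<in> M. base D d \<in> state_nodes s}) - 2 * int (card (state_nodes s))"
    unfolding sg by (rule resolution.resolve_euler [OF resolution_nodes])
  moreover have "int (card {d \<in> M. base D d \<in> state_nodes s}) + 4 * int (card (smoothed s)) =
      2 * int (card dart_strands)"
    using card_darts_nodes [of s] card_darts by linarith
  moreover have "int (card (smoothed s)) + int (card {x \<in> crossings D. s x = Zero}) =
      int (card (crossings D))"
    using card_smoothed [of s] by linarith
  ultimately show ?thesis using card_state_nodes [of s] by simp
qed

lemma underlying_graph_euler:
  "int (card (gedges (underlying_graph D))) - int (card (gverts (underlying_graph D))) =
    int (card dart_strands) - int (card (vertices D)) - 2 * int (card (crossings D))"
proof -
  \<comment> \<open>\<open>resolve_euler\<close> does not see how the removed nodes are joined, so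
    the counts for any state that keeps no crossing also serve the underlying graph.\<close>
  let ?s = "\<lambda>x. Pos"
  have n: "state_nodes ?s = vertices D" by (simp add: state_nodes_def)
  show ?thesis
    unfolding underlying_graph_def
    using resolution.resolve_euler [OF resolution_underlying] card_darts_nodes [of ?s] card_darts
      card_smoothed [of ?s] n
    by simp
qed

text \<open>With one strand chosen in each edge, a set of edges corresponds to a set of chosen
  strands, and all sets containing a strand that was not chosen cancel in pairs.\<close>

lemma h_poly_state_graph:
  fixes p :: "'k::field"
  shows "h_poly (state_graph D s) (- 1) (- (p ^ 2)) = (\<Sum>F\<in>Pow (strands D). weight s p F)"
proof -
  interpret r: resolution D "state_nodes s" "partner D s" by (rule resolution_nodes)
  let ?E = "r.edge_of ` r.arcs"
  have sg: "state_graph D s = resolve D (state_nodes s) (partner D s)"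
    by (simp add: state_graph_def state_nodes_def)
  have strand_ex: "\<exists>e. e \<in> strands D \<and> e \<subseteq> X" if X: "X \<in> ?E" for X
  proof -
    obtain x where x: "x \<in> r.arcs" "X = r.edge_of x" using X by blast
    show ?thesis
    proof (cases "x \<in> M")
      case True
      then have "opp D x \<in> X" using r.piece_opp [of x "{}" x] x by simp
      then show ?thesis using True x by (intro exI [of _ "{x, opp D x}"]) (auto simp: strands_eq dart_strands_def)
    next
      case False
      then show ?thesis using x by (intro exI [of _ "{x}"]) (auto simp: strands_eq r.arcs_def)
    qed
  qed
  define q where "q X = (SOME e. e \<in> strands D \<and> e \<subseteq> X)" for X
  have q: "q X \<in> strands D" "q X \<subseteq> X" if "X \<in> ?E" for X
    using someI_ex [OF strand_ex [OF that]] by (auto simp: q_def)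
  have strand_ne: "e \<noteq> {}" if "e \<in> strands D" for e
    using that by (auto simp: strands_def)
  have q_inj: "inj_on q ?E"
  proof (rule inj_onI)
    fix X Y assume XY: "X \<in> ?E" "Y \<in> ?E" "q X = q Y"
    obtain y where "y \<in> q X" using strand_ne [OF q(1) [OF XY(1)]] by blast
    then have "y \<in> X" "y \<in> Y" using q(2) XY by auto
    then show "X = Y" using r.edge_eqI XY by metis
  qed
  \<comment> \<open>In an edge that is already cut, a further cut adds a component and hence, by the
    Euler count, a curve. The exponent of \<open>p\<close> stays and the sign changes.\<close>
  have again: "weight s p (insert b F) + weight s p (insert e (insert b F)) = 0"
    if X: "X \<in> ?E" and be: "b \<in> strands D" "e \<in> strands D" "b \<subseteq> X" "e \<subseteq> X"
      and F: "F \<subseteq> strands D" "e \<notin> insert b F" for X b e F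
  proof -
    let ?F = "insert b F"
    have F': "?F \<subseteq> strands D" "insert e ?F \<subseteq> strands D" using F be by auto
    have "comps s (insert e ?F) = Suc (comps s ?F)"
      using r.cut_again [OF F'(1) be(2) F(2) be(4) _ be(3) X] by (simp add: comps_def)
    moreover have "card (insert e ?F) = Suc (card ?F)"
      using F(2) finite_subset [OF F'(1) finite_strands] by simp
    ultimately have "curves s (insert e ?F) = Suc (curves s ?F)"
      using curves_euler [OF F'(1), of s] curves_euler [OF F'(2), of s] by linarith
    with \<open>comps s (insert e ?F) = _\<close> show ?thesis by (simp add: weight_def)
  qed
  have q_sub: "q ` ?E \<subseteq> strands D" using q by auto
  have "(\<Sum>F\<in>Pow (strands D). weight s p F) = (\<Sum>F\<in>Pow (q ` ?E \<union> (strands D - q ` ?E)). weight s p F)"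
    using q_sub by (simp add: Un_absorb1)
  also have "\<dots> = (\<Sum>F\<in>Pow (q ` ?E). weight s p F)"
  proof (rule sum_Pow_representatives)
    fix b assume b: "b \<in> strands D - q ` ?E"
    then have "b \<noteq> {}" by (intro strand_ne) simp
    then obtain x where x: "x \<in> b" by blast
    have xa: "x \<in> r.arcs" using x b by (auto simp: strands_def r.arcs_def)
    let ?X = "r.edge_of x"
    have X: "?X \<in> ?E" using xa by simp
    have bX: "b \<subseteq> ?X"
    proof (cases "x \<in> M")
      case True
      then have "b = {x, opp D x}" using strand_unique b x by blast
      then show ?thesis using r.piece_opp [of x "{}" x] True by simp
    next
      case False
      then have "b = {x}" using b x by (auto simp: strands_eq dart_strands_def)
      then show ?thesis by simp
    qed
    show "\<exists>r\<in>q ` ?E. \<forall>F. F \<subseteq> q ` ?E \<union> (strands D - q ` ?E) - {b, r} \<longrightarrow>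
        weight s p (insert b F) + weight s p (insert r (insert b F)) = 0"
    proof (intro bexI allI impI)
      fix F assume F: "F \<subseteq> q ` ?E \<union> (strands D - q ` ?E) - {b, q ?X}"
      have "q ?X \<noteq> b" using b X by blast
      moreover have "F \<subseteq> strands D" "q ?X \<notin> F" using F q_sub by blast+
      ultimately show "weight s p (insert b F) + weight s p (insert (q ?X) (insert b F)) = 0"
        using b by (intro again [OF X _ q(1) [OF X] bX q(2) [OF X]]) auto
    qed (use X in blast)
  qed (use finite_strands r.finite_arcs in auto)
  also have "\<dots> = (\<Sum>C\<in>Pow ?E. weight s p (q ` C))"
  proof -
    have "Pow (q ` ?E) = (`) q ` Pow ?E" by (simp add: image_Pow_surj)
    then show ?thesis by (simp add: sum.reindex inj_on_image_Pow [OF q_inj])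
  qed
  also have "\<dots> = h_poly (state_graph D s) (- 1) (- (p ^ 2))"
    unfolding h_poly_def
  proof (rule sum.cong)
    show "Pow ?E = Pow (gedges (state_graph D s))" by (simp add: sg r.edges_eq)
  next
    fix C assume "C \<in> Pow (gedges (state_graph D s))"
    then have C: "C \<subseteq> ?E" by (simp add: sg r.edges_eq)
    let ?F = "q ` C"
    have F: "?F \<subseteq> strands D" using q C by auto
    have "state_nodes s - base D ` M = isolated"
      using crossing_bases by (auto simp: state_nodes_def)
    then have n: "num_components (delete_edges (state_graph D s) C) = comps s ?F"
      unfolding sg comps_def
      using r.components_delete_edges [where r = q and F = ?F, OF C] q C by (metis subsetD)
    have cF: "card ?F = card C" using q_inj C inj_on_subset card_image by metis
    have finE: "finite (gedges (state_graph D s))" using r.finite_arcs by (simp add: sg r.edges_eq)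
    have "card (gedges (state_graph D s) - C) = card (gedges (state_graph D s)) - card C"
      using C finE finite_subset by (intro card_Diff_subset) (auto simp: sg r.edges_eq)
    moreover have "card C \<le> card (gedges (state_graph D s))"
      using C finE by (intro card_mono) (auto simp: sg r.edges_eq)
    \<comment> \<open>Both Euler counts give edges - vertices - cuts = curves - 2 components; adding
      the components yields the Betti number.\<close>
    ultimately have b: "betti (delete_edges (state_graph D s) C) = curves s ?F - comps s ?F"
      using n curves_euler [OF F, of s] state_graph_euler [of s] cF comps_le_curves [OF F, of s]
      unfolding betti_def by (simp add: delete_edges_def)
    have "(- 1 :: 'k) ^ curves s ?F = (- 1) ^ comps s ?F * (- 1) ^ (curves s ?F - comps s ?F)"
      by (simp add: power_add [symmetric] comps_le_curves [OF F])
    then show "weight s p ?F = (- (- 1)) powi (- int (card C)) *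
        (- 1) ^ num_components (delete_edges (state_graph D s) C) *
        (- (p ^ 2)) ^ betti (delete_edges (state_graph D s) C)"
      unfolding n b weight_def by (simp add: power_mult power_minus [of "p ^ 2"])
  qed
  finally show ?thesis by simp
qed

end


section \<open>Boundary curves of the band surface\<close>

context link_diagram
begin

definition band_darts :: "('v, 'd) bdart set" where
  "band_darts = OutL ` M \<union> OutR ` M \<union> In1 ` X \<union> In2 ` X"

text \<open>\<open>T d\<close> says that the smoothing of the corner \<open>d\<close> of a band crossing separates the outer from
  the inner strands.\<close>

inductive_set band_links :: "('d \<Rightarrow> bool) \<Rightarrow> 'd set set \<Rightarrow> (('v, 'd) bdart \<times> ('v, 'd) bdart) set"
  for T F where
  corner: "d \<in> M \<Longrightarrow> (d \<in> X \<Longrightarrow> T d) \<Longrightarrow> (OutL d, OutR (\<rho> d)) \<in> band_links T F"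
| enter: "d \<in> X \<Longrightarrow> \<not> T d \<Longrightarrow> (OutL d, In2 d) \<in> band_links T F"
| leave: "d \<in> X \<Longrightarrow> \<not> T d \<Longrightarrow> (In1 d, OutR (\<rho> d)) \<in> band_links T F"
| bounce: "d \<in> X \<Longrightarrow> T d \<Longrightarrow> (In1 d, In2 d) \<in> band_links T F"
| side: "d \<in> X \<Longrightarrow> (In1 d, In2 (\<rho> d)) \<in> band_links T F"
| strand: "d \<in> M \<Longrightarrow> (OutL d, OutR (opp_on F d)) \<in> band_links T F"

lemma band_darts_simps [simp]:
  "OutL d \<in> band_darts \<longleftrightarrow> d \<in> M" "OutR d \<in> band_darts \<longleftrightarrow> d \<in> M"
  "In1 d \<in> band_darts \<longleftrightarrow> d \<in> X" "In2 d \<in> band_darts \<longleftrightarrow> d \<in> X"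
  "Disk v \<notin> band_darts" "Rim1 d \<notin> band_darts" "Rim2 d \<notin> band_darts"
  by (auto simp: band_darts_def)

lemma X_M: "d \<in> X \<Longrightarrow> d \<in> M"
  by (simp add: X_iff)

lemma finite_X: "finite X"
  by (rule finite_subset [of _ M]) (auto simp: X_iff)

lemma finite_band_darts: "finite band_darts"
  by (simp add: band_darts_def finite_X)

lemma opp_on_in: "d \<in> M \<Longrightarrow> opp_on F d \<in> M"
  by (simp add: opp_on_def)

lemma band_links_subset: "(a, b) \<in> band_links T F \<Longrightarrow> a \<in> band_darts \<and> b \<in> band_darts"
  by (induction rule: band_links.induct) (auto simp: X_M opp_on_in)

abbreviation bcls :: "('d \<Rightarrow> bool) \<Rightarrow> 'd set set \<Rightarrow> ('v, 'd) bdart \<Rightarrow> ('v, 'd) bdart set" where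
  "bcls T F \<equiv> cls band_darts (band_links T F)"

lemma bcls_link: "(a, b) \<in> band_links T F \<Longrightarrow> bcls T F a = bcls T F b"
  using cls_link [of a b "band_links T F" band_darts] band_links_subset [of a b T F] by simp

text \<open>At this crossing both arcs of the strip of \<open>\<rho> d\<close> are joined to each
  other through \<open>In2 (\<rho> d)\<close> and \<open>In1 d\<close>. Cutting the strip caps this
  arc off to a separate curve.\<close>

lemma nc_band_turnback:
  assumes d: "d \<in> X" "\<not> T d" "\<not> T (\<rho> d)" and F: "F \<subseteq> strands D" and e: "e = {\<rho> d, opp D (\<rho> d)}" "e \<notin> F"
  shows "nc band_darts (band_links T (insert e F)) = Suc (nc band_darts (band_links T F))"
proof -
  let ?d = "\<rho> d" and ?o = "opp D (\<rho> d)" and ?F = "insert e F"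
  let ?R = "band_links T ?F" and ?Q = "band_links T F"
  have m: "?d \<in> M" "?o \<in> M" "?d \<in> X" "?o \<noteq> ?d" "opp D ?o = ?d" using d by (simp_all add: X_M)
  have eS: "?F \<subseteq> strands D" using F e(1) m(1) by (auto simp: strands_eq dart_strands_def)
  have nF: "?d \<notin> \<Union>F" "?o \<notin> \<Union>F"
    using strand_mem [OF F m(1)] strand_mem_opp [OF F m(1)] e by auto
  have cut: "opp_on ?F ?d = ?d" "opp_on ?F ?o = ?o" using e(1) by (auto simp: opp_on_def)
  have unc: "opp_on F ?d = ?o" "opp_on F ?o = ?d" using nF m by (auto simp: opp_on_def)
  have same: "opp_on ?F x = opp_on F x" if "x \<noteq> ?d" "x \<noteq> ?o" for x
    using that e(1) by (auto simp: opp_on_def)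
  have turnback: "bcls T G (OutL ?d) = bcls T G (OutR ?d)" for G
  proof -
    have "bcls T G (OutL ?d) = bcls T G (In2 ?d)" by (intro bcls_link band_links.enter m d)
    also have "\<dots> = bcls T G (In1 d)" by (rule sym, intro bcls_link band_links.side d)
    also have "\<dots> = bcls T G (OutR ?d)" by (intro bcls_link band_links.leave d)
    finally show ?thesis .
  qed
  \<comment> \<open>The curve that is split off: the turnback, closed by the cap of the cut
    strip.\<close>
  let ?P = "{OutL ?d, OutR ?d, In1 d, In2 ?d}"
  have "bcls T ?F (OutL ?d) \<subseteq> ?P"
  proof (rule cls_subset)
    fix u v assume "(u, v) \<in> ?R"
    then show "u \<in> ?P \<longleftrightarrow> v \<in> ?P"
    proof cases
      case (corner x)
      then show ?thesis using d m by auto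
    next
      case (strand x)
      have "x = ?d \<longleftrightarrow> opp_on ?F x = ?d"
        using cut(1) opp_on_involution [OF eS strand(3)] by metis
      then show ?thesis using strand by auto
    qed (use d in auto)
  qed simp
  then have disc: "(OutL ?d, OutL ?o) \<notin> conn band_darts ?R"
    using m(4) by (auto simp: mem_cls_iff [symmetric])
  \<comment> \<open>One link across the cut recovers both uncut arcs, since they are joined to each
    other by the turnback on one side and by the cap on the other.\<close>
  have "conn band_darts ?Q = conn band_darts (insert (OutL ?d, OutL ?o) ?R)"
  proof (rule conn_eqI)
    let ?R' = "insert (OutL ?d, OutL ?o) ?R"
    let ?c = "cls band_darts ?R'"
    have sub: "cls band_darts ?R u = cls band_darts ?R v \<Longrightarrow> ?c u = ?c v" for u v
      using conn_insert_mono [of band_darts ?R "(OutL ?d, OutL ?o)"] by (auto simp: cls_eq_iff)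
    have new: "?c (OutL ?d) = ?c (OutL ?o)" by (rule cls_link) (use m in auto)
    have tb: "?c (OutL ?d) = ?c (OutR ?d)" by (rule sub [OF turnback])
    have ob: "?c (OutL ?o) = ?c (OutR ?o)"
      using bcls_link [OF band_links.strand [where d = ?o and T = T and F = ?F]] m cut by (intro sub) simp
    fix u v assume uv: "(u, v) \<in> ?Q" "u \<in> band_darts" "v \<in> band_darts"
    have "?c u = ?c v"
      using uv(1)
    proof cases
      case (strand x)
      show ?thesis
      proof (cases "x = ?d \<or> x = ?o")
        case True
        then show ?thesis using strand unc new tb ob by auto
      next
        case False
        then show ?thesis
          using strand bcls_link [OF band_links.strand [where d = x and T = T and F = ?F]] same by (intro sub) auto
      qed
    qed (intro sub bcls_link; auto intro: band_links.intros)+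
    then show "(u, v) \<in> conn band_darts ?R'" by (simp add: cls_eq_iff)
  next
    fix u v assume uv: "(u, v) \<in> insert (OutL ?d, OutL ?o) ?R" "u \<in> band_darts" "v \<in> band_darts"
    have l1: "bcls T F (OutL ?d) = bcls T F (OutR ?o)"
      using bcls_link [OF band_links.strand [where d = ?d and T = T and F = F]] m unc by simp
    have l2: "bcls T F (OutL ?o) = bcls T F (OutR ?d)"
      using bcls_link [OF band_links.strand [where d = ?o and T = T and F = F]] m unc by simp
    have "bcls T F u = bcls T F v"
    proof (cases "(u, v) = (OutL ?d, OutL ?o)")
      case True
      then show ?thesis using l2 turnback by simp
    next
      case False
      then have "(u, v) \<in> ?R" using uv(1) by (metis insert_iff)
      then show ?thesis
      proof cases
        case (strand x)
        show ?thesis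
        proof (cases "x = ?d \<or> x = ?o")
          case True
          then show ?thesis using strand cut l1 l2 turnback [of F] by auto
        next
          case False
          then show ?thesis
            using strand bcls_link [OF band_links.strand [where d = x and T = T and F = F]] same by auto
        qed
      qed (intro bcls_link; auto intro: band_links.intros)+
    qed
    then show "(u, v) \<in> conn band_darts ?Q" by (simp add: cls_eq_iff)
  qed
  then have "nc band_darts ?Q = nc band_darts (insert (OutL ?d, OutL ?o) ?R)" by (rule nc_cong_conn)
  then show ?thesis
    using nc_insert_disconnected [OF finite_band_darts _ _ disc] m by simp
qed

text \<open>If all four corners are split, the inner strands close up to a small circle inside the
  crossing.\<close>

definition inner_circles :: "('d \<Rightarrow> bool) \<Rightarrow> 'v set" where
  "inner_circles T = {x \<in> crossings D. \<forall>d\<in>X. base D d = x \<longrightarrow> T d}"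

text \<open>Call a corner open if it is not split. Two opposite open corners turn the band crossing
  into a smoothing of the bands; with at most one open corner the outer boundary runs around the
  crossing as around a disk. Assumption \<open>s\<close> says that the marker records this. A curve
  is then either a face of the state or an inner circle.\<close>

lemma nc_band_links:
  assumes F: "F \<subseteq> strands D" and good: "\<And>d. d \<in> X \<Longrightarrow> T d \<or> T (\<rho> d)"
    and s: "\<And>d. d \<in> X \<Longrightarrow> s (base D d) \<noteq> Zero \<and> (d \<in> over D \<longleftrightarrow> s (base D d) = Pos) \<longleftrightarrow>
      \<not> T d \<and> \<not> T (\<rho> (\<rho> d))"
  shows "nc band_darts (band_links T F) = faces s F + card (inner_circles T)"
proof -
  define sm where "sm = smooth_at (smoothed s) s"
  define face where "face = sm \<circ> opp_on F"
  have sm_X: "sm d = (if \<not> T d \<and> \<not> T (\<rho> (\<rho> d)) then \<rho> (\<rho> (\<rho> d)) else \<rho> d)" if "d \<in> X" for d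
    using s [OF that] that by (auto simp: sm_def smooth_at_def smoothed_def partner_eq X_iff)
  have sm_M: "sm d = \<rho> d" if "d \<in> M" "d \<notin> X" for d
    using that by (auto simp: sm_def smooth_at_def smoothed_def X_iff)
  have sm_perm: "sm permutes M" unfolding sm_def by (rule smooth_facts(1))
  have sm_in: "sm d \<in> M \<longleftrightarrow> d \<in> M" for d by (rule permutes_in_image [OF sm_perm])
  have four: "\<rho> (\<rho> (\<rho> (\<rho> d))) = d" if "d \<in> X" for d using rot_four [OF that] by simp
  define all where "all d \<longleftrightarrow> T d \<and> T (\<rho> d) \<and> T (\<rho> (\<rho> d)) \<and> T (\<rho> (\<rho> (\<rho> d)))" for d
  have all_rot: "all (\<rho> d) = all d" if "d \<in> X" for d using four [OF that] by (auto simp: all_def)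
  have all_iff: "all d \<longleftrightarrow> base D d \<in> inner_circles T" if d: "d \<in> X" for d
  proof -
    have "{d' \<in> X. base D d' = base D d} = {d, \<rho> d, \<rho> (\<rho> d), \<rho> (\<rho> (\<rho> d))}"
      using rot_four(2) [OF d] d by (auto simp: X_iff)
    moreover have "base D d \<in> crossings D" using d by (simp add: X_iff)
    moreover have "base D d \<in> inner_circles T \<longleftrightarrow>
        base D d \<in> crossings D \<and> (\<forall>d'\<in>{d' \<in> X. base D d' = base D d}. T d')"
      by (auto simp: inner_circles_def)
    ultimately show ?thesis by (simp add: all_def)
  qed
  \<comment> \<open>The inner strand \<open>In2 d\<close> leads outside at the first open corner
    \<open>x\<close> among \<open>d\<close>, \<open>\<rho> d\<close> and so on; there it joins
    \<open>OutL x\<close>, which continues to \<open>OutR (sm x)\<close>.\<close>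
  define nxt where "nxt d = (if \<not> T d then sm d else if \<not> T (\<rho> d) then sm (\<rho> d)
    else if \<not> T (\<rho> (\<rho> d)) then sm (\<rho> (\<rho> d)) else sm (\<rho> (\<rho> (\<rho> d))))" for d
  have nxt_in: "nxt d \<in> M" if "d \<in> X" for d
    using that by (simp add: nxt_def sm_in X_M)
  let ?fc = "cls M (gr M face)"
  \<comment> \<open>Each dart is sent to some \<open>x\<close> such that \<open>OutR x\<close> lies
    on the same curve, or to its crossing if it belongs to an inner circle. With \<open>x\<close>
    replaced by its face this is a complete invariant of the curves.\<close>
  define g where "g b = (case b of OutL d \<Rightarrow> Inl (sm d) | OutR d \<Rightarrow> Inl d
     | In1 d \<Rightarrow> if all d then Inr (base D d) else Inl (nxt (\<rho> d))
     | In2 d \<Rightarrow> if all d then Inr (base D d) else Inl (nxt d))" for b :: "('v, 'd) bdart"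
  define f where "f b = (case g b of Inl d \<Rightarrow> Inl (?fc d) | Inr v \<Rightarrow> Inr v)" for b
  let ?b = "bcls T F"
  have side: "?b (In1 d) = ?b (In2 (\<rho> d))" if "d \<in> X" for d
    by (intro bcls_link band_links.side that)
  have bounce: "?b (In2 d) = ?b (In2 (\<rho> d))" if "d \<in> X" "T d" for d
    using bcls_link [OF band_links.bounce [of d T F]] that side by simp
  \<comment> \<open>The way on from the left arc of \<open>d\<close>: around a split corner, through
    the crossing to the opposite open corner, or all around the inside and out again at the corner
    \<open>d\<close>.\<close>
  have OutL_sm: "?b (OutL d) = ?b (OutR (sm d))" if d: "d \<in> M" for d
  proof (cases "d \<in> X \<and> \<not> T d")
    case False
    then have "sm d = \<rho> d" using d sm_X [of d] sm_M [of d] by (cases "d \<in> X") auto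
    then show ?thesis using False d bcls_link [OF band_links.corner [of d T F]] by auto
  next
    case True
    then have dX: "d \<in> X" and nT: "\<not> T d" by auto
    have "?b (OutL d) = ?b (In2 d)" by (intro bcls_link band_links.enter dX nT)
    also have "\<dots> = ?b (In2 (\<rho> (\<rho> (\<rho> d))))"
      using good [of "\<rho> (\<rho> (\<rho> d))"] bounce [of "\<rho> (\<rho> (\<rho> d))"] four [OF dX] dX nT by simp
    also have "\<dots> = ?b (In1 (\<rho> (\<rho> d)))" using side [of "\<rho> (\<rho> d)"] dX by simp
    also have "\<dots> = ?b (OutR (sm d))"
    proof (cases "T (\<rho> (\<rho> d))")
      case False
      then show ?thesis
        using bcls_link [OF band_links.leave [of "\<rho> (\<rho> d)" T F]] sm_X [OF dX] dX nT by simp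
    next
      case True
      have "?b (In1 (\<rho> (\<rho> d))) = ?b (In2 (\<rho> (\<rho> d)))"
        using bcls_link [OF band_links.bounce [of "\<rho> (\<rho> d)" T F]] True dX by simp
      also have "\<dots> = ?b (In2 (\<rho> d))" using bounce [of "\<rho> d"] good [OF dX] dX nT by simp
      also have "\<dots> = ?b (In1 d)" using side [OF dX] by simp
      also have "\<dots> = ?b (OutR (\<rho> d))" by (intro bcls_link band_links.leave dX nT)
      finally show ?thesis using sm_X [OF dX] True by simp
    qed
    finally show ?thesis .
  qed
  have In2_nxt: "?b (In2 d) = ?b (OutR (nxt d))" if d: "d \<in> X" "\<not> all d" for d
  proof -
    have *: "?b (In2 x) = ?b (OutR (sm x))" if "x \<in> X" "\<not> T x" for x
      using bcls_link [OF band_links.enter [of x T F]] that OutL_sm [of x] X_M by simp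
    show ?thesis
      using * [of d] * [of "\<rho> d"] * [of "\<rho> (\<rho> d)"] * [of "\<rho> (\<rho> (\<rho> d))"]
        bounce [of d] bounce [of "\<rho> d"] bounce [of "\<rho> (\<rho> d)"] d
      unfolding nxt_def all_def by (auto split: if_splits)
  qed
  have rep: "?b b = ?b (OutR d)" if "b \<in> band_darts" "g b = Inl d" for b d
    using that OutL_sm In2_nxt side all_rot
    by (cases b) (auto simp: g_def split: if_splits)
  have faces_conn: "?b (OutR x) = ?b (OutR y)" if "(x, y) \<in> conn M (gr M face)" for x y
    using that
  proof (rule conn_invariant [where f = "\<lambda>x. ?b (OutR x)"])
    fix u v assume "(u, v) \<in> gr M face" "u \<in> M"
    then have u: "u \<in> M" "v = sm (opp_on F u)" by (auto simp: face_def)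
    have "?b (OutL (opp_on F u)) = ?b (OutR u)"
      using bcls_link [OF band_links.strand [where d = "opp_on F u" and T = T and F = F]] u opp_on_involution [OF F] opp_on_in
      by simp
    then show "?b (OutR u) = ?b (OutR v)" using OutL_sm [OF opp_on_in [OF u(1)]] u by simp
  qed
  have inner: "?b b = ?b (In2 d)" if "b \<in> band_darts" "g b = Inr v" "d \<in> X" "base D d = v" "all d" for b d v
  proof -
    have "?b (In2 d') = ?b (In2 d)" if "d' \<in> X" "base D d' = v" for d'
    proof -
      have d': "d' \<in> {d, \<rho> d, \<rho> (\<rho> d), \<rho> (\<rho> (\<rho> d))}"
        using rot_four(2) [OF \<open>d \<in> X\<close>] that \<open>base D d = v\<close> by (auto simp: X_iff)
      have "?b (In2 d) = ?b (In2 (\<rho> d))" "?b (In2 (\<rho> d)) = ?b (In2 (\<rho> (\<rho> d)))"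
        "?b (In2 (\<rho> (\<rho> d))) = ?b (In2 (\<rho> (\<rho> (\<rho> d))))"
        using bounce \<open>all d\<close> \<open>d \<in> X\<close> by (simp_all add: all_def)
      then show ?thesis using d' by auto
    qed
    note * = this
    show ?thesis
    proof (cases b)
      case (In1 x)
      then have x: "x \<in> X" "base D x = v" using that by (auto simp: g_def split: if_splits)
      have "?b b = ?b (In2 (\<rho> x))" using side [OF x(1)] In1 by simp
      also have "\<dots> = ?b (In2 d)" by (rule *) (use x X_M in auto)
      finally show ?thesis .
    next
      case (In2 x)
      then have "x \<in> X" "base D x = v" using that(1,2) by (auto simp: g_def split: if_splits)
      from * [OF this] show ?thesis using In2 by simp
    qed (use that in \<open>auto simp: g_def\<close>)
  qed
  have "nc band_darts (band_links T F) = card (f ` band_darts)"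
  proof (rule nc_eq_card_image)
    fix b c assume bc: "b \<in> band_darts" "c \<in> band_darts"
    show "f b = f c \<longleftrightarrow> (b, c) \<in> conn band_darts (band_links T F)"
    proof
      assume eq: "f b = f c"
      have "?b b = ?b c"
      proof (cases "g b")
        case (Inl x)
        then obtain y where y: "g c = Inl y" "?fc x = ?fc y"
          using eq by (cases "g c") (auto simp: f_def)
        have "?b (OutR x) = ?b (OutR y)" using y(2) by (intro faces_conn) (simp add: cls_eq_iff)
        then show ?thesis using rep [OF bc(1) Inl] rep [OF bc(2) y(1)] by simp
      next
        case (Inr v)
        then have c: "g c = Inr v" using eq by (cases "g c") (auto simp: f_def)
        obtain d where d: "d \<in> X" "base D d = v" "all d"
          using Inr bc(1) by (cases b) (auto simp: g_def split: if_splits)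
        show ?thesis using inner [OF bc(1) Inr d] inner [OF bc(2) c d] by simp
      qed
      then show "(b, c) \<in> conn band_darts (band_links T F)" by (simp add: cls_eq_iff)
    next
      assume "(b, c) \<in> conn band_darts (band_links T F)"
      then show "f b = f c"
      proof (rule conn_invariant)
        fix u v assume "(u, v) \<in> band_links T F"
        then show "f u = f v"
        proof cases
          case (corner d)
          then have "sm d = \<rho> d" using sm_X [of d] sm_M [of d] by (cases "d \<in> X") auto
          then show ?thesis using corner by (simp add: f_def g_def)
        next
          case (enter d)
          then show ?thesis by (simp add: f_def g_def all_def nxt_def)
        next
          case (leave d)
          \<comment> \<open>Both neighbours of the open corner \<open>d\<close> are split, so the
            first open corner after it is the opposite one or \<open>d\<close> itself; either way
            the curve continues on \<open>OutR (\<rho> d)\<close>.\<close>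
          have "nxt (\<rho> d) = \<rho> d"
            using leave good [of d] good [of "\<rho> (\<rho> (\<rho> d))"] four sm_X [of "\<rho> (\<rho> d)"] sm_X [of d]
            by (auto simp: nxt_def)
          then show ?thesis using leave by (simp add: f_def g_def all_def)
        next
          case (bounce d)
          then show ?thesis using four [of d] by (auto simp: f_def g_def all_def nxt_def)
        next
          case (side d)
          then show ?thesis using all_rot X_M by (simp add: f_def g_def)
        next
          case (strand d)
          have "?fc (opp_on F d) = ?fc (sm d)"
            by (rule cls_link) (use strand opp_on_in sm_in opp_on_involution [OF F] in \<open>auto simp: face_def\<close>)
          then show ?thesis using strand by (simp add: f_def g_def)
        qed
      qed
    qed
  qed
  also have "f ` band_darts = Inl ` (?fc ` M) \<union> Inr ` inner_circles T"
  proof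
    show "f ` band_darts \<subseteq> Inl ` (?fc ` M) \<union> Inr ` inner_circles T"
    proof
      fix z assume "z \<in> f ` band_darts"
      then obtain b where b: "b \<in> band_darts" "z = f b" by blast
      show "z \<in> Inl ` (?fc ` M) \<union> Inr ` inner_circles T"
        using b sm_in nxt_in all_iff by (cases b) (auto simp: f_def g_def)
    qed
    show "Inl ` (?fc ` M) \<union> Inr ` inner_circles T \<subseteq> f ` band_darts"
    proof
      fix z assume "z \<in> Inl ` (?fc ` M) \<union> Inr ` inner_circles T"
      then consider d where "d \<in> M" "z = Inl (?fc d)" | v where "v \<in> inner_circles T" "z = Inr v" by blast
      then show "z \<in> f ` band_darts"
      proof cases
        case 1
        then have "z = f (OutR d)" by (simp add: f_def g_def)
        then show ?thesis using 1 by auto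
      next
        case 2
        then obtain d where d: "d \<in> M" "base D d = v" "v \<in> crossings D"
          using crossing_bases by (auto simp: inner_circles_def)
        then have "d \<in> X" by (simp add: X_iff)
        moreover from this have "all d" using all_iff 2 d by simp
        ultimately have "z = f (In1 d)" using 2 d by (simp add: f_def g_def)
        then show ?thesis using \<open>d \<in> X\<close> by auto
      qed
    qed
  qed
  also have "card \<dots> = card (?fc ` M) + card (inner_circles T)"
    by (subst card_Un_disjoint) (auto simp: card_image inner_circles_def)
  also have "card (?fc ` M) = faces s F"
    by (simp add: cyc_def nc_eq face_def sm_def)
  finally show ?thesis .
qed

end

section \<open>States of the boundary link\<close>

context link_diagram
begin

lemma inv_rot [simp]: "inv \<rho> (\<rho> d) = d" "\<rho> (inv \<rho> d) = d"
  using permutes_inverses [OF rot_permutes] by auto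

lemma inv_rot_in [simp]: "inv \<rho> d \<in> M \<longleftrightarrow> d \<in> M" "inv \<rho> d \<in> X \<longleftrightarrow> d \<in> X"
  using rot_in [of "inv \<rho> d"] rot_X [of "inv \<rho> d"] by simp_all

text \<open>The outer strands at a corner are \<open>OutL d\<close> and its counterclockwise
  successor \<open>OutR (\<rho> d)\<close>. If \<open>d\<close> is over, the B-smoothing joins
  \<open>OutL d\<close> to its successor; if \<open>d\<close> is under,
  \<open>OutR (\<rho> d)\<close> is over and the A-smoothing joins it to its predecessor.\<close>

definition corner_split :: "('d \<Rightarrow> marker) \<Rightarrow> 'd \<Rightarrow> bool" where
  "corner_split \<tau> d \<longleftrightarrow> (\<tau> d = Neg \<longleftrightarrow> d \<in> over D)"

lemma link_fields:
  "vertices (boundary_link D F) = M - X" "crossings (boundary_link D F) = X"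
  "darts (boundary_link D F) = band_darts"
  "circles (boundary_link D F) = Disk ` isolated \<union> Rim1 ` circles D \<union> Rim2 ` (circles D - \<Union>F)"
  "base (boundary_link D F) = bd_corner D" "opp (boundary_link D F) = bd_opp D F"
  "rot (boundary_link D F) b = (if b \<in> band_darts then bd_rot D b else b)"
  "over (boundary_link D F) = {b \<in> band_darts. bd_over D b}"
  by (simp_all add: boundary_link_def Let_def band_darts_def)

lemma band_dart_cases:
  assumes "b \<in> band_darts"
  obtains d where "d \<in> M" "b = OutL d" | d where "d \<in> M" "b = OutR (\<rho> d)"
    | d where "d \<in> X" "b = In1 d" | d where "d \<in> X" "b = In2 d"
proof (cases b)
  case (OutR d)
  then have "d \<in> M" using assms by simp
  then show ?thesis using that(2) [of "inv \<rho> d"] OutR by simp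
qed (use assms that in auto)

lemma link_partner:
  assumes d: "d \<in> X" and \<tau>: "\<tau> d \<in> {Pos, Neg}"
  shows "partner (boundary_link D F) \<tau> (OutL d) = (if corner_split \<tau> d then OutR (\<rho> d) else In2 d)"
    "partner (boundary_link D F) \<tau> (OutR (\<rho> d)) = (if corner_split \<tau> d then OutL d else In1 d)"
    "partner (boundary_link D F) \<tau> (In1 d) = (if corner_split \<tau> d then In2 d else OutR (\<rho> d))"
    "partner (boundary_link D F) \<tau> (In2 d) = (if corner_split \<tau> d then In1 d else OutL d)"
  using d \<tau> by (auto simp: partner_def link_fields corner_split_def X_M)

lemma link_resolution:
  assumes F: "F \<subseteq> strands D" and \<tau>: "\<And>d. d \<in> X \<Longrightarrow> \<tau> d \<in> {Pos, Neg}"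
  shows "resolution (boundary_link D F) (M - X) (partner (boundary_link D F) \<tau>)"
proof
  fix b assume b: "b \<in> darts (boundary_link D F)"
  then have b: "b \<in> band_darts" by (simp add: link_fields)
  have oX: "opp D d \<in> \<Union>F \<longleftrightarrow> d \<in> \<Union>F" if "d \<in> M" for d using strand_mem_opp [OF F that] .
  show "opp (boundary_link D F) b \<in> darts (boundary_link D F)" "opp (boundary_link D F) b \<noteq> b"
    "opp (boundary_link D F) (opp (boundary_link D F) b) = b"
    using b oX by (cases b; simp add: link_fields del: Union_iff)+
  show "rot (boundary_link D F) b \<in> darts (boundary_link D F)"
    "base (boundary_link D F) (rot (boundary_link D F) b) = base (boundary_link D F) b"
    using b X_M by (auto simp: link_fields crossing_darts_def elim!: band_dart_cases)
  assume "base (boundary_link D F) b \<notin> M - X"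
  then have k: "bd_corner D b \<in> X" using b by (auto simp: link_fields elim!: band_dart_cases)
  note p = link_partner [OF _ \<tau>]
  show "partner (boundary_link D F) \<tau> b \<in> darts (boundary_link D F)"
    "base (boundary_link D F) (partner (boundary_link D F) \<tau> b) = base (boundary_link D F) b"
    "partner (boundary_link D F) \<tau> (partner (boundary_link D F) \<tau> b) = b"
    "partner (boundary_link D F) \<tau> b \<noteq> b"
    using b k X_M by (auto simp: link_fields p elim!: band_dart_cases split: if_splits)
next
  fix b b' assume b: "b \<in> darts (boundary_link D F)" "b' \<in> darts (boundary_link D F)"
    "base (boundary_link D F) b = base (boundary_link D F) b'" "base (boundary_link D F) b \<in> M - X"
  let ?L = "boundary_link D F"
  define d where "d = bd_corner D b"
  have d: "d \<in> M" "d \<notin> X" using b by (auto simp: link_fields d_def)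
  have "c \<in> {OutL d, OutR (\<rho> d)}" if "c \<in> band_darts" "bd_corner D c = d" for c
    using that d by (auto elim!: band_dart_cases)
  then have bb: "b \<in> {OutL d, OutR (\<rho> d)}" "b' \<in> {OutL d, OutR (\<rho> d)}"
    using b by (auto simp: link_fields d_def)
  have r: "rot ?L (OutL d) = OutR (\<rho> d)" "rot ?L (OutR (\<rho> d)) = OutL d"
    using d by (auto simp: link_fields)
  have "(rot ?L ^^ 0) b = b' \<or> (rot ?L ^^ 1) b = b'" using bb r by auto
  then show "\<exists>n. (rot ?L ^^ n) b = b'" by blast
next
  show "finite (darts (boundary_link D F))" "finite (circles (boundary_link D F))" "finite (M - X)"
    by (simp_all add: link_fields finite_band_darts)
  show "darts (boundary_link D F) \<inter> circles (boundary_link D F) = {}"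
    by (auto simp: link_fields)
qed

text \<open>The curves through band darts are the classes of \<open>band_links\<close>, and every
  marked point \<open>d\<close> lies on the dart \<open>OutL d\<close>, so no node is isolated. The
  other curves are one per isolated vertex and two per annulus, of which a cut annulus loses
  \<open>Rim2\<close>.\<close>

lemma link_components:
  assumes F: "F \<subseteq> strands D" and \<tau>: "\<And>d. d \<in> X \<Longrightarrow> \<tau> d \<in> {Pos, Neg}"
  shows "num_components (state_graph (boundary_link D F) \<tau>) =
    nc band_darts (band_links (corner_split \<tau>) F) + card isolated + card (circles D) + card (circles D - \<Union>F)"
proof -
  let ?L = "boundary_link D F" and ?T = "corner_split \<tau>"
  interpret r: resolution ?L "M - X" "partner ?L \<tau>" by (rule link_resolution [OF assms])
  have nz: "{x \<in> X. \<tau> x = Zero} = {}" using \<tau> by force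
  have sg: "state_graph ?L \<tau> = resolve ?L (M - X) (partner ?L \<tau>)"
    unfolding state_graph_def link_fields(1,2) nz by simp
  have "bd_corner D (OutL d) \<in> bd_corner D ` band_darts" if "d \<in> M" for d
    by (rule imageI) (use that in simp)
  then have iso: "M - X - base ?L ` darts ?L = {}" by (auto simp: link_fields)
  note p = link_partner [OF _ \<tau>]
  have tX: "r.turn (OutL d) = (if ?T d then OutR (\<rho> d) else In2 d)"
      "r.turn (OutR (\<rho> d)) = (if ?T d then OutL d else In1 d)"
      "r.turn (In1 d) = (if ?T d then In2 d else OutR (\<rho> d))"
      "r.turn (In2 d) = (if ?T d then In1 d else OutL d)" if "d \<in> X" for d
    using that by (simp_all add: r.turn_def link_fields p)
  have tM: "r.turn (OutL d) = OutR (\<rho> d)" "r.turn (OutR (\<rho> d)) = OutL d" if "d \<in> M" "d \<notin> X" for d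
    using that by (simp_all add: r.turn_def link_fields)
  have "conn band_darts (r.links {}) = conn band_darts (band_links ?T F)"
  proof (rule conn_eqI)
    fix u v assume uv: "(u, v) \<in> r.links {}"
    let ?b = "bcls ?T F"
    have ub: "u \<in> band_darts" using uv by (auto simp: r.links_def link_fields)
    consider "v = bd_opp D F u" | "v = r.turn u" using uv by (auto simp: r.links_def link_fields)
    then have "?b u = ?b v"
    proof cases
      case 1
      show ?thesis
      proof (cases u)
        case (OutL d)
        then show ?thesis
          using 1 ub bcls_link [OF band_links.strand [where d = d and T = ?T and F = F]] by (auto simp: opp_on_def)
      next
        case (OutR d)
        then have "d \<in> M" using ub by simp
        then show ?thesis
          using 1 OutR opp_on_involution [OF F, of d] opp_on_in [of d F]
            bcls_link [OF band_links.strand [where d = "opp_on F d" and T = ?T and F = F]]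
          by (auto simp: opp_on_def split: if_splits)
      next
        case (In1 d)
        then show ?thesis using 1 ub bcls_link [OF band_links.side [where d = d and T = ?T and F = F]] by simp
      next
        case (In2 d)
        then show ?thesis using 1 ub bcls_link [OF band_links.side [where d = "inv \<rho> d" and T = ?T and F = F]] by simp
      qed (use ub in auto)
    next
      case 2
      show ?thesis
      proof -
        note l = bcls_link [OF band_links.corner [where T = ?T and F = F]]
          bcls_link [OF band_links.enter [where T = ?T and F = F]]
          bcls_link [OF band_links.leave [where T = ?T and F = F]]
          bcls_link [OF band_links.bounce [where T = ?T and F = F]]
        show ?thesis
          using ub
        proof (cases rule: band_dart_cases)
          case (1 d)
          then show ?thesis using 2 tX(1) [of d] tM(1) [of d] l(1,2) [of d] by (cases "d \<in> X") auto
        next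
          case (2 d)
          then show ?thesis using \<open>v = r.turn u\<close> tX(2) [of d] tM(2) [of d] l(1,3) [of d] by (cases "d \<in> X") auto
        next
          case (3 d)
          then show ?thesis using 2 tX(3) [of d] l(3,4) [of d] by auto
        next
          case (4 d)
          then show ?thesis using 2 tX(4) [of d] l(2,4) [of d] by auto
        qed
      qed
    qed
    then show "(u, v) \<in> conn band_darts (band_links ?T F)" by (simp add: cls_eq_iff)
  next
    fix u v assume uv: "(u, v) \<in> band_links ?T F" "u \<in> band_darts" "v \<in> band_darts"
    have "v = bd_opp D F u \<or> v = r.turn u"
      using uv(1)
    proof cases
      case (corner d)
      then show ?thesis using tX(1) [of d] tM(1) [of d] by (cases "d \<in> X") auto
    qed (auto simp: tX opp_on_def)
    then have "(u, v) \<in> r.links {}" using uv(2) by (auto simp: r.links_def link_fields)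
    then show "(u, v) \<in> conn band_darts (r.links {})" using uv by (intro conn_link)
  qed
  then have nb: "nc band_darts (r.links {}) = nc band_darts (band_links ?T F)" by (rule nc_cong_conn)
  have "card (circles ?L) = card (Disk ` isolated \<union> Rim1 ` circles D :: ('v, 'd) bdart set)
      + card (Rim2 ` (circles D - \<Union>F) :: ('v, 'd) bdart set)"
    unfolding link_fields by (rule card_Un_disjoint) auto
  also have "card (Disk ` isolated \<union> Rim1 ` circles D :: ('v, 'd) bdart set) =
      card (Disk ` isolated :: ('v, 'd) bdart set) + card (Rim1 ` circles D :: ('v, 'd) bdart set)"
    by (rule card_Un_disjoint) auto
  finally have cc: "card (circles ?L) = card isolated + card (circles D) + card (circles D - \<Union>F)"
    by (simp add: card_image inj_on_def)
  have "nc r.arcs (r.links {}) = nc band_darts (r.links {}) + card (circles ?L)"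
    unfolding r.arcs_def link_fields(3)
  proof (rule nc_add_isolated)
    fix u v assume "(u, v) \<in> r.links {}"
    then show "u \<in> band_darts \<and> v \<in> band_darts"
      using r.opp(1) r.turn_in by (auto simp: r.links_def link_fields(3))
  qed (use r.fin r.disj in \<open>auto simp: link_fields(3)\<close>)
  then show ?thesis
    unfolding sg r.components_resolve iso using nb cc by simp
qed

end


section \<open>Expansion of the band crossings\<close>

text \<open>As \<open>G\<close> depends only on the types, the sum over all choices of given types
  factorizes over the points of \<open>C\<close>.\<close>

lemma sum_PiE_by_type:
  fixes V :: "'p \<Rightarrow> 'k::field" and t :: "'p \<Rightarrow> 'm"
  assumes C: "finite C" and fin: "finite Good" "finite (UNIV :: 'm set)"
  shows "(\<Sum>q\<in>C \<rightarrow>\<^sub>E Good. (\<Prod>x\<in>C. V (q x)) * G (restrict (t \<circ> q) C)) =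
    (\<Sum>s\<in>C \<rightarrow>\<^sub>E UNIV. (\<Prod>x\<in>C. \<Sum>p\<in>{p \<in> Good. t p = s x}. V p) * G s)"
proof -
  let ?f = "\<lambda>q. (\<Prod>x\<in>C. V (q x)) * G (restrict (t \<circ> q) C)"
  have "(\<Sum>q\<in>C \<rightarrow>\<^sub>E Good. ?f q) =
      (\<Sum>s\<in>C \<rightarrow>\<^sub>E UNIV. \<Sum>q\<in>{q \<in> C \<rightarrow>\<^sub>E Good. restrict (t \<circ> q) C = s}. ?f q)"
    by (rule sum.group [symmetric]) (use assms in \<open>auto intro!: finite_PiE\<close>)
  also have "\<dots> = (\<Sum>s\<in>C \<rightarrow>\<^sub>E UNIV. (\<Prod>x\<in>C. \<Sum>p\<in>{p \<in> Good. t p = s x}. V p) * G s)"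
  proof (rule sum.cong [OF refl])
    fix s :: "'a \<Rightarrow> 'm" assume s: "s \<in> C \<rightarrow>\<^sub>E UNIV"
    have eq: "{q \<in> C \<rightarrow>\<^sub>E Good. restrict (t \<circ> q) C = s} = PiE C (\<lambda>x. {p \<in> Good. t p = s x})"
    proof (rule set_eqI)
      fix q
      show "q \<in> {q \<in> C \<rightarrow>\<^sub>E Good. restrict (t \<circ> q) C = s} \<longleftrightarrow> q \<in> PiE C (\<lambda>x. {p \<in> Good. t p = s x})"
        using s by (auto simp: PiE_iff fun_eq_iff extensional_def restrict_def)
    qed
    have "(\<Sum>q\<in>{q \<in> C \<rightarrow>\<^sub>E Good. restrict (t \<circ> q) C = s}. ?f q) =
        (\<Sum>q\<in>PiE C (\<lambda>x. {p \<in> Good. t p = s x}). (\<Prod>x\<in>C. V (q x)) * G s)"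
      using eq by (intro sum.cong) auto
    also have "\<dots> = (\<Sum>q\<in>PiE C (\<lambda>x. {p \<in> Good. t p = s x}). \<Prod>x\<in>C. V (q x)) * G s"
      by (rule sum_distrib_right [symmetric])
    also have "(\<Sum>q\<in>PiE C (\<lambda>x. {p \<in> Good. t p = s x}). \<Prod>x\<in>C. V (q x)) =
        (\<Prod>x\<in>C. \<Sum>p\<in>{p \<in> Good. t p = s x}. V p)"
      by (rule prod_sum_PiE [symmetric]) (use C fin in auto)
    finally show "(\<Sum>q\<in>{q \<in> C \<rightarrow>\<^sub>E Good. restrict (t \<circ> q) C = s}. ?f q) =
        (\<Prod>x\<in>C. \<Sum>p\<in>{p \<in> Good. t p = s x}. V p) * G s" .
  qed
  finally show ?thesis .
qed

text \<open>One entry per corner of a crossing, counterclockwise from the corner of an over dart: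
  whether it is split.\<close>

type_synonym corners = "bool \<times> bool \<times> bool \<times> bool"

text \<open>If two adjacent corners are both open, the strip between them turns back.\<close>

fun no_turnback :: "corners \<Rightarrow> bool" where
  "no_turnback (b0, b1, b2, b3) \<longleftrightarrow> (b0 \<or> b1) \<and> (b1 \<or> b2) \<and> (b2 \<or> b3) \<and> (b3 \<or> b0)"

fun corner_marker :: "corners \<Rightarrow> marker" where
  "corner_marker (b0, b1, b2, b3) = (if \<not> b0 \<and> \<not> b2 then Pos else if \<not> b1 \<and> \<not> b3 then Neg else Zero)"

text \<open>A corner at an over dart is split by the B-smoothing, one at an under dart by the
  A-smoothing; hence the alternation.\<close>

fun corner_weight :: "'k::field \<Rightarrow> corners \<Rightarrow> 'k" where
  "corner_weight a (b0, b1, b2, b3) =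
     (if b0 then inverse a else a) * (if b1 then a else inverse a) *
     (if b2 then inverse a else a) * (if b3 then a else inverse a)"

lemma finite_corners [simp]: "finite (A :: corners set)"
  by (rule finite_subset [OF subset_UNIV]) simp

lemma UNIV_marker: "UNIV = {Pos, Neg, Zero}"
  using marker.exhaust by auto

text \<open>The expansion of a crossing of two bands whose ends do not turn back.\<close>

lemma crossing_expansion:
  fixes a :: "'k::field"
  assumes "a \<noteq> 0"
  shows "(\<Sum>p\<in>{p \<in> Collect no_turnback. corner_marker p = m}.
      corner_weight a p * (if p = (True, True, True, True) then - phi a else 1)) =
    (case m of Pos \<Rightarrow> a ^ 4 | Neg \<Rightarrow> inverse (a ^ 4) | Zero \<Rightarrow> phi a)"
proof -
  have phi: "phi a = a * a + inverse a * inverse a"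
    by (simp add: phi_def power_int_minus power2_eq_square)
  have sets: "{p \<in> Collect no_turnback. corner_marker p = Pos} = {(False, True, False, True)}"
    "{p \<in> Collect no_turnback. corner_marker p = Neg} = {(True, False, True, False)}"
    "{p \<in> Collect no_turnback. corner_marker p = Zero} = {(True, True, True, True),
       (False, True, True, True), (True, False, True, True), (True, True, False, True), (True, True, True, False)}"
    by (auto split: if_splits)
  show ?thesis
  proof (cases m)
    case Pos
    then show ?thesis unfolding Pos sets by (simp add: power4_eq_xxxx)
  next
    case Neg
    then show ?thesis unfolding Neg sets by (simp add: power4_eq_xxxx mult.assoc)
  next
    \<comment> \<open>All corners split: weight 1 and an inner circle, in total -phi. Exactly one
      open corner: a^2 twice and a^-2 twice, in total 2 phi.\<close>
    case Zero
    then show ?thesis unfolding Zero sets phi using assms by (simp add: mult.assoc)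
  qed
qed

section \<open>Corner smoothings collected crossing by crossing\<close>

context link_diagram
begin

definition over_dart :: "'v \<Rightarrow> 'd" where
  "over_dart x = (SOME d. d \<in> X \<and> base D d = x \<and> d \<in> over D)"

lemma over_dart:
  assumes "x \<in> crossings D"
  shows "over_dart x \<in> X" "base D (over_dart x) = x" "over_dart x \<in> over D"
proof -
  obtain d where d: "d \<in> M" "base D d = x" using crossing_bases assms by auto
  then have "d \<in> X" using assms by (simp add: X_iff)
  then have "(\<exists>d. d \<in> X \<and> base D d = x \<and> d \<in> over D)"
    using d over_rot [of d] rot_X [of d] base_rot [of d] by (cases "d \<in> over D") metis+
  from someI_ex [OF this] show "over_dart x \<in> X" "base D (over_dart x) = x" "over_dart x \<in> over D"
    by (auto simp: over_dart_def)
qed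

lemma crossing_block:
  assumes "x \<in> crossings D"
  shows "{d \<in> X. base D d = x} = {over_dart x, \<rho> (over_dart x), \<rho> (\<rho> (over_dart x)), \<rho> (\<rho> (\<rho> (over_dart x)))}"
  using rot_four(2) [OF over_dart(1) [OF assms]] over_dart [OF assms] assms by (auto simp: X_iff)

definition corners_at :: "('d \<Rightarrow> bool) \<Rightarrow> 'v \<Rightarrow> corners" where
  "corners_at T x = (let d = over_dart x in (T d, T (\<rho> d), T (\<rho> (\<rho> d)), T (\<rho> (\<rho> (\<rho> d)))))"

lemma prod_crossing_darts:
  "(\<Prod>d\<in>X. f d) = (\<Prod>x\<in>crossings D. let d = over_dart x in
     f d * f (\<rho> d) * f (\<rho> (\<rho> d)) * (f (\<rho> (\<rho> (\<rho> d))) :: 'k::comm_monoid_mult))"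
proof -
  have "(\<Prod>d\<in>X. f d) = (\<Prod>x\<in>crossings D. \<Prod>d\<in>{d \<in> X. base D d = x}. f d)"
    by (rule prod.group [symmetric]) (auto simp: finite_X X_iff)
  also have "\<dots> = (\<Prod>x\<in>crossings D. let d = over_dart x in
     f d * f (\<rho> d) * f (\<rho> (\<rho> d)) * f (\<rho> (\<rho> (\<rho> d))))"
  proof (rule prod.cong [OF refl])
    fix x assume x: "x \<in> crossings D"
    show "(\<Prod>d\<in>{d \<in> X. base D d = x}. f d) = (let d = over_dart x in
     f d * f (\<rho> d) * f (\<rho> (\<rho> d)) * f (\<rho> (\<rho> (\<rho> d))))"
      unfolding crossing_block [OF x]
      using rot_four(3) [OF over_dart(1) [OF x]] by (simp add: Let_def mult.assoc)
  qed
  finally show ?thesis .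
qed

lemma ball_crossing_darts:
  "(\<forall>d\<in>X. P d) \<longleftrightarrow> (\<forall>x\<in>crossings D. let d = over_dart x in
     P d \<and> P (\<rho> d) \<and> P (\<rho> (\<rho> d)) \<and> P (\<rho> (\<rho> (\<rho> d))))"
proof -
  have "(\<forall>d\<in>X. P d) \<longleftrightarrow> (\<forall>x\<in>crossings D. \<forall>d\<in>{d \<in> X. base D d = x}. P d)"
    by (auto simp: X_iff)
  also have "\<dots> \<longleftrightarrow> (\<forall>x\<in>crossings D. let d = over_dart x in
     P d \<and> P (\<rho> d) \<and> P (\<rho> (\<rho> d)) \<and> P (\<rho> (\<rho> (\<rho> d))))"
    by (rule ball_cong [OF refl]) (simp add: crossing_block Let_def)
  finally show ?thesis .
qed

lemma no_turnback_iff: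
  "(\<forall>x\<in>crossings D. no_turnback (corners_at T x)) \<longleftrightarrow> (\<forall>d\<in>X. T d \<or> T (\<rho> d))"
  unfolding ball_crossing_darts [of "\<lambda>d. T d \<or> T (\<rho> d)"]
  using rot_four(1) over_dart(1) by (intro ball_cong) (auto simp: corners_at_def Let_def)

text \<open>This supplies the assumption \<open>s\<close> of \<open>nc_band_links\<close>.
  \<open>corners_at\<close> starts from a chosen over dart, whereas \<open>d\<close> is arbitrary at
  the crossing, so its four positions are checked.\<close>

lemma corner_marker_state:
  assumes d: "d \<in> X" and nt: "no_turnback (corners_at T (base D d))"
  shows "corner_marker (corners_at T (base D d)) \<noteq> Zero \<and>
      (d \<in> over D \<longleftrightarrow> corner_marker (corners_at T (base D d)) = Pos) \<longleftrightarrow> \<not> T d \<and> \<not> T (\<rho> (\<rho> d))"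
proof -
  define e where "e = over_dart (base D d)"
  have x: "base D d \<in> crossings D" using d by (simp add: X_iff)
  have e: "e \<in> X" "e \<in> over D" using over_dart [OF x] by (simp_all add: e_def)
  have four: "\<rho> (\<rho> (\<rho> (\<rho> e))) = e" using rot_four(1) [OF e(1)] .
  have c: "corners_at T (base D d) = (T e, T (\<rho> e), T (\<rho> (\<rho> e)), T (\<rho> (\<rho> (\<rho> e))))"
    by (simp add: corners_at_def Let_def e_def)
  have "d \<in> {e, \<rho> e, \<rho> (\<rho> e), \<rho> (\<rho> (\<rho> e))}"
    using crossing_block [OF x] d unfolding e_def by blast
  then consider "d = e" | "d = \<rho> e" | "d = \<rho> (\<rho> e)" | "d = \<rho> (\<rho> (\<rho> e))" by blast
  then show ?thesis
    using nt unfolding c by cases (use e four in auto)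
qed

lemma inner_circles_corners:
  "inner_circles T = {x \<in> crossings D. corners_at T x = (True, True, True, True)}"
proof -
  have "(\<forall>d\<in>X. base D d = x \<longrightarrow> T d) \<longleftrightarrow> corners_at T x = (True, True, True, True)"
    if x: "x \<in> crossings D" for x
  proof -
    have "(\<forall>d\<in>X. base D d = x \<longrightarrow> T d) \<longleftrightarrow> (\<forall>d\<in>{d \<in> X. base D d = x}. T d)" by auto
    then show ?thesis unfolding crossing_block [OF x] by (simp add: corners_at_def Let_def)
  qed
  then show ?thesis by (auto simp: inner_circles_def)
qed

lemma prod_if_card:
  assumes "finite A"
  shows "(\<Prod>x\<in>A. if P x then c else 1) = (c :: 'k::comm_monoid_mult) ^ card {x \<in> A. P x}"
  using assms by (simp add: prod.If_cases Int_def)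

text \<open>The marker at a corner is determined by whether the corner is split, which gives
  injectivity; surjectivity follows by counting, as 2^(4c) = 16^c for c crossings.\<close>

lemma corners_bij:
  "bij_betw (\<lambda>\<tau>. restrict (corners_at (corner_split \<tau>)) (crossings D)) (X \<rightarrow>\<^sub>E {Pos, Neg})
     (crossings D \<rightarrow>\<^sub>E UNIV)"
proof -
  let ?f = "\<lambda>\<tau>. restrict (corners_at (corner_split \<tau>)) (crossings D)"
  have inj: "inj_on ?f (X \<rightarrow>\<^sub>E {Pos, Neg})"
  proof (rule inj_onI)
    fix \<sigma> \<tau> assume st: "\<sigma> \<in> X \<rightarrow>\<^sub>E {Pos, Neg}" "\<tau> \<in> X \<rightarrow>\<^sub>E {Pos, Neg}" and eq: "?f \<sigma> = ?f \<tau>"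
    have "corners_at (corner_split \<sigma>) x = corners_at (corner_split \<tau>) x" if "x \<in> crossings D" for x
      using fun_cong [OF eq, of x] that by simp
    then have "\<forall>d\<in>X. corner_split \<sigma> d = corner_split \<tau> d"
      unfolding ball_crossing_darts by (auto simp: corners_at_def Let_def)
    then have "\<sigma> d = \<tau> d" if "d \<in> X" for d
      using that st PiE_mem [OF st(1) that] PiE_mem [OF st(2) that] by (auto simp: corner_split_def)
    then show "\<sigma> = \<tau>" using st by (intro PiE_ext)
  qed
  have cX: "card X = 4 * card (crossings D)"
  proof -
    have "X = (\<Union>x\<in>crossings D. {d \<in> M. base D d = x})" by (auto simp: X_iff)
    also have "card \<dots> = (\<Sum>x\<in>crossings D. card {d \<in> M. base D d = x})"
      by (rule card_UN_disjoint) auto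
    finally show ?thesis by (simp add: valence)
  qed
  have "card (UNIV :: corners set) = 16"
    by (simp add: UNIV_Times_UNIV [symmetric] card_cartesian_product del: UNIV_Times_UNIV)
  then have "card (crossings D \<rightarrow>\<^sub>E (UNIV :: corners set)) = 16 ^ card (crossings D)"
    by (simp add: card_PiE)
  also have "\<dots> = card (X \<rightarrow>\<^sub>E {Pos, Neg})"
  proof -
    have "card {Pos, Neg} = 2" by simp
    then have "card (X \<rightarrow>\<^sub>E {Pos, Neg}) = (2 ^ 4) ^ card (crossings D)"
      by (simp only: card_PiE [OF finite_X] prod_constant cX power_mult)
    then show ?thesis by simp
  qed
  also have "card (X \<rightarrow>\<^sub>E {Pos, Neg}) = card (?f ` (X \<rightarrow>\<^sub>E {Pos, Neg}))" by (rule card_image [OF inj, symmetric])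
  finally have "?f ` (X \<rightarrow>\<^sub>E {Pos, Neg}) = crossings D \<rightarrow>\<^sub>E UNIV"
    by (intro card_subset_eq) (auto intro!: finite_PiE)
  then show ?thesis using inj by (simp add: bij_betw_def)
qed

lemma state_weight_corners:
  fixes a :: "'k::field"
  assumes a: "a \<noteq> 0" and \<tau>: "\<tau> \<in> X \<rightarrow>\<^sub>E {Pos, Neg}"
  shows "a powi state_weight (boundary_link D F) \<tau> =
    (\<Prod>x\<in>crossings D. corner_weight a (corners_at (corner_split \<tau>) x))"
proof -
  have "a powi state_weight (boundary_link D F) \<tau> =
      a ^ card {d \<in> X. \<tau> d = Pos} * inverse a ^ card {d \<in> X. \<tau> d = Neg}"
    using a by (simp add: state_weight_def link_fields power_int_diff power_inverse divide_inverse)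
  also have "\<dots> = (\<Prod>d\<in>X. (if \<tau> d = Pos then a else 1) * (if \<tau> d = Neg then inverse a else 1))"
    by (simp add: prod.distrib prod_if_card finite_X)
  also have "\<dots> = (\<Prod>d\<in>X. if \<tau> d = Neg then inverse a else a)"
    using \<tau> by (intro prod.cong) (auto dest: PiE_mem)
  also have "\<dots> = (\<Prod>x\<in>crossings D. corner_weight a (corners_at (corner_split \<tau>) x))"
    unfolding prod_crossing_darts
    using over_dart by (intro prod.cong) (auto simp: Let_def corners_at_def corner_split_def)
  finally show ?thesis .
qed

end


section \<open>The two state sums agree\<close>

context link_diagram
begin

text \<open>Toggling the cut of the strip that turns back adds a curve, with factor -p, and a cut,
  with factor 1/p. The product is -1, so the terms cancel in pairs.\<close>

lemma band_sum_turnback: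
  fixes p :: "'k::field"
  assumes p: "p \<noteq> 0" and \<tau>: "\<And>d. d \<in> X \<Longrightarrow> \<tau> d \<in> {Pos, Neg}"
    and d: "d \<in> X" "\<not> corner_split \<tau> d" "\<not> corner_split \<tau> (\<rho> d)"
  shows "(\<Sum>F\<in>Pow (strands D). (1 / p) ^ card F *
    (- p) powi (int (num_components (state_graph (boundary_link D F) \<tau>)) - 1)) = 0"
proof (rule sum_Pow_cancel [OF finite_strands])
  let ?e = "{\<rho> d, opp D (\<rho> d)}"
  have dM: "\<rho> d \<in> M" "opp D (\<rho> d) \<in> M" using d X_M by auto
  show e: "?e \<in> strands D" using dM by (auto simp: strands_eq dart_strands_def)
  fix F assume "F \<subseteq> strands D - {?e}"
  then have F: "F \<subseteq> strands D" "?e \<notin> F" "insert ?e F \<subseteq> strands D" using e by auto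
  have c: "circles D - \<Union>(insert ?e F) = circles D - \<Union>F" using dM disjoints(2) by blast
  have "num_components (state_graph (boundary_link D (insert ?e F)) \<tau>) =
      Suc (num_components (state_graph (boundary_link D F) \<tau>))"
    using link_components [of "insert ?e F" \<tau>] link_components [of F \<tau>] c F \<tau>
      nc_band_turnback [OF d F(1) refl F(2)] by simp
  then have n: "int (num_components (state_graph (boundary_link D (insert ?e F)) \<tau>)) - 1 =
      (int (num_components (state_graph (boundary_link D F) \<tau>)) - 1) + 1" by simp
  have cF: "card (insert ?e F) = Suc (card F)"
    using F finite_subset [OF F(1) finite_strands] by simp
  show "(1 / p) ^ card F * (- p) powi (int (num_components (state_graph (boundary_link D F) \<tau>)) - 1) +
      (1 / p) ^ card (insert ?e F) *
      (- p) powi (int (num_components (state_graph (boundary_link D (insert ?e F)) \<tau>)) - 1) = 0"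
    unfolding n cF using p by (subst power_int_add) auto
qed

abbreviation euler :: int where
  "euler \<equiv> int (card dart_strands) - int (card (vertices D)) - 2 * int (card (crossings D))"

text \<open>Once \<open>h_poly\<close> is written as a sum over sets of strands, the identity holds
  for each such set separately, by comparing powers of \<open>p\<close>.\<close>

lemma band_sum_state:
  fixes p :: "'k::field"
  assumes p: "p \<noteq> 0" and \<tau>: "\<And>d. d \<in> X \<Longrightarrow> \<tau> d \<in> {Pos, Neg}"
    and good: "\<forall>x\<in>crossings D. no_turnback (corners_at (corner_split \<tau>) x)"
    and s: "\<And>x. x \<in> crossings D \<Longrightarrow> s x = corner_marker (corners_at (corner_split \<tau>) x)"
  shows "- (p powi (euler + 1)) * (\<Sum>F\<in>Pow (strands D). (1 / p) ^ card F *
      (- p) powi (int (num_components (state_graph (boundary_link D F) \<tau>)) - 1)) =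
    (- p) ^ card (inner_circles (corner_split \<tau>)) *
      (p powi (- int (card {x \<in> crossings D. s x = Zero})) * h_poly (state_graph D s) (- 1) (- (p ^ 2)))"
  unfolding h_poly_state_graph sum_distrib_left
proof (rule sum.cong [OF refl])
  fix F assume "F \<in> Pow (strands D)"
  then have F: "F \<subseteq> strands D" by simp
  let ?z = "card (inner_circles (corner_split \<tau>))" and ?c = "curves s F" and ?m = "comps s F"
  let ?Z = "card {x \<in> crossings D. s x = Zero}"
  have good': "corner_split \<tau> d \<or> corner_split \<tau> (\<rho> d)" if "d \<in> X" for d
    using good that unfolding no_turnback_iff by blast
  have st: "s (base D d) \<noteq> Zero \<and> (d \<in> over D \<longleftrightarrow> s (base D d) = Pos) \<longleftrightarrow>
      \<not> corner_split \<tau> d \<and> \<not> corner_split \<tau> (\<rho> (\<rho> d))" if "d \<in> X" for d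
  proof -
    have x: "base D d \<in> crossings D" using that by (simp add: X_iff)
    show ?thesis unfolding s [OF x] by (rule corner_marker_state [OF that]) (use good x in blast)
  qed
  have "num_components (state_graph (boundary_link D F) \<tau>) = ?c + ?z"
    using link_components [of F \<tau>] F \<tau> nc_band_links [of F "corner_split \<tau>" s, OF F good' st]
    by (simp add: curves_def)
  then have n: "int (num_components (state_graph (boundary_link D F) \<tau>)) - 1 = int ?c + int ?z + (- 1)"
    by simp
  have np: "- p \<noteq> 0" using p by simp
  have "(1 / p) ^ card F = p powi (- int (card F))"
    by (simp add: power_int_minus power_one_over inverse_eq_divide)
  moreover have "(- p) powi (int ?c + int ?z + (- 1)) = (- p) ^ ?z * ((- 1) ^ ?c * p ^ ?c * inverse (- p))"
  proof -
    have "(- p) powi (int ?c + int ?z + (- 1)) = (- p) powi int ?c * (- p) powi int ?z * (- p) powi (- 1)"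
      by (simp only: power_int_add [OF disjI1 [OF np]])
    then show ?thesis by (simp add: power_int_minus power_minus [of p ?c])
  qed
  ultimately have L: "- (p powi (euler + 1)) * ((1 / p) ^ card F *
      (- p) powi (int (num_components (state_graph (boundary_link D F) \<tau>)) - 1)) =
      (- p) ^ ?z * (- 1) ^ ?c * (p powi (euler + 1) * p powi (- int (card F)) * p powi (int ?c) * p powi (- 1))"
    unfolding n by (simp add: power_int_minus algebra_simps)
  also have "p powi (euler + 1) * p powi (- int (card F)) * p powi (int ?c) * p powi (- 1) =
      p powi (euler + 1 + - int (card F) + int ?c + - 1)"
    by (simp only: power_int_add [OF disjI1 [OF p]])
  \<comment> \<open>The Euler count eliminates both \<open>euler\<close> and \<open>card F\<close>;
    what remains is twice the Betti number minus the number of kept crossings.\<close>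
  also have "euler + 1 + - int (card F) + int ?c + - 1 = - int ?Z + int (2 * (?c - ?m))"
    using curves_euler [OF F, of s] comps_le_curves [OF F, of s] by (simp add: of_nat_diff)
  also have "p powi (- int ?Z + int (2 * (?c - ?m))) = p powi (- int ?Z) * p ^ (2 * (?c - ?m))"
    by (simp only: power_int_add [OF disjI1 [OF p]] power_int_of_nat)
  finally show "- (p powi (euler + 1)) * ((1 / p) ^ card F *
      (- p) powi (int (num_components (state_graph (boundary_link D F) \<tau>)) - 1)) =
      (- p) ^ ?z * (p powi (- int ?Z) * weight s p F)"
    by (simp add: weight_def mult.assoc mult.left_commute)
qed

text \<open>Exchanging the two sums puts the sum over cuts inside, for a fixed smoothing of the
  boundary link. There the turnbacks vanish, and the remaining smoothings are regrouped by the
  marker of each crossing.\<close>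

lemma yamada_eq_jaeger:
  fixes a :: "'k::field"
  assumes a: "a \<noteq> 0" and phi: "phi a \<noteq> 0"
  shows "yamada D (a ^ 4) = - (phi a powi (euler + 1) * jaeger D a)"
proof -
  define p where "p = phi a"
  have p: "p \<noteq> 0" using phi by (simp add: p_def)
  let ?C = "crossings D"
  let ?N = "\<lambda>F \<tau>. num_components (state_graph (boundary_link D F) \<tau>)"
  let ?q = "\<lambda>\<tau>. restrict (corners_at (corner_split \<tau>)) ?C"
  let ?S = "\<lambda>\<tau>. \<Sum>F\<in>Pow (strands D). (1 / p) ^ card F * (- p) powi (int (?N F \<tau>) - 1)"
  \<comment> \<open>\<open>G\<close> is the part that depends only on the markers, \<open>V\<close>
    the local weight including an inner circle. The negative power of \<open>p\<close> in
    \<open>G\<close> is cancelled by the local sums \<open>p\<close> of the crossings marked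
    \<open>Zero\<close>.\<close>
  define G where "G s = p powi (- int (card {x \<in> ?C. s x = Zero})) *
    h_poly (state_graph D s) (- 1) (- (p ^ 2))" for s
  define V where "V b = corner_weight a b * (if b = (True, True, True, True) then - p else 1)" for b
  have delta: "- (a powi 2) - a powi (- 2) = - p" by (simp add: p_def phi_def)
  have "jaeger D a = (\<Sum>F\<in>Pow (strands D). \<Sum>\<tau>\<in>X \<rightarrow>\<^sub>E {Pos, Neg}.
      (\<Prod>x\<in>?C. corner_weight a (?q \<tau> x)) * ((1 / p) ^ card F * (- p) powi (int (?N F \<tau>) - 1)))"
    unfolding jaeger_def R_poly_def bracket_def delta sum_distrib_left p_def [symmetric]
    by (intro sum.cong) (simp_all add: link_fields(2) state_weight_corners [OF a] mult.left_commute)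
  also have "\<dots> = (\<Sum>\<tau>\<in>X \<rightarrow>\<^sub>E {Pos, Neg}. (\<Prod>x\<in>?C. corner_weight a (?q \<tau> x)) * ?S \<tau>)"
    unfolding sum_distrib_left by (rule sum.swap)
  finally have "- (p powi (euler + 1) * jaeger D a) =
      (\<Sum>\<tau>\<in>X \<rightarrow>\<^sub>E {Pos, Neg}. (\<Prod>x\<in>?C. corner_weight a (?q \<tau> x)) * (- (p powi (euler + 1)) * ?S \<tau>))"
    by (simp add: sum_distrib_left sum_negf mult.left_commute)
  also have "\<dots> = (\<Sum>\<tau>\<in>X \<rightarrow>\<^sub>E {Pos, Neg}. (\<lambda>q. if \<forall>x\<in>?C. no_turnback (q x)
      then (\<Prod>x\<in>?C. V (q x)) * G (restrict (corner_marker \<circ> q) ?C) else 0) (?q \<tau>))"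
  proof (rule sum.cong [OF refl])
    fix \<tau> assume \<tau>': "\<tau> \<in> X \<rightarrow>\<^sub>E {Pos, Neg}"
    then have \<tau>: "\<tau> d \<in> {Pos, Neg}" if "d \<in> X" for d using that by (rule PiE_mem)
    show "(\<Prod>x\<in>?C. corner_weight a (?q \<tau> x)) * (- (p powi (euler + 1)) * ?S \<tau>) =
      (\<lambda>q. if \<forall>x\<in>?C. no_turnback (q x)
        then (\<Prod>x\<in>?C. V (q x)) * G (restrict (corner_marker \<circ> q) ?C) else 0) (?q \<tau>)"
    proof (cases "\<forall>x\<in>?C. no_turnback (?q \<tau> x)")
      case True
      let ?s = "restrict (corner_marker \<circ> ?q \<tau>) ?C"
      have "- (p powi (euler + 1)) * ?S \<tau> = (- p) ^ card (inner_circles (corner_split \<tau>)) * G ?s"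
        unfolding G_def by (rule band_sum_state [OF p \<tau>]) (use True in auto)
      also have "(- p) ^ card (inner_circles (corner_split \<tau>)) =
          (\<Prod>x\<in>?C. if ?q \<tau> x = (True, True, True, True) then - p else 1)"
        unfolding inner_circles_corners
        by (subst prod_if_card) (auto intro!: arg_cong [where f = "\<lambda>A. (- p) ^ card A"])
      finally have S: "- (p powi (euler + 1)) * ?S \<tau> =
          (\<Prod>x\<in>?C. if ?q \<tau> x = (True, True, True, True) then - p else 1) * G ?s" .
      have "(\<Prod>x\<in>?C. V (?q \<tau> x)) = (\<Prod>x\<in>?C. corner_weight a (?q \<tau> x)) *
          (\<Prod>x\<in>?C. if ?q \<tau> x = (True, True, True, True) then - p else 1)"
        unfolding V_def by (rule prod.distrib)
      then show ?thesis unfolding if_P [OF True] S by (simp only: mult.assoc)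
    next
      case False
      then have "\<not> (\<forall>x\<in>?C. no_turnback (corners_at (corner_split \<tau>) x))" by simp
      then obtain d where d: "d \<in> X" "\<not> corner_split \<tau> d" "\<not> corner_split \<tau> (\<rho> d)"
        unfolding no_turnback_iff by blast
      have "?S \<tau> = 0" by (rule band_sum_turnback [OF p _ d]) (rule \<tau>)
      then show ?thesis unfolding if_not_P [OF False] by simp
    qed
  qed
  also have "\<dots> = (\<Sum>q\<in>?C \<rightarrow>\<^sub>E UNIV. if \<forall>x\<in>?C. no_turnback (q x)
      then (\<Prod>x\<in>?C. V (q x)) * G (restrict (corner_marker \<circ> q) ?C) else 0)"
    by (rule sum.reindex_bij_betw [OF corners_bij])
  also have "\<dots> = (\<Sum>q\<in>?C \<rightarrow>\<^sub>E Collect no_turnback.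
      (\<Prod>x\<in>?C. V (q x)) * G (restrict (corner_marker \<circ> q) ?C))"
    by (rule sum.mono_neutral_cong_right) (auto intro!: finite_PiE simp: PiE_iff)
  also have "\<dots> = (\<Sum>s\<in>?C \<rightarrow>\<^sub>E UNIV.
      (\<Prod>x\<in>?C. \<Sum>b\<in>{b \<in> Collect no_turnback. corner_marker b = s x}. V b) * G s)"
    by (rule sum_PiE_by_type) (auto simp: UNIV_marker)
  also have "\<dots> = yamada D (a ^ 4)"
    unfolding yamada_def UNIV_marker
  proof (rule sum.cong [OF refl])
    fix s assume s: "s \<in> ?C \<rightarrow>\<^sub>E {Pos, Neg, Zero}"
    have a4: "a ^ 4 \<noteq> 0" using a by simp
    have "(\<Prod>x\<in>?C. \<Sum>b\<in>{b \<in> Collect no_turnback. corner_marker b = s x}. V b) =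
        (\<Prod>x\<in>?C. case s x of Pos \<Rightarrow> a ^ 4 | Neg \<Rightarrow> inverse (a ^ 4) | Zero \<Rightarrow> p)"
      unfolding V_def p_def by (intro prod.cong refl crossing_expansion [OF a])
    also have "\<dots> = (\<Prod>x\<in>?C. (if s x = Pos then a ^ 4 else 1) *
        (if s x = Neg then inverse (a ^ 4) else 1) * (if s x = Zero then p else 1))"
    proof (rule prod.cong [OF refl])
      fix x
      show "(case s x of Pos \<Rightarrow> a ^ 4 | Neg \<Rightarrow> inverse (a ^ 4) | Zero \<Rightarrow> p) = (if s x = Pos then a ^ 4 else 1) *
        (if s x = Neg then inverse (a ^ 4) else 1) * (if s x = Zero then p else 1)"
        by (cases "s x") simp_all
    qed
    also have "\<dots> = (a ^ 4) ^ card {x \<in> ?C. s x = Pos} * inverse (a ^ 4) ^ card {x \<in> ?C. s x = Neg} *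
        p ^ card {x \<in> ?C. s x = Zero}"
      by (simp only: prod.distrib prod_if_card finites)
    also have "(a ^ 4) ^ card {x \<in> ?C. s x = Pos} * inverse (a ^ 4) ^ card {x \<in> ?C. s x = Neg} =
        (a ^ 4) powi state_weight D s"
      unfolding state_weight_def using a4
      by (simp only: power_int_diff [OF disjI1 [OF a4]] power_int_of_nat divide_inverse power_inverse)
    finally have *: "(\<Prod>x\<in>?C. \<Sum>b\<in>{b \<in> Collect no_turnback. corner_marker b = s x}. V b) =
        (a ^ 4) powi state_weight D s * p ^ card {x \<in> ?C. s x = Zero}" .
    \<comment> \<open>This identity is the reason for substituting A^4: there the second argument of
      \<open>h_poly\<close> is minus the square of phi.\<close>
    have "p ^ 2 = a ^ 4 + 2 + inverse (a ^ 4)"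
      using a by (simp add: p_def phi_def power_int_minus power2_eq_square power4_eq_xxxx algebra_simps)
    then have y: "- (a ^ 4) - 2 - inverse (a ^ 4) = - (p ^ 2)" by simp
    show "(\<Prod>x\<in>?C. \<Sum>b\<in>{b \<in> Collect no_turnback. corner_marker b = s x}. V b) * G s =
        (a ^ 4) powi state_weight D s * h_poly (state_graph D s) (- 1) (- (a ^ 4) - 2 - inverse (a ^ 4))"
      unfolding * y G_def using p by (simp add: power_int_minus)
  qed
  finally show ?thesis by (simp add: p_def)
qed

end

section \<open>Specialization to the variable A\<close>

lemma var_A_nonzero: "var_A \<noteq> 0"
  by (simp add: var_A_def Zero_fract_def eq_fract)

text \<open>Multiplication by A^2 turns phi into A^4 + 1, a polynomial with value 1 at 0.\<close>

lemma phi_var_A_nonzero: "phi var_A \<noteq> 0"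
proof
  assume "phi var_A = 0"
  then have "var_A ^ 2 + inverse (var_A ^ 2) = 0" by (simp add: phi_def power_int_minus)
  then have "var_A ^ 2 * (var_A ^ 2 + inverse (var_A ^ 2)) = 0" by simp
  then have "var_A ^ 4 + 1 = 0"
    using var_A_nonzero by (simp add: algebra_simps power4_eq_xxxx power2_eq_square)
  then have "Fract ([:0, 1:] ^ 4 + 1 :: rat poly) 1 = 0"
    by (simp add: var_A_def One_fract_def power4_eq_xxxx)
  then have "[:0, 1:] ^ 4 + 1 = (0 :: rat poly)"
    by (simp add: Zero_fract_def eq_fract)
  then have "poly ([:0, 1:] ^ 4 + 1 :: rat poly) 0 = 0" by simp
  then show False by simp
qed

theorem proposition5:
  fixes G :: "('a, 'b) mgraph" and D :: "('v, 'd) diagram"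
  assumes "finite_graph G"
    and "planar_graph G"
    and "diagram_of D G"
  shows "yamada D (var_A ^ 4) =
    - (phi var_A powi (int (card (gedges G)) - int (card (gverts G)) + 1) * jaeger D var_A)"
proof -
  interpret link_diagram D
    using assms(3) by unfold_locales (simp add: diagram_of_def)
  have "graph_iso (underlying_graph D) G" using assms(3) by (simp add: diagram_of_def)
  then have "card (gverts (underlying_graph D)) = card (gverts G)"
    "card (gedges (underlying_graph D)) = card (gedges G)"
    by (auto simp: graph_iso_def bij_betw_same_card)
  \<comment> \<open>The isomorphism enters only through the numbers of vertices and edges, whose
    difference \<open>underlying_graph_euler\<close> has computed.\<close>
  then have "euler = int (card (gedges G)) - int (card (gverts G))"
    using underlying_graph_euler by simp
  then show ?thesis
    using yamada_eq_jaeger [OF var_A_nonzero phi_var_A_nonzero] by simp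
qed

end
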